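(* Let $d>6$ and assume that $( * )$ (defined in the context) holds. There exists $C>0$ such that, for every $p\leq p_c$, every $S\subset \mathbb Z^d$ containing $0$, and every $\Lambda$ with $S\subset\Lambda\subset\mathbb Z^d$, $$\varphi_p(\Lambda)\leq C\cdot \varphi_p(S).$$
   Context: Setting: $\mathcal E$ is a fixed edge set on $\mathbb Z^d$, either nearest-neighbour, $\mathcal E=\{\{x,y\}:\|x-y\|_1=1\}$, or spread-out with parameter $L\ge 1$, $\mathcal E=\{\{x,y\}: x\neq y,\ \|x-y\|_1\le L\}$. Write $x\sim y$ if $\{x,y\}\in\mathcal E$. $\mathbb P_p$ is Bernoulli bond percolation (each edge of $\mathcal E$ open independently with probability $p$), and $p_c:=\inf\{p:\mathbb P_p[0\leftrightarrow\infty]>0\}\in(0,1)$. $\{x\xleftrightarrow{S}y\}$ is the event that there is an open path from $x$ to $y$ with all vertices in $S$; $\tau_{S,p}(x,y):=\mathbb P_p[x\xleftrightarrow{S}y]$; $\tau_p:=\tau_{\mathbb Z^d,p}$. For $S\ni 0$, $$\varphi_p(S):=\sum_{u\in S,\ v\notin S,\ u\sim v}\tau_{S,p}(0,u)\cdot p .$$ Assumption $( * )$: there are constants $0<a\le b<\infty$ with $a(1\vee|x-y|)^{-(d-2)}\le\tau_{p_c}(x,y)\le b(1\vee|x-y|)^{-(d-2)}$ for all $x,y\in\mathbb Z^d$, where $|\cdot|$ is the $\ell^\infty$ norm. *)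

theory Defs
  imports "HOL-Probability.Probability"
begin

definition l1_norm :: "int ^ 'd \<Rightarrow> int"
  where "l1_norm x = (\<Sum>i\<in>UNIV. \<bar>x $ i\<bar>)"

definition linf_norm :: "int ^ 'd \<Rightarrow> int"
  where "linf_norm x = Max (range (\<lambda>i. \<bar>x $ i\<bar>))"

definition nearest_neighbour_edges :: "(int ^ 'd) set set"
  where "nearest_neighbour_edges = {{x, y} | x y. l1_norm (x - y) = 1}"

definition spread_out_edges :: "nat \<Rightarrow> (int ^ 'd) set set"
  where "spread_out_edges L = {{x, y} | x y. x \<noteq> y \<and> l1_norm (x - y) \<le> int L}"

definition lattice_edges :: "(int ^ 'd) set set \<Rightarrow> bool"
  where "lattice_edges E \<longleftrightarrow>
    E = nearest_neighbour_edges \<or> (\<exists>L\<ge>1. E = spread_out_edges L)"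

text \<open>A configuration \<open>\<omega>\<close> maps each edge in \<open>E\<close> to \<open>True\<close> (open) or \<open>False\<close> (closed). The
  parameter \<open>p\<close> is meant to lie in \<open>[0, 1]\<close>; outside, \<^const>\<open>bernoulli_pmf\<close> truncates it.\<close>

definition bond_percolation ::
    "(int ^ 'd) set set \<Rightarrow> real \<Rightarrow> ((int ^ 'd) set \<Rightarrow> bool) measure"
  where "bond_percolation E p = PiM E (\<lambda>_. measure_pmf (bernoulli_pmf p))"

text \<open>A path may consist of a single vertex, so \<open>x\<close> is connected to itself in \<open>S\<close> iff \<open>x \<in> S\<close>;
  there is no connection in \<open>S\<close> if one of the end points lies outside \<open>S\<close>.\<close>

definition connected_in ::
    "(int ^ 'd) set set \<Rightarrow> ((int ^ 'd) set \<Rightarrow> bool) \<Rightarrow> (int ^ 'd) set \<Rightarrow>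
      int ^ 'd \<Rightarrow> int ^ 'd \<Rightarrow> bool"
  where "connected_in E \<omega> S x y \<longleftrightarrow>
    (\<exists>\<gamma>. \<gamma> \<noteq> [] \<and> hd \<gamma> = x \<and> last \<gamma> = y \<and> set \<gamma> \<subseteq> S \<and>
         successively (\<lambda>u v. {u, v} \<in> E \<and> \<omega> {u, v}) \<gamma>)"

definition two_point ::
    "(int ^ 'd) set set \<Rightarrow> (int ^ 'd) set \<Rightarrow> real \<Rightarrow> int ^ 'd \<Rightarrow> int ^ 'd \<Rightarrow> real"
  where "two_point E S p x y =
    measure (bond_percolation E p)
      {\<omega> \<in> space (bond_percolation E p). connected_in E \<omega> S x y}"

text \<open>The event that \<open>0\<close> is connected to infinity means that the open cluster of \<open>0\<close> is infinite.\<close>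

definition percolation_probability :: "(int ^ 'd) set set \<Rightarrow> real \<Rightarrow> real"
  where "percolation_probability E p =
    measure (bond_percolation E p)
      {\<omega> \<in> space (bond_percolation E p). infinite {y. connected_in E \<omega> UNIV 0 y}}"

definition critical_probability :: "(int ^ 'd) set set \<Rightarrow> real"
  where "critical_probability E = Inf {p \<in> {0..1}. percolation_probability E p > 0}"

text \<open>The set \<open>S\<close> may be infinite, so the sum of nonnegative terms is taken in \<open>[0, \<infinity>]\<close>.\<close>

definition phi :: "(int ^ 'd) set set \<Rightarrow> real \<Rightarrow> (int ^ 'd) set \<Rightarrow> ennreal"
  where "phi E p S =
    (\<Sum>\<^sub>\<infinity>(u, v)\<in>{(u, v). u \<in> S \<and> v \<notin> S \<and> {u, v} \<in> E}. ennreal (two_point E S p 0 u * p))"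

definition critical_two_point_bounds :: "(int ^ 'd) set set \<Rightarrow> bool"
  where "critical_two_point_bounds E \<longleftrightarrow>
    (\<exists>a b. 0 < a \<and> a \<le> b \<and>
      (\<forall>x y. let r = real_of_int (max 1 (linf_norm (x - y))) powi (- (int CARD('d) - 2));
                 \<tau> = two_point E UNIV (critical_probability E) x y
             in a * r \<le> \<tau> \<and> \<tau> \<le> b * r))"

end

theory Submission imports Defs
begin

text \<open>By the Simon--Lieb inequality, it suffices to bound \<open>\<phi>\<close> at criticality by a constant, uniformly in
  the finite set \<open>S\<close> and the starting point \<open>z \<in> S\<close>. The key estimate is that the sum over boundary
  points \<open>u\<close> of \<open>S\<close> of the expected volume in \<open>ball(u, r)\<close> of the cluster of \<open>z\<close>, on the event that
  \<open>z\<close> is connected to \<open>u\<close> in \<open>S\<close>, is at most \<open>C r^(9/2) \<phi>(S)\<close>. As \<open>9/2 < d - 2\<close>, for a large fixed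
  \<open>R\<close> the part of this cluster outside \<open>ball(u, R)\<close> is too thin to block all connections from a neighbour
  of \<open>u\<close> to a far away point \<open>x\<close>. Hence, at a cost depending only on \<open>R\<close>, a surgery in a ball of radius
  \<open>R\<close> makes an edge leaving \<open>S\<close> near \<open>u\<close> open and pivotal for \<open>z \<leftrightarrow> x\<close>, with \<open>z\<close> connected to
  it in \<open>S\<close>. There is at most one such edge, so \<open>\<phi>(S) \<tau>(u, x)\<close> is at most a constant times
  \<open>\<tau>(z, x)\<close>, which bounds \<open>\<phi>(S)\<close> as \<open>x \<rightarrow> \<infinity>\<close>.\<close>

section \<open>Finite Bernoulli configurations\<close>

text \<open>A critical cluster meets a ball of radius r in about r^4 points, and r^4 is small
  against r^(d-2) exactly when d > 6; the exponent 9/2 leaves room above 4 and still lies below d -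
  2 for every integer d > 6. The obstacle is that nothing is known from below about connections
  inside \<open>S\<close>, so asking \<open>z\<close> to be connected to \<open>u\<close> in
  \<open>S\<close> might distort its cluster near \<open>u\<close>. A tree-graph bound alone yields
  a branch point whose connections inside \<open>S\<close> cannot be compared sharply with
  \<phi>(S). Only a crude comparison is available, losing a power of the scale; it is affordable
  where a moment of high order pays for it, that is, for a cluster explored locally around
  \<open>u\<close>. The ball of the surgery is centred at a neighbour of \<open>u\<close> outside
  \<open>S\<close>, so that a path to its centre must leave \<open>S\<close>; and only the part of
  the cluster outside the ball is revealed, which keeps the edges at the ball free. All estimates
  are made in finite volumes at the critical parameter, where expectations are finite sums; limits
  in the volume and monotonicity in the parameter enter at the very end.\<close>

definition bex :: "real \<Rightarrow> 'e set \<Rightarrow> ('e set \<Rightarrow> real) \<Rightarrow> real"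
  where "bex p F g = (\<Sum>K\<in>Pow F. p ^ card K * (1 - p) ^ card (F - K) * g K)"

definition bpr :: "real \<Rightarrow> 'e set \<Rightarrow> ('e set \<Rightarrow> bool) \<Rightarrow> real"
  where "bpr p F A = bex p F (\<lambda>K. of_bool (A K))"

lemma bex_empty [simp]: "bex p {} g = g {}"
  by (simp add: bex_def)

text \<open>Conditioning on the state of the single edge \<open>e\<close>. The inductions over the
  edge set below go through this recursion, so measure theory is postponed to the passage to
  infinite volume.\<close>

lemma bex_insert:
  assumes "finite F" "e \<notin> F"
  shows "bex p (insert e F) g = (1 - p) * bex p F g + p * bex p F (\<lambda>K. g (insert e K))"
proof -
  have sub: "finite K" "e \<notin> K" if "K \<in> Pow F" for K
    using that assms finite_subset by auto
  have inj: "inj_on (insert e) (Pow F)"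
    using assms(2) by (auto simp: inj_on_def insert_ident)
  have "bex p (insert e F) g =
      (\<Sum>K\<in>Pow F. p ^ card K * (1 - p) ^ card (insert e F - K) * g K) +
      (\<Sum>K\<in>insert e ` Pow F. p ^ card K * (1 - p) ^ card (insert e F - K) * g K)"
    unfolding bex_def Pow_insert using assms
    by (intro sum.union_disjoint) auto
  also have "(\<Sum>K\<in>Pow F. p ^ card K * (1 - p) ^ card (insert e F - K) * g K) = (1 - p) * bex p F g"
    unfolding bex_def sum_distrib_left
  proof (intro sum.cong refl)
    fix K assume K: "K \<in> Pow F"
    have "insert e F - K = insert e (F - K)" using sub[OF K] by auto
    then have "card (insert e F - K) = Suc (card (F - K))" using assms by simp
    then show "p ^ card K * (1 - p) ^ card (insert e F - K) * g K =
        (1 - p) * (p ^ card K * (1 - p) ^ card (F - K) * g K)" by simp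
  qed
  also have "(\<Sum>K\<in>insert e ` Pow F. p ^ card K * (1 - p) ^ card (insert e F - K) * g K) =
      p * bex p F (\<lambda>K. g (insert e K))"
    unfolding bex_def sum_distrib_left sum.reindex[OF inj]
  proof (intro sum.cong refl)
    fix K assume K: "K \<in> Pow F"
    have "insert e F - insert e K = F - K" using assms K by auto
    then show "((\<lambda>K. p ^ card K * (1 - p) ^ card (insert e F - K) * g K) \<circ> insert e) K =
        p * (p ^ card K * (1 - p) ^ card (F - K) * g (insert e K))" using sub[OF K] by simp
  qed
  finally show ?thesis .
qed

lemma bex_cong: "(\<And>K. K \<subseteq> F \<Longrightarrow> g K = h K) \<Longrightarrow> bex p F g = bex p F h"
  unfolding bex_def by (intro sum.cong) auto

lemma bex_mono:
  assumes "0 \<le> p" "p \<le> 1" "\<And>K. K \<subseteq> F \<Longrightarrow> g K \<le> h K"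
  shows "bex p F g \<le> bex p F h"
  unfolding bex_def using assms by (intro sum_mono mult_left_mono) auto

lemma bex_cmult: "bex p F (\<lambda>K. c * g K) = c * bex p F g"
  unfolding bex_def by (simp add: sum_distrib_left mult_ac)

lemma bex_cmult_right: "bex p F (\<lambda>K. g K * c) = bex p F g * c"
  using bex_cmult[of p F c g] by (simp add: mult.commute)

lemma bex_add: "bex p F (\<lambda>K. g K + h K) = bex p F g + bex p F h"
  unfolding bex_def by (simp add: sum.distrib distrib_left)

lemma bex_diff: "bex p F (\<lambda>K. g K - h K) = bex p F g - bex p F h"
  unfolding bex_def by (simp add: sum_subtractf right_diff_distrib)

lemma bex_sum: "bex p F (\<lambda>K. \<Sum>i\<in>I. g i K) = (\<Sum>i\<in>I. bex p F (g i))"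
  unfolding bex_def by (subst sum.swap) (simp add: sum_distrib_left)

lemma bex_const [simp]: "finite F \<Longrightarrow> bex p F (\<lambda>K. c) = c"
  by (induction F rule: finite_induct) (simp_all add: bex_insert algebra_simps)

lemma bex_nonneg: "0 \<le> p \<Longrightarrow> p \<le> 1 \<Longrightarrow> (\<And>K. K \<subseteq> F \<Longrightarrow> 0 \<le> g K) \<Longrightarrow> 0 \<le> bex p F g"
  unfolding bex_def by (intro sum_nonneg mult_nonneg_nonneg) auto

lemma bex_Un:
  assumes "finite F1" "finite F2" "F1 \<inter> F2 = {}"
  shows "bex p (F1 \<union> F2) g = bex p F1 (\<lambda>K1. bex p F2 (\<lambda>K2. g (K1 \<union> K2)))"
  using assms
proof (induction F1 arbitrary: g rule: finite_induct)
  case (insert e F1)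
  then have "e \<notin> F1 \<union> F2" by auto
  then have "bex p (insert e F1 \<union> F2) g =
      (1 - p) * bex p (F1 \<union> F2) g + p * bex p (F1 \<union> F2) (\<lambda>K. g (insert e K))"
    using insert.hyps insert.prems(1) by (simp add: bex_insert)
  also have "\<dots> = bex p (insert e F1) (\<lambda>K1. bex p F2 (\<lambda>K2. g (K1 \<union> K2)))"
    using insert.IH insert.hyps insert.prems by (simp add: bex_insert)
  finally show ?case .
qed simp

lemma bex_restrict:
  assumes "finite F" "F' \<subseteq> F" "\<And>K. K \<subseteq> F \<Longrightarrow> g K = g (K \<inter> F')"
  shows "bex p F g = bex p F' g"
proof -
  have fin: "finite F'" "finite (F - F')" using assms finite_subset by auto
  have "bex p F g = bex p (F' \<union> (F - F')) g" using assms(2) by (simp add: Un_absorb1)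
  also have "\<dots> = bex p F' (\<lambda>K1. bex p (F - F') (\<lambda>K2. g (K1 \<union> K2)))"
    using fin by (intro bex_Un) auto
  also have "\<dots> = bex p F' (\<lambda>K1. bex p (F - F') (\<lambda>K2. g K1))"
  proof (intro bex_cong)
    fix K1 K2 assume "K1 \<subseteq> F'" "K2 \<subseteq> F - F'"
    then have "(K1 \<union> K2) \<inter> F' = K1" "K1 \<union> K2 \<subseteq> F" using assms(2) by auto
    then show "g (K1 \<union> K2) = g K1" using assms(3)[of "K1 \<union> K2"] by simp
  qed
  also have "\<dots> = bex p F' g" using fin by simp
  finally show ?thesis .
qed

text \<open>Product structure over \<open>F1\<close> and \<open>F - F1\<close>. It serves where the
  cluster of \<open>z\<close> outside a ball is revealed: \<open>F1\<close> then consists of the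
  edges that touch this cluster.\<close>

lemma bex_indep:
  assumes "finite F" "F1 \<subseteq> F"
    and "\<And>K. K \<subseteq> F \<Longrightarrow> g K = g (K \<inter> F1)" "\<And>K. K \<subseteq> F \<Longrightarrow> h K = h (K - F1)"
  shows "bex p F (\<lambda>K. g K * h K) = bex p F g * bex p F h"
proof -
  have fin: "finite F1" "finite (F - F1)" using assms finite_subset by auto
  have hF: "bex p F h = bex p (F - F1) h"
  proof (rule bex_restrict)
    fix K assume "K \<subseteq> F"
    then have "K \<inter> (F - F1) = K - F1" by auto
    then show "h K = h (K \<inter> (F - F1))" using assms(4)[OF \<open>K \<subseteq> F\<close>] by simp
  qed (use assms in auto)
  have "bex p F (\<lambda>K. g K * h K) = bex p (F1 \<union> (F - F1)) (\<lambda>K. g K * h K)"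
    using assms(2) by (simp add: Un_absorb1)
  also have "\<dots> = bex p F1 (\<lambda>K1. bex p (F - F1) (\<lambda>K2. g (K1 \<union> K2) * h (K1 \<union> K2)))"
    using fin by (intro bex_Un) auto
  also have "\<dots> = bex p F1 (\<lambda>K1. bex p (F - F1) (\<lambda>K2. g K1 * h K2))"
  proof (intro bex_cong)
    fix K1 K2 assume K: "K1 \<subseteq> F1" "K2 \<subseteq> F - F1"
    then have "(K1 \<union> K2) \<inter> F1 = K1" "(K1 \<union> K2) - F1 = K2" "K1 \<union> K2 \<subseteq> F"
      using assms(2) by auto
    then show "g (K1 \<union> K2) * h (K1 \<union> K2) = g K1 * h K2"
      using assms(3)[of "K1 \<union> K2"] assms(4)[of "K1 \<union> K2"] by simp
  qed
  also have "\<dots> = bex p F1 g * bex p (F - F1) h"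
    by (simp only: bex_cmult bex_cmult_right)
  also have "bex p F1 g = bex p F g"
    using assms by (intro bex_restrict[symmetric])
  finally show ?thesis by (simp only: hF)
qed

section \<open>Monotonicity in the parameter and the Harris inequality\<close>

lemma mono_insert:
  assumes "mono g"
  shows "mono (\<lambda>K. g (insert e K))"
  by (rule monoI, rule monoD[OF assms]) auto

text \<open>The expectation is affine in the weight of one edge, with slope the difference between
  its open and closed states, nonnegative for monotone \<open>g\<close>. The parameter is raised
  first on the other edges, then on \<open>e\<close>.\<close>

lemma bex_mono_p:
  assumes "finite F" "0 \<le> p" "p \<le> p'" "p' \<le> 1" "mono g"
  shows "bex p F g \<le> bex p' F g"
  using assms(1,5)
proof (induction F arbitrary: g rule: finite_induct)
  case (insert e F)
  have m1: "mono (\<lambda>K. g (insert e K))"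
    using insert.prems by (simp_all add: mono_insert)
  let ?a = "bex p F g" and ?b = "bex p F (\<lambda>K. g (insert e K))"
  let ?a' = "bex p' F g" and ?b' = "bex p' F (\<lambda>K. g (insert e K))"
  have 1: "?a \<le> ?a'" "?b \<le> ?b'" using insert.IH insert.prems m1 by auto
  have 2: "?a' \<le> ?b'"
    using assms insert.prems by (intro bex_mono) (auto intro: monoD)
  have "(1 - p) * ?a + p * ?b \<le> (1 - p) * ?a' + p * ?b'"
    using 1 assms by (intro add_mono mult_left_mono) auto
  also have "\<dots> = ?a' + p * (?b' - ?a')" by (simp add: algebra_simps)
  also have "\<dots> \<le> ?a' + p' * (?b' - ?a')"
    using 2 assms by (intro add_left_mono mult_right_mono) auto
  also have "\<dots> = (1 - p') * ?a' + p' * ?b'" by (simp add: algebra_simps)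
  finally show ?case using insert.hyps by (simp add: bex_insert)
qed simp

lemma harris:
  assumes "finite F" "0 \<le> p" "p \<le> 1" "mono g" "mono h"
  shows "bex p F g * bex p F h \<le> bex p F (\<lambda>K. g K * h K)"
  using assms(1,4,5)
proof (induction F arbitrary: g h rule: finite_induct)
  case (insert e F)
  have m: "mono (\<lambda>K. g (insert e K))" "mono (\<lambda>K. h (insert e K))"
    using insert.prems by (simp_all add: mono_insert)
  define g0 g1 h0 h1 where d: "g0 = bex p F g" "g1 = bex p F (\<lambda>K. g (insert e K))"
     "h0 = bex p F h" "h1 = bex p F (\<lambda>K. h (insert e K))"
  have le: "g0 \<le> g1" "h0 \<le> h1"
    unfolding d using assms insert.prems by (auto intro!: bex_mono intro: monoD)
  \<comment> \<open>Splitting on \<open>e\<close> leaves a covariance term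
    \<open>p * (1 - p) * ((g1 - g0) * (h1 - h0))\<close>, which is nonnegative because both
    conditional expectations grow when \<open>e\<close> opens.\<close>
  have "((1 - p) * g0 + p * g1) * ((1 - p) * h0 + p * h1) =
      (1 - p) * (g0 * h0) + p * (g1 * h1) - p * (1 - p) * ((g1 - g0) * (h1 - h0))"
    by (simp add: algebra_simps)
  also have "\<dots> \<le> (1 - p) * (g0 * h0) + p * (g1 * h1)"
    using assms le by simp
  also have "\<dots> \<le> (1 - p) * bex p F (\<lambda>K. g K * h K) +
      p * bex p F (\<lambda>K. g (insert e K) * h (insert e K))"
    unfolding d using assms insert.IH[OF insert.prems] insert.IH[OF m]
    by (intro add_mono mult_left_mono) auto
  finally show ?case using insert.hyps by (simp add: bex_insert d)
qed simp

lemma bpr_nonneg: "0 \<le> p \<Longrightarrow> p \<le> 1 \<Longrightarrow> 0 \<le> bpr p F A"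
  unfolding bpr_def by (rule bex_nonneg) auto

lemma bpr_mono:
  assumes "0 \<le> p" "p \<le> 1" "\<And>K. K \<subseteq> F \<Longrightarrow> A K \<Longrightarrow> B K"
  shows "bpr p F A \<le> bpr p F B"
  unfolding bpr_def using assms by (intro bex_mono) auto

lemma bpr_le_1: "finite F \<Longrightarrow> 0 \<le> p \<Longrightarrow> p \<le> 1 \<Longrightarrow> bpr p F A \<le> 1"
  using bpr_mono[of p F A "\<lambda>_. True"] by (simp add: bpr_def)

lemma bpr_Un_le:
  assumes "0 \<le> p" "p \<le> 1" "finite I" "\<And>K. K \<subseteq> F \<Longrightarrow> A K \<Longrightarrow> \<exists>i\<in>I. B i K"
  shows "bpr p F A \<le> (\<Sum>i\<in>I. bpr p F (B i))"
proof -
  have "of_bool (A K) \<le> (\<Sum>i\<in>I. of_bool (B i K) :: real)" if K: "K \<subseteq> F" for K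
  proof (cases "A K")
    case True
    then obtain i where i: "i \<in> I" "B i K" using assms(4)[OF K True] by blast
    have "of_bool (B i K) \<le> (\<Sum>i\<in>I. of_bool (B i K) :: real)"
      by (rule member_le_sum) (use i assms(3) in simp_all)
    then show ?thesis using True i by simp
  qed (auto intro: sum_nonneg)
  then show ?thesis
    unfolding bpr_def bex_sum[symmetric] using assms by (intro bex_mono) auto
qed

lemma bpr_disj_le:
  assumes "0 \<le> p" "p \<le> 1" "\<And>K. K \<subseteq> F \<Longrightarrow> A K \<Longrightarrow> B K \<or> C K"
  shows "bpr p F A \<le> bpr p F B + bpr p F C"
  unfolding bpr_def bex_add[symmetric] using assms by (intro bex_mono) (auto dest: assms(3))

section \<open>Increasing events and disjoint occurrence\<close>

definition increasing :: "('e set \<Rightarrow> bool) \<Rightarrow> bool" where "increasing A \<longleftrightarrow> (\<forall>K K'. K \<subseteq> K' \<longrightarrow> A K \<longrightarrow> A K')"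

lemma increasingI: "(\<And>K K'. K \<subseteq> K' \<Longrightarrow> A K \<Longrightarrow> A K') \<Longrightarrow> increasing A" by (simp add: increasing_def)

lemma increasingD: "increasing A \<Longrightarrow> K \<subseteq> K' \<Longrightarrow> A K \<Longrightarrow> A K'" by (auto simp: increasing_def)

lemma increasing_mono: "increasing A \<Longrightarrow> mono (\<lambda>K. of_bool (A K) :: real)"
  by (intro monoI) (auto simp: increasing_def)

lemma bpr_harris:
  assumes "finite F" "0 \<le> p" "p \<le> 1" "increasing A" "increasing B"
  shows "bpr p F A * bpr p F B \<le> bpr p F (\<lambda>K. A K \<and> B K)"
  using harris[OF assms(1-3) increasing_mono[OF assms(4)] increasing_mono[OF assms(5)]]
  by (simp add: bpr_def of_bool_conj)

text \<open>The witnesses are sets \<open>K1\<close>, \<open>K2\<close> of open edges on which the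
  events already hold by themselves; for increasing events this is the usual disjoint occurrence.
  Nesting on the right expresses three disjoint events.\<close>

definition disjointly :: "('e set \<Rightarrow> bool) \<Rightarrow> ('e set \<Rightarrow> bool) \<Rightarrow> 'e set \<Rightarrow> bool"
  where "disjointly A B K \<longleftrightarrow> (\<exists>K1 K2. K1 \<subseteq> K \<and> K2 \<subseteq> K \<and> K1 \<inter> K2 = {} \<and> A K1 \<and> B K2)"

lemma disjointlyI: "K1 \<subseteq> K \<Longrightarrow> K2 \<subseteq> K \<Longrightarrow> K1 \<inter> K2 = {} \<Longrightarrow> A K1 \<Longrightarrow> B K2 \<Longrightarrow> disjointly A B K"
  unfolding disjointly_def by (intro exI[of _ K1] exI[of _ K2]) simp

lemma disjointlyE:
  assumes "disjointly A B K"
  obtains K1 K2 where "K1 \<subseteq> K" "K2 \<subseteq> K" "K1 \<inter> K2 = {}" "A K1" "B K2"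
  using assms unfolding disjointly_def by (elim exE conjE)

lemma increasing_disjointly [simp]: "increasing (disjointly A B)"
  unfolding increasing_def
proof (intro allI impI)
  fix K K' :: "'a set"
  assume "K \<subseteq> K'" "disjointly A B K"
  then obtain K1 K2 where "K1 \<subseteq> K" "K2 \<subseteq> K" "K1 \<inter> K2 = {}" "A K1" "B K2"
    unfolding disjointly_def by blast
  with \<open>K \<subseteq> K'\<close> show "disjointly A B K'"
    unfolding disjointly_def by (intro exI[of _ K1] exI[of _ K2]) auto
qed

text \<open>Revealing one edge at a time, and giving each of the two events its own copy of the revealed
  edge, can only increase the probability of the set of pairs; for products this is the van den
  Berg--Kesten inequality.\<close>

lemma bk_pairs:
  fixes D :: "'e set \<Rightarrow> 'e set \<Rightarrow> bool"
  assumes "finite F" "0 \<le> p" "p \<le> 1"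
    and "\<And>K1 K1' K2 K2'. K1 \<subseteq> K1' \<Longrightarrow> K2 \<subseteq> K2' \<Longrightarrow> D K1 K2 \<Longrightarrow> D K1' K2'"
  shows "bpr p F (\<lambda>K. \<exists>K1 K2. K1 \<subseteq> K \<and> K2 \<subseteq> K \<and> K1 \<inter> K2 = {} \<and> D K1 K2)
    \<le> bex p F (\<lambda>K1. bpr p F (D K1))"
  using assms(1,4)
proof (induction F arbitrary: D rule: finite_induct)
  case empty
  then show ?case by (auto simp: bpr_def)
next
  case (insert e F)
  define sq where "sq D K \<longleftrightarrow> (\<exists>K1 K2. K1 \<subseteq> K \<and> K2 \<subseteq> K \<and> K1 \<inter> K2 = {} \<and> D K1 K2)"
    for D :: "'e set \<Rightarrow> 'e set \<Rightarrow> bool" and K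
  define P2 where "P2 D = bex p F (\<lambda>K1. bpr p F (D K1))" for D :: "'e set \<Rightarrow> 'e set \<Rightarrow> bool"
  define i where "i = insert e"
  define D10 D01 D11 DU where Dd: "D10 = (\<lambda>K1 K2. D (i K1) K2)" "D01 = (\<lambda>K1 K2. D K1 (i K2))"
    "D11 = (\<lambda>K1 K2. D (i K1) (i K2))" "DU = (\<lambda>K1 K2. D (i K1) K2 \<or> D K1 (i K2))"
  have i_mono: "i K \<subseteq> i K'" if "K \<subseteq> K'" for K K' using that by (auto simp: i_def)
  have i_ge: "K \<subseteq> i K" for K by (auto simp: i_def)
  note Dm = insert.prems
  have IH: "bpr p F (sq D') \<le> P2 D'"
    if "\<And>K1 K1' K2 K2'. K1 \<subseteq> K1' \<Longrightarrow> K2 \<subseteq> K2' \<Longrightarrow> D' K1 K2 \<Longrightarrow> D' K1' K2'" for D'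
    unfolding sq_def[abs_def] P2_def by (rule insert.IH) (rule that)
  have IH0: "bpr p F (sq D) \<le> P2 D" by (rule IH) (rule Dm)
  have IHU: "bpr p F (sq DU) \<le> P2 DU"
  proof (rule IH)
    fix K1 K1' K2 K2' assume K: "K1 \<subseteq> K1'" "K2 \<subseteq> K2'" "DU K1 K2"
    then show "DU K1' K2'"
      using Dm[OF i_mono[OF K(1)] K(2)] Dm[OF K(1) i_mono[OF K(2)]] unfolding Dd by blast
  qed
  \<comment> \<open>With \<open>e\<close> open, at most one of the two disjoint witnesses uses it;
    \<open>DU\<close> grants it to either side.\<close>
  have split: "bpr p (insert e F) (sq D) \<le> (1 - p) * bpr p F (sq D) + p * bpr p F (sq DU)"
  proof -
    have "sq D (insert e K) \<Longrightarrow> sq DU K" if K: "K \<subseteq> F" for K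
    proof -
      assume "sq D (insert e K)"
      then obtain K1 K2 where K12: "K1 \<subseteq> insert e K" "K2 \<subseteq> insert e K" "K1 \<inter> K2 = {}" "D K1 K2"
        unfolding sq_def by blast
      have "DU (K1 - {e}) (K2 - {e})"
      proof (cases "e \<in> K1")
        case True
        then have "K1 \<subseteq> i (K1 - {e})" "K2 \<subseteq> K2 - {e}" using K12 by (auto simp: i_def)
        from Dm[OF this K12(4)] show ?thesis unfolding Dd by blast
      next
        case False
        then have "K1 \<subseteq> K1 - {e}" "K2 \<subseteq> i (K2 - {e})" by (auto simp: i_def)
        from Dm[OF this K12(4)] show ?thesis unfolding Dd by blast
      qed
      moreover have "K1 - {e} \<subseteq> K" "K2 - {e} \<subseteq> K" "(K1 - {e}) \<inter> (K2 - {e}) = {}"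
        using K12 by auto
      ultimately show "sq DU K" unfolding sq_def by blast
    qed
    then have "bpr p F (\<lambda>K. sq D (insert e K)) \<le> bpr p F (sq DU)"
      using assms by (intro bpr_mono) auto
    then show ?thesis
      using insert.hyps assms(2,3) by (simp add: bpr_def bex_insert mult_left_mono)
  qed
  have P2_exp: "bex p (insert e F) (\<lambda>K1. bpr p (insert e F) (D K1)) =
      (1-p)*((1-p) * P2 D + p * P2 D01) + p * ((1-p) * P2 D10 + p * P2 D11)"
    using insert(1,2) unfolding P2_def Dd i_def bpr_def
    by (simp add: bex_insert bex_add bex_cmult) (simp add: algebra_simps)
  \<comment> \<open>Inclusion-exclusion: \<open>DU\<close> is the union of \<open>D10\<close> and
    \<open>D01\<close>, whose intersection contains \<open>D\<close> by monotonicity.\<close>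
  have incl: "P2 DU + P2 D \<le> P2 D10 + P2 D01"
    unfolding P2_def bpr_def bex_add[symmetric]
  proof (intro bex_mono assms)
    fix K1 K2
    show "of_bool (DU K1 K2) + of_bool (D K1 K2) \<le> (of_bool (D10 K1 K2) + of_bool (D01 K1 K2) :: real)"
      using Dm[of K1 "i K1" K2 K2] Dm[of K1 K1 K2 "i K2"] i_ge unfolding Dd by auto
  qed
  have U11: "P2 DU \<le> P2 D11"
    unfolding P2_def bpr_def
  proof (intro bex_mono assms)
    fix K1 K2
    show "of_bool (DU K1 K2) \<le> (of_bool (D11 K1 K2) :: real)"
      using Dm[of "i K1" "i K1" K2 "i K2"] Dm[of K1 "i K1" "i K2" "i K2"] i_ge unfolding Dd by auto
  qed
  have "bpr p (insert e F) (sq D) \<le> (1 - p) * P2 D + p * P2 DU"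
    using split IH0 IHU assms(2,3)
    by (smt (verit) mult_left_mono)
  also have "\<dots> = (1-p)*((1-p) * P2 D) + p * (1-p) * (P2 DU + P2 D) + p * (p * P2 DU)"
    by (simp add: algebra_simps)
  also have "\<dots> \<le> (1-p)*((1-p) * P2 D) + p * (1-p) * (P2 D10 + P2 D01) + p * (p * P2 D11)"
    using mult_left_mono[OF incl, of "p * (1 - p)"] mult_left_mono[OF U11, of "p * p"] assms(2,3)
    by (simp add: mult.assoc)
  also have "\<dots> = bex p (insert e F) (\<lambda>K1. bpr p (insert e F) (D K1))"
    unfolding P2_exp by (simp add: algebra_simps)
  finally show ?case unfolding sq_def .
qed

lemma bk:
  assumes "finite F" "0 \<le> p" "p \<le> 1" "increasing A" "increasing B"
  shows "bpr p F (disjointly A B) \<le> bpr p F A * bpr p F B"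
proof -
  have "bpr p F (disjointly A B) \<le> bex p F (\<lambda>K1. bpr p F (\<lambda>K2. A K1 \<and> B K2))"
    unfolding disjointly_def[abs_def]
    by (rule bk_pairs[OF assms(1-3), of "\<lambda>K1 K2. A K1 \<and> B K2"]) (use assms(4,5) in \<open>auto simp: increasing_def\<close>)
  also have "\<dots> = bpr p F A * bpr p F B"
    unfolding bpr_def by (simp only: of_bool_conj bex_cmult bex_cmult_right)
  finally show ?thesis .
qed

lemma bk3:
  assumes "finite F" "0 \<le> p" "p \<le> 1" "increasing A" "increasing B" "increasing C"
  shows "bpr p F (disjointly A (disjointly B C)) \<le> bpr p F A * bpr p F B * bpr p F C"
proof -
  have "bpr p F (disjointly A (disjointly B C)) \<le> bpr p F A * bpr p F (disjointly B C)"
    using assms by (intro bk) auto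
  also have "\<dots> \<le> bpr p F A * (bpr p F B * bpr p F C)"
    using assms by (intro mult_left_mono bk bpr_nonneg) auto
  finally show ?thesis by simp
qed

section \<open>Open connections\<close>

text \<open>Restrictions are made on the edge set: \<open>K \<inter> Pow S\<close> keeps a path
  inside \<open>S\<close>, and \<open>{e \<in> K. e \<inter> A = {}}\<close> keeps it off
  \<open>A\<close>. As \<open>conn\<close> is reflexive, membership of the starting point in
  \<open>S\<close> has to be asked for separately.\<close>

definition conn :: "'v set set \<Rightarrow> 'v \<Rightarrow> 'v \<Rightarrow> bool"
  where "conn K x y \<longleftrightarrow> (x, y) \<in> {(u, v). {u, v} \<in> K}\<^sup>*"

lemma conn_refl [simp]: "conn K x x"
  by (simp add: conn_def)

lemma conn_trans: "conn K x y \<Longrightarrow> conn K y z \<Longrightarrow> conn K x z"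
  unfolding conn_def by (rule rtrancl_trans)

lemma conn_edge: "{x, y} \<in> K \<Longrightarrow> conn K x y"
  unfolding conn_def by (rule r_into_rtrancl) simp

lemma conn_mono: "K \<subseteq> K' \<Longrightarrow> conn K x y \<Longrightarrow> conn K' x y"
  unfolding conn_def by (rule subsetD[OF rtrancl_mono]) auto

lemma conn_step: "conn K x u \<Longrightarrow> {u, v} \<in> K \<Longrightarrow> conn K x v"
  by (rule conn_trans[OF _ conn_edge])

lemma conn_step_left: "{x, u} \<in> K \<Longrightarrow> conn K u y \<Longrightarrow> conn K x y"
  by (rule conn_trans[OF conn_edge])

lemma conn_insert_left: "conn K u y \<Longrightarrow> conn (insert {x, u} K) x y"
  by (rule conn_step_left[of x u]) (auto intro: conn_mono[rotated])

lemma conn_sym: "conn K x y \<Longrightarrow> conn K y x"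
  unfolding conn_def
  by (rule symD[OF sym_rtrancl]) (auto simp: sym_def insert_commute)

lemma increasing_conn [simp]: "increasing (\<lambda>K. conn K x y)"
  by (rule increasingI) (rule conn_mono)

lemma increasing_conn_Int [simp]: "increasing (\<lambda>K. conn (K \<inter> T) x y)"
  by (rule increasingI) (rule conn_mono, auto)

lemma increasing_all: "(\<And>i. i \<in> I \<Longrightarrow> increasing (A i)) \<Longrightarrow> increasing (\<lambda>K. \<forall>i\<in>I. A i K)"
  by (simp add: increasing_def)

lemma conn_induct [consumes 1, case_names base step]:
  assumes "conn K x y" "P x" "\<And>u v. conn K x u \<Longrightarrow> {u, v} \<in> K \<Longrightarrow> P u \<Longrightarrow> P v"
  shows "P y"
  using assms(1)[unfolded conn_def]
proof (induction rule: rtrancl_induct)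
  case base
  show ?case by fact
next
  case (step u v)
  then show ?case using assms(3)[of u v] by (simp add: conn_def)
qed

section \<open>Cutting open paths at vertices and at exits from sets\<close>

lemma conn_closed:
  assumes "conn K x y" "x \<in> U" "\<And>u v. u \<in> U \<Longrightarrow> {u, v} \<in> K \<Longrightarrow> v \<in> U"
  shows "y \<in> U"
  using assms(1) by (induction rule: conn_induct) (use assms in auto)

lemma conn_in_Pow: "conn (K \<inter> Pow S) x y \<Longrightarrow> x \<in> S \<Longrightarrow> y \<in> S"
  by (erule conn_closed) auto

text \<open>A path never leaves the component of its starting point. This is how witnesses are
  confined to a cluster, and how an event about a cluster is seen to depend only on edges touching
  it.\<close>

lemma conn_component:
  assumes "conn K x y"
  shows "conn {e \<in> K. e \<subseteq> {v. conn K x v}} x y"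
  using assms
proof (induction rule: conn_induct)
  case (step u v)
  from step(1,2) have "conn K x v" by (rule conn_step)
  then have "{u, v} \<in> {e \<in> K. e \<subseteq> {v. conn K x v}}" using step by auto
  then show ?case using step.IH by (rule conn_step[rotated])
qed simp

text \<open>Follows the path after its last visit to \<open>x\<close>: the induction along the path
  restarts whenever it returns to \<open>x\<close>. Dropping all edges at \<open>x\<close> is what
  makes the inductions on \<open>card K\<close> below descend.\<close>

lemma conn_step_first:
  assumes "conn K x y" "x \<noteq> y"
  obtains x1 where "{x, x1} \<in> K" "x1 \<noteq> x" "conn {e \<in> K. x \<notin> e} x1 y"
proof -
  have "x = y \<or> (\<exists>x1. {x, x1} \<in> K \<and> x1 \<noteq> x \<and> conn {e \<in> K. x \<notin> e} x1 y)"
    using assms(1)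
  proof (induction rule: conn_induct)
    case (step u v)
    consider "v = x" | "u = x" "v \<noteq> x" | "u \<noteq> x" "v \<noteq> x" by blast
    then show ?case
    proof cases
      case 2
      then show ?thesis using step.hyps by (intro disjI2 exI[of _ v]) simp
    next
      case 3
      then have uv: "{u, v} \<in> {e \<in> K. x \<notin> e}" using step by simp
      from 3 step.IH obtain x1 where "{x, x1} \<in> K" "x1 \<noteq> x" "conn {e \<in> K. x \<notin> e} x1 u"
        by auto
      then show ?thesis using conn_step[OF _ uv] by (intro disjI2 exI[of _ x1]) simp
    qed simp
  qed simp
  then show ?thesis using assms(2) that by blast
qed

text \<open>The same device for a set: the induction restarts whenever the path is back in
  \<open>U\<close>.\<close>

lemma conn_last_exit:
  assumes "conn K x y" "x \<in> U" "y \<notin> U"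
  obtains u w where "u \<in> U" "w \<notin> U" "{u, w} \<in> K" "conn {e \<in> K. e \<inter> U = {}} w y"
proof -
  have "y \<in> U \<or> (\<exists>u w. u \<in> U \<and> w \<notin> U \<and> {u, w} \<in> K \<and> conn {e \<in> K. e \<inter> U = {}} w y)"
    using assms(1)
  proof (induction rule: conn_induct)
    case (step u v)
    consider "v \<in> U" | "u \<in> U" "v \<notin> U" | "u \<notin> U" "v \<notin> U" by blast
    then show ?case
    proof cases
      case 2
      then show ?thesis using step.hyps by (intro disjI2 exI[of _ u] exI[of _ v]) simp
    next
      case 3
      then have uv: "{u, v} \<in> {e \<in> K. e \<inter> U = {}}" using step by simp
      from 3 step.IH obtain u' w where "u' \<in> U" "w \<notin> U" "{u', w} \<in> K"
          "conn {e \<in> K. e \<inter> U = {}} w u"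
        by auto
      then show ?thesis using conn_step[OF _ uv] by (intro disjI2 exI[of _ u'] exI[of _ w]) simp
    qed simp
  qed (use assms in simp)
  then show ?thesis using assms(3) that by blast
qed

text \<open>Walk along the path, each time dropping all edges at the vertex just left, until a
  vertex of \<open>A\<close> is met. The step from \<open>x\<close> is then disjoint from everything
  that the induction produces for the smaller edge set.\<close>

lemma conn_through:
  assumes "finite K" "conn K x y" "\<not> (x \<notin> A \<and> conn {e \<in> K. e \<inter> A = {}} x y)"
  shows "\<exists>a\<in>A. disjointly (\<lambda>K. conn K x a) (\<lambda>K. conn K a y) K"
  using assms
proof (induction "card K" arbitrary: K x rule: less_induct)
  case less
  show ?case
  proof (cases "x \<in> A")
    case True
    have "disjointly (\<lambda>K. conn K x x) (\<lambda>K. conn K x y) K"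
      using less.prems(2) by (intro disjointlyI[of "{}" _ K]) simp_all
    then show ?thesis using True by blast
  next
    case xA: False
    then have "x \<noteq> y" using less.prems by auto
    with less.prems(2) obtain x1 where x1: "{x, x1} \<in> K" "x1 \<noteq> x" "conn {e \<in> K. x \<notin> e} x1 y"
      by (rule conn_step_first)
    define K' where "K' = {e \<in> K. x \<notin> e}"
    have "K' \<subseteq> K" "{x, x1} \<notin> K'" by (auto simp: K'_def)
    then have "K' \<subset> K" using x1(1) by blast
    then have card: "card K' < card K" using less.prems(1) by (simp add: psubset_card_mono)
    have fin: "finite K'" using less.prems(1) by (simp add: K'_def)
    have K'c: "conn K' x1 y" using x1(3) by (simp add: K'_def)
    have "\<not> (x1 \<notin> A \<and> conn {e \<in> K'. e \<inter> A = {}} x1 y)"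
    proof
      assume H: "x1 \<notin> A \<and> conn {e \<in> K'. e \<inter> A = {}} x1 y"
      have "conn {e \<in> K. e \<inter> A = {}} x1 y"
        by (rule conn_mono[OF _ conjunct2[OF H]]) (auto simp: K'_def)
      moreover have "conn {e \<in> K. e \<inter> A = {}} x x1"
        using H xA x1 by (intro conn_edge) auto
      ultimately show False using less.prems(3) xA conn_trans[of _ x x1 y] by simp
    qed
    from less.hyps[OF card fin K'c this]
    obtain a where aA: "a \<in> A" and "disjointly (\<lambda>K. conn K x1 a) (\<lambda>K. conn K a y) K'" by blast
    from this(2) obtain K1 K2 where a: "K1 \<subseteq> K'" "K2 \<subseteq> K'" "K1 \<inter> K2 = {}"
        "conn K1 x1 a" "conn K2 a y"
      by (rule disjointlyE)
    have "conn (insert {x, x1} K1) x a"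
      using a(4) by (rule conn_insert_left)
    moreover have "insert {x, x1} K1 \<inter> K2 = {}" "insert {x, x1} K1 \<subseteq> K" "K2 \<subseteq> K"
      using a x1 by (auto simp: K'_def)
    ultimately have "disjointly (\<lambda>K. conn K x a) (\<lambda>K. conn K a y) K"
      using a(5) by (intro disjointlyI[of "insert {x, x1} K1" _ K2])
    then show ?thesis using aA by blast
  qed
qed

text \<open>\<open>V\<close> collects the vertices visited before the first exit. The rest of the
  path may return to \<open>U\<close>, but it never touches \<open>V\<close>, because each step
  drops all edges at the vertex it leaves. The surgery uses this vertex-disjointness to make the
  exit edge pivotal.\<close>

lemma conn_exit_vertices:
  assumes "finite K" "conn K x y" "x \<in> U" "y \<notin> U"
  shows "\<exists>u w V K1 K2. V \<subseteq> U \<and> x \<in> V \<and> u \<in> V \<and> w \<notin> U \<and> {u, w} \<in> K \<and> K1 \<subseteq> K \<inter> Pow V \<and>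
    K2 \<subseteq> K \<and> (\<forall>e\<in>K2. e \<inter> V = {}) \<and> conn K1 x u \<and> conn K2 w y"
  using assms
proof (induction "card K" arbitrary: K x rule: less_induct)
  case less
  then have "x \<noteq> y" by auto
  with less.prems(2) obtain x1 where x1: "{x, x1} \<in> K" "x1 \<noteq> x" "conn {e \<in> K. x \<notin> e} x1 y"
    by (rule conn_step_first)
  define K' where "K' = {e \<in> K. x \<notin> e}"
  have "K' \<subseteq> K" "{x, x1} \<notin> K'" by (auto simp: K'_def)
  then have "K' \<subset> K" using x1(1) by blast
  then have card: "card K' < card K" using less.prems(1) by (simp add: psubset_card_mono)
  have fin: "finite K'" using less.prems(1) by (simp add: K'_def)
  have K'c: "conn K' x1 y" using x1(3) by (simp add: K'_def)
  show ?case
  proof (cases "x1 \<in> U")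
    case False
    have "\<forall>e\<in>K'. e \<inter> {x} = {}" by (simp add: K'_def)
    then show ?thesis using False less.prems(3) x1(1) \<open>K' \<subseteq> K\<close> K'c
      by (intro exI[of _ x] exI[of _ x1] exI[of _ "{x}"] exI[of _ "{}"] exI[of _ K']) simp
  next
    case True
    from less.hyps[OF card fin K'c True less.prems(4)]
    obtain u w V K1 K2 where h: "V \<subseteq> U" "x1 \<in> V" "u \<in> V" "w \<notin> U" "{u, w} \<in> K'" "K1 \<subseteq> K' \<inter> Pow V"
        "K2 \<subseteq> K'" "\<forall>e\<in>K2. e \<inter> V = {}" "conn K1 x1 u" "conn K2 w y"
      by (elim exE conjE)
    have "conn (insert {x, x1} K1) x u"
      using h(9) by (rule conn_insert_left)
    moreover have "insert {x, x1} K1 \<subseteq> K \<inter> Pow (insert x V)" "K2 \<subseteq> K" "{u, w} \<in> K"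
      using h(2,5,6,7) x1(1) \<open>K' \<subseteq> K\<close> by auto
    moreover have "\<forall>e\<in>K2. e \<inter> insert x V = {}" using h(7,8) by (auto simp: K'_def)
    ultimately show ?thesis using h(1,3,4,10) less.prems(3)
      by (intro exI[of _ u] exI[of _ w] exI[of _ "insert x V"] exI[of _ "insert {x, x1} K1"] exI[of _ K2]) simp
  qed
qed

text \<open>The empty set must be discarded before \<open>K1\<close> and \<open>K2\<close> can be
  called disjoint: it lies in \<open>Pow V\<close> and is disjoint from \<open>V\<close> at the same
  time.\<close>

lemma conn_Diff_empty: "conn (K - {{}}) x y = conn K x y"
  by (simp add: conn_def)

lemma conn_exit:
  assumes "finite K" "conn K x y" "x \<in> U" "y \<notin> U"
  shows "\<exists>u w K1 K2. u \<in> U \<and> w \<notin> U \<and> {u, w} \<in> K \<and> K1 \<subseteq> K \<inter> Pow U \<and> K2 \<subseteq> K \<and>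
    K1 \<inter> K2 = {} \<and> conn K1 x u \<and> conn K2 w y"
proof -
  obtain u w V K1 K2 where h: "V \<subseteq> U" "x \<in> V" "u \<in> V" "w \<notin> U" "{u, w} \<in> K" "K1 \<subseteq> K \<inter> Pow V"
      "K2 \<subseteq> K" "\<forall>e\<in>K2. e \<inter> V = {}" "conn K1 x u" "conn K2 w y"
    using conn_exit_vertices[OF assms] by (elim exE conjE)
  have "e \<notin> K2" if "e \<in> K1 - {{}}" for e
  proof
    assume "e \<in> K2"
    then have "e \<inter> V = {}" using h(8) by simp
    moreover have "e \<subseteq> V" "e \<noteq> {}" using that h(6) by auto
    ultimately show False by auto
  qed
  then have "(K1 - {{}}) \<inter> K2 = {}" by blast
  moreover have "u \<in> U" "K1 - {{}} \<subseteq> K \<inter> Pow U" using h(1,3,6) by auto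
  moreover have "conn (K1 - {{}}) x u" using h(9) by (simp add: conn_Diff_empty)
  ultimately show ?thesis using h(4,5,7,10)
    by (intro exI[of _ u] exI[of _ w] exI[of _ "K1 - {{}}"] exI[of _ K2]) simp
qed

section \<open>Branch points of trees of open edges\<close>

lemma conn_remove_edge:
  "conn K z y \<Longrightarrow> conn (K - {{z, z1}}) z y \<or> conn (K - {{z, z1}}) z1 y"
proof (induction rule: conn_induct)
  case (step u v)
  show ?case
  proof (cases "{u, v} = {z, z1}")
    case True
    then have "v = z \<or> v = z1" by (auto simp: doubleton_eq_iff)
    then show ?thesis by auto
  next
    case False
    then have "conn (K - {{z, z1}}) u v" using step by (intro conn_edge) auto
    then show ?thesis using step.IH conn_trans[of _ _ u v] by blast
  qed
qed simp

text \<open>The first branch point \<open>z'\<close> of a tree of open edges that joins \<open>z\<close> to the points \<open>f i\<close>.\<close>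

lemma conn_branch:
  assumes "finite K" "{} \<notin> K" "\<And>i. i \<in> A \<Longrightarrow> conn K z (f i)" "finite A" "2 \<le> card A"
  shows "\<exists>z' I. I \<subseteq> A \<and> I \<noteq> {} \<and> I \<noteq> A \<and>
    disjointly (\<lambda>K. conn K z z') (disjointly (\<lambda>K. \<forall>i\<in>I. conn K z' (f i)) (\<lambda>K. \<forall>i\<in>A - I. conn K z' (f i))) K"
  using assms(1-3)
proof (induction "card K" arbitrary: K z rule: less_induct)
  case less
  have dis0: "disjointly (\<lambda>K. conn K z z) D K" if "D K" for D K
    using that by (intro disjointlyI[of "{}" _ K]) simp_all
  have A_ne: "A \<noteq> {}" using assms(5) by auto
  show ?case
  proof (cases "\<exists>i\<in>A. f i = z")
    case True
    then obtain i where i: "i \<in> A" "f i = z" by blast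
    have "{i} \<noteq> A" using assms(5) by auto
    moreover have "disjointly (\<lambda>K. \<forall>i\<in>{i}. conn K z (f i)) (\<lambda>K. \<forall>j\<in>A - {i}. conn K z (f j)) K"
      using less.prems i by (intro disjointlyI[of "{}" _ K]) auto
    ultimately show ?thesis using i dis0 by (intro exI[of _ z] exI[of _ "{i}"]) auto
  next
    case no: False
    obtain i0 where i0: "i0 \<in> A" using A_ne by auto
    then have "conn K z (f i0)" "z \<noteq> f i0" using less.prems(3) no by auto
    then obtain z1 where z1: "{z, z1} \<in> K" "z1 \<noteq> z" by (rule conn_step_first)
    define e where "e = {z, z1}"
    define K' where "K' = K - {e}"
    \<comment> \<open>The targets still reached from \<open>z\<close> without \<open>e\<close>. If
      all are, \<open>e\<close> is dropped; if none is, the tree starts with \<open>e\<close> and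
      the search moves on to \<open>z1\<close>; otherwise \<open>z\<close> itself is the branch
      point.\<close>
    define I where "I = {i \<in> A. conn K' z (f i)}"
    have card: "card K' < card K"
      using z1 less.prems(1) unfolding K'_def e_def by (intro psubset_card_mono) auto
    have K': "finite K'" "{} \<notin> K'" "K' \<subseteq> K" using less.prems by (auto simp: K'_def)
    have rest: "conn K' z1 (f i)" if "i \<in> A - I" for i
      using conn_remove_edge[OF less.prems(3), of i z1] that unfolding I_def K'_def e_def by auto
    consider "I = A" | "I = {}" | "I \<noteq> A" "I \<noteq> {}" by blast
    then show ?thesis
    proof cases
      case 1
      then have all: "conn K' z (f i)" if "i \<in> A" for i using that by (auto simp: I_def)
      have "\<exists>z' I. I \<subseteq> A \<and> I \<noteq> {} \<and> I \<noteq> A \<and> disjointly (\<lambda>K. conn K z z')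
          (disjointly (\<lambda>K. \<forall>i\<in>I. conn K z' (f i)) (\<lambda>K. \<forall>i\<in>A - I. conn K z' (f i))) K'"
        by (rule less.hyps[OF card K'(1,2)]) (rule all)
      then obtain z' I' where z': "I' \<subseteq> A" "I' \<noteq> {}" "I' \<noteq> A"
        "disjointly (\<lambda>K. conn K z z') (disjointly (\<lambda>K. \<forall>i\<in>I'. conn K z' (f i)) (\<lambda>K. \<forall>i\<in>A - I'. conn K z' (f i))) K'"
        by (elim exE conjE)
      show ?thesis
        by (intro exI[of _ z'] exI[of _ I'] conjI z'(1-3) increasingD[OF increasing_disjointly K'(3) z'(4)])
    next
      case 2
      then have all: "conn K' z1 (f i)" if "i \<in> A" for i using that rest by auto
      have "\<exists>z' I. I \<subseteq> A \<and> I \<noteq> {} \<and> I \<noteq> A \<and> disjointly (\<lambda>K. conn K z1 z')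
          (disjointly (\<lambda>K. \<forall>i\<in>I. conn K z' (f i)) (\<lambda>K. \<forall>i\<in>A - I. conn K z' (f i))) K'"
        by (rule less.hyps[OF card K'(1,2)]) (rule all)
      then obtain z' I' where z': "I' \<subseteq> A" "I' \<noteq> {}" "I' \<noteq> A"
        "disjointly (\<lambda>K. conn K z1 z') (disjointly (\<lambda>K. \<forall>i\<in>I'. conn K z' (f i)) (\<lambda>K. \<forall>i\<in>A - I'. conn K z' (f i))) K'"
        by (elim exE conjE)
      from z'(4) obtain K1 K2 where K12: "K1 \<subseteq> K'" "K2 \<subseteq> K'" "K1 \<inter> K2 = {}" "conn K1 z1 z'"
        "disjointly (\<lambda>K. \<forall>i\<in>I'. conn K z' (f i)) (\<lambda>K. \<forall>i\<in>A - I'. conn K z' (f i)) K2"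
        by (rule disjointlyE)
      have "conn (insert e K1) z z'"
        using K12(4) unfolding e_def by (rule conn_insert_left)
      moreover have "insert e K1 \<inter> K2 = {}" "insert e K1 \<subseteq> K" "K2 \<subseteq> K"
        using K12 z1 by (auto simp: K'_def e_def)
      ultimately have "disjointly (\<lambda>K. conn K z z')
          (disjointly (\<lambda>K. \<forall>i\<in>I'. conn K z' (f i)) (\<lambda>K. \<forall>i\<in>A - I'. conn K z' (f i))) K"
        using K12(5) by - (rule disjointlyI[of "insert e K1" _ K2], assumption+)
      then show ?thesis using z'(1-3) by (intro exI[of _ z'] exI[of _ I'] conjI)
    next
      case 3
      define C where "C v = {v'. conn K' v v'}" for v
      \<comment> \<open>A common point would join \<open>z\<close> to \<open>z1\<close> without
        \<open>e\<close>, and hence to the targets outside \<open>I\<close>.\<close>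
      have "C z \<inter> C z1 = {}"
      proof (rule ccontr)
        assume "C z \<inter> C z1 \<noteq> {}"
        then obtain v where "conn K' z v" "conn K' z1 v" unfolding C_def by auto
        then have zz1: "conn K' z z1" by (rule conn_trans[OF _ conn_sym])
        obtain i where "i \<in> A - I" using 3 unfolding I_def by blast
        then show False using rest[of i] conn_trans[OF zz1] unfolding I_def by blast
      qed
      define K2 K3 where "K2 = {e \<in> K'. e \<subseteq> C z}" and "K3 = insert e {e \<in> K'. e \<subseteq> C z1}"
      have "K2 \<inter> K3 = {}"
      proof -
        have "e' \<notin> K3" if e': "e' \<in> K2" for e'
        proof
          assume "e' \<in> K3"
          moreover have "e' \<noteq> e" using e' by (auto simp: K2_def K'_def)
          ultimately have "e' \<subseteq> C z \<inter> C z1" using e' by (auto simp: K2_def K3_def)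
          then have "e' = {}" using \<open>C z \<inter> C z1 = {}\<close> by simp
          then show False using e' K'(2) by (auto simp: K2_def)
        qed
        then show ?thesis by blast
      qed
      moreover have "K2 \<subseteq> K" "K3 \<subseteq> K" using K' z1 unfolding K2_def K3_def e_def by auto
      moreover have "\<forall>i\<in>I. conn K2 z (f i)"
        unfolding K2_def C_def I_def by (auto intro: conn_component)
      moreover have "\<forall>i\<in>A - I. conn K3 z (f i)"
      proof
        fix i assume "i \<in> A - I"
        then have "conn {e \<in> K'. e \<subseteq> C z1} z1 (f i)"
          unfolding C_def by (intro conn_component rest)
        then have "conn K3 z1 (f i)" unfolding K3_def by (rule conn_mono[rotated]) auto
        moreover have "conn K3 z z1" unfolding K3_def e_def by (intro conn_edge) auto
        ultimately show "conn K3 z (f i)" by (rule conn_trans[rotated])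
      qed
      ultimately have "disjointly (\<lambda>K. \<forall>i\<in>I. conn K z (f i)) (\<lambda>K. \<forall>i\<in>A - I. conn K z (f i)) K"
        by (intro disjointlyI[of K2 _ K3])
      moreover have "I \<subseteq> A" by (auto simp: I_def)
      ultimately show ?thesis using 3 dis0 by (intro exI[of _ z] exI[of _ I] conjI) auto
    qed
  qed
qed

text \<open>\<open>V\<close> is the cluster of \<open>u\<close> in \<open>B\<close>. The path from
  \<open>x\<close> is stopped at its first vertex \<open>z\<close> in \<open>V\<close>; up to there
  its edges do not lie inside \<open>V\<close>, whereas all \<open>f i\<close> are reached by edges
  inside \<open>V\<close>. The price is a single unknown point \<open>z\<close> of \<open>B\<close>,
  however many targets there are.\<close>

lemma conn_local_hit:
  assumes "finite K" "{} \<notin> K" "conn (K \<inter> Pow S) x u" "u \<in> B"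
    and "\<And>i. i \<in> A \<Longrightarrow> conn (K \<inter> Pow B) u (f i)"
  shows "\<exists>z\<in>B. disjointly (\<lambda>K. conn (K \<inter> Pow S) x z) (\<lambda>K. \<forall>i\<in>A. conn K u (f i)) K"
proof -
  define V where "V = {v. conn (K \<inter> Pow B) u v}"
  define K2 where "K2 = {e \<in> K \<inter> Pow B. e \<subseteq> V}"
  have V: "V \<subseteq> B" "u \<in> V" unfolding V_def using conn_in_Pow assms(4) by force+
  have K2: "\<forall>i\<in>A. conn K2 u (f i)"
    using conn_component[OF assms(5)] unfolding K2_def V_def by simp
  have K2_sub: "K2 \<subseteq> K" by (auto simp: K2_def)
  show ?thesis
  proof (cases "x \<in> V")
    case True
    then have "x \<in> B" using V by auto
    moreover have "disjointly (\<lambda>K. conn (K \<inter> Pow S) x x) (\<lambda>K. \<forall>i\<in>A. conn K u (f i)) K"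
      using K2 K2_sub by (intro disjointlyI[of "{}" _ K2]) simp_all
    ultimately show ?thesis by blast
  next
    case False
    then obtain a z K1 where h: "a \<notin> V" "z \<in> V" "{a, z} \<in> K \<inter> Pow S"
        "K1 \<subseteq> K \<inter> Pow S \<inter> Pow (- V)" "conn K1 x a"
      using conn_exit[of "K \<inter> Pow S" x u "- V"] assms(1,3) V(2) by auto
    let ?K1 = "insert {a, z} K1"
    have "conn (?K1 \<inter> Pow S) x z"
    proof (rule conn_trans)
      show "conn (?K1 \<inter> Pow S) x a" using h by (intro conn_mono[OF _ h(5)]) auto
      show "conn (?K1 \<inter> Pow S) a z" using h by (intro conn_edge) auto
    qed
    moreover have "?K1 \<inter> K2 = {}"
    proof -
      have "e \<notin> K1" if e: "e \<in> K2" for e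
      proof
        assume "e \<in> K1"
        then have "e \<in> K" "e \<subseteq> - V" using h(4) by auto
        moreover have "e \<subseteq> V" using e unfolding K2_def by auto
        ultimately have "e = {}" "e \<in> K" by auto
        then show False using assms(2) by simp
      qed
      moreover have "{a, z} \<notin> K2" using h(1) unfolding K2_def by simp
      ultimately show ?thesis by blast
    qed
    moreover have "?K1 \<subseteq> K" using h by auto
    ultimately have "disjointly (\<lambda>K. conn (K \<inter> Pow S) x z) (\<lambda>K. \<forall>i\<in>A. conn K u (f i)) K"
      using K2 K2_sub by (intro disjointlyI[of ?K1 _ K2])
    then show ?thesis using h(2) V(1) by blast
  qed
qed

lemma conn_three:
  assumes "finite K" "{} \<notin> K" "conn (K \<inter> Pow S) x u" "conn K x a"
  shows "\<exists>z K1 K2 K3. K1 \<subseteq> K \<and> K2 \<subseteq> K \<and> K3 \<subseteq> K \<and> K1 \<inter> K2 = {} \<and> K1 \<inter> K3 = {} \<and> K2 \<inter> K3 = {} \<and>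
    conn (K1 \<inter> Pow S) x z \<and> conn (K2 \<inter> Pow S) z u \<and> conn K3 z a"
proof -
  \<comment> \<open>An edge set of least size joining \<open>x\<close> to \<open>u\<close> inside
    \<open>S\<close> behaves like a simple path: deleting one of its vertices breaks it, so by
    \<open>conn_through\<close> it can be cut there into two disjoint pieces. The connection to
    \<open>a\<close> is attached where it last leaves this set.\<close>
  define P where "P K0 \<longleftrightarrow> K0 \<subseteq> K \<inter> Pow S \<and> conn K0 x u" for K0
  have "P (K \<inter> Pow S)" using assms by (simp add: P_def)
  then obtain K0 where K0: "P K0" and min: "\<And>K1. P K1 \<Longrightarrow> card K0 \<le> card K1"
    using ex_has_least_nat[of P _ card] by blast
  have K0': "K0 \<subseteq> K \<inter> Pow S" "conn K0 x u" "finite K0"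
    using K0 assms(1) unfolding P_def by (auto intro: finite_subset)
  define V where "V = insert x (\<Union>K0)"
  have split: "\<exists>K1 K2. K1 \<subseteq> K0 \<and> K2 \<subseteq> K0 \<and> K1 \<inter> K2 = {} \<and> conn K1 x z \<and> conn K2 z u"
    if z: "z \<in> V" for z
  proof (cases "z = x")
    case True
    then show ?thesis using K0' by (intro exI[of _ "{}"] exI[of _ K0]) simp
  next
    case False
    have "\<not> conn {e \<in> K0. e \<inter> {z} = {}} x u"
    proof
      assume c: "conn {e \<in> K0. e \<inter> {z} = {}} x u"
      have "{e \<in> K0. e \<inter> {z} = {}} \<subset> K0" using z False unfolding V_def by auto
      then have "card {e \<in> K0. e \<inter> {z} = {}} < card K0"
        using K0'(3) by (simp add: psubset_card_mono)
      moreover have "P {e \<in> K0. e \<inter> {z} = {}}" using c K0' unfolding P_def by auto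
      ultimately show False using min[of "{e \<in> K0. e \<inter> {z} = {}}"] by simp
    qed
    then have "\<exists>a\<in>{z}. disjointly (\<lambda>K. conn K x a) (\<lambda>K. conn K a u) K0"
      by (intro conn_through K0') simp
    then show ?thesis unfolding disjointly_def by simp
  qed
  have "\<exists>z\<in>V. \<exists>K3. K3 \<subseteq> K \<and> K0 \<inter> K3 = {} \<and> conn K3 z a"
  proof (cases "a \<in> V")
    case True
    then show ?thesis by (intro bexI[of _ a] exI[of _ "{}"]) auto
  next
    case False
    then obtain w z K3 where h: "w \<notin> V" "z \<in> V" "{w, z} \<in> K" "K3 \<subseteq> K \<inter> Pow (- V)" "conn K3 a w"
      using conn_exit[OF assms(1) conn_sym[OF assms(4)], of "- V"] unfolding V_def by auto
    have "conn (insert {w, z} K3) z a"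
      using conn_insert_left[OF conn_sym[OF h(5)], of z] by (simp add: insert_commute)
    moreover have "K0 \<inter> insert {w, z} K3 = {}"
    proof -
      have "{w, z} \<notin> K0" using h(1) unfolding V_def by auto
      moreover have "e \<notin> K3" if e: "e \<in> K0" for e
      proof
        assume "e \<in> K3"
        then have "e \<subseteq> - V" "e \<in> K" using h(4) by auto
        moreover have "e \<subseteq> V" using e unfolding V_def by auto
        ultimately have "e = {}" "e \<in> K" by auto
        then show False using assms(2) by simp
      qed
      ultimately show ?thesis by auto
    qed
    moreover have "insert {w, z} K3 \<subseteq> K" using h by auto
    ultimately show ?thesis using h(2) by (intro bexI[of _ z] exI[of _ "insert {w, z} K3"] conjI)
  qed
  then obtain z K3 where z: "z \<in> V" "K3 \<subseteq> K" "K0 \<inter> K3 = {}" "conn K3 z a" by blast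
  obtain K1 K2 where K12: "K1 \<subseteq> K0" "K2 \<subseteq> K0" "K1 \<inter> K2 = {}" "conn K1 x z" "conn K2 z u"
    using split[OF z(1)] by (elim exE conjE)
  have "K1 \<inter> Pow S = K1" "K2 \<inter> Pow S = K2" using K12 K0' by auto
  then show ?thesis
    using z K12 K0' by (intro exI[of _ z] exI[of _ K1] exI[of _ K2] exI[of _ K3]) auto
qed

text \<open>A tripod with centre \<open>z\<close>. If \<open>z\<close> lies in \<open>B\<close>, the
  legs to \<open>u\<close> and to \<open>a\<close> cannot both stay in \<open>B\<close>, for
  otherwise \<open>u\<close> and \<open>a\<close> would be joined in \<open>B\<close>; a leg that
  leaves is cut at a point \<open>y\<close> outside.\<close>

lemma conn_far:
  assumes "finite K" "{} \<notin> K" "conn (K \<inter> Pow S) x u" "conn K x a"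
    and "\<not> conn (K \<inter> Pow B) u a"
  shows "\<exists>z. disjointly (\<lambda>K. conn (K \<inter> Pow S) x z) (disjointly (\<lambda>K. conn (K \<inter> Pow S) z u) (\<lambda>K. conn K z a)) K \<and>
    (z \<in> B \<longrightarrow> (\<exists>y. y \<notin> B \<and>
      (disjointly (\<lambda>K. conn (K \<inter> Pow S) x z) (disjointly (\<lambda>K. conn K z y) (\<lambda>K. conn K y u)) K \<or>
       disjointly (\<lambda>K. conn (K \<inter> Pow S) x z) (disjointly (\<lambda>K. conn K z y) (\<lambda>K. conn K y a)) K)))"
proof -
  obtain z K1 K2 K3 where h: "K1 \<subseteq> K" "K2 \<subseteq> K" "K3 \<subseteq> K" "K1 \<inter> K2 = {}" "K1 \<inter> K3 = {}"
      "K2 \<inter> K3 = {}" "conn (K1 \<inter> Pow S) x z" "conn (K2 \<inter> Pow S) z u" "conn K3 z a"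
    using conn_three[OF assms(1-4)] by (elim exE conjE)
  have "disjointly (\<lambda>K. conn (K \<inter> Pow S) z u) (\<lambda>K. conn K z a) (K2 \<union> K3)"
    using h by (intro disjointlyI[of K2 _ K3]) auto
  then have A: "disjointly (\<lambda>K. conn (K \<inter> Pow S) x z) (disjointly (\<lambda>K. conn (K \<inter> Pow S) z u) (\<lambda>K. conn K z a)) K"
    using h by (intro disjointlyI[of K1 K "K2 \<union> K3" "\<lambda>K. conn (K \<inter> Pow S) x z"]) auto
  have out: "\<exists>y. y \<notin> B \<and> disjointly (\<lambda>K. conn (K \<inter> Pow S) x z) (disjointly (\<lambda>K. conn K z y) (\<lambda>K. conn K y w)) K"
    if "K' \<subseteq> K" "K1 \<inter> K' = {}" "conn K' z w" "z \<in> B" "\<not> conn (K \<inter> Pow B) z w" for K' w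
  proof -
    have "\<not> conn {e \<in> K'. e \<inter> - B = {}} z w"
    proof
      assume "conn {e \<in> K'. e \<inter> - B = {}} z w"
      then have "conn (K \<inter> Pow B) z w" by (rule conn_mono[rotated]) (use that(1) in auto)
      then show False using that(5) by simp
    qed
    moreover have "finite K'" using that(1) assms(1) finite_subset by blast
    ultimately have "\<exists>y\<in>-B. disjointly (\<lambda>K. conn K z y) (\<lambda>K. conn K y w) K'"
      using that(3) by (intro conn_through) auto
    then obtain y where y: "y \<notin> B" "disjointly (\<lambda>K. conn K z y) (\<lambda>K. conn K y w) K'" by blast
    have "disjointly (\<lambda>K. conn (K \<inter> Pow S) x z) (disjointly (\<lambda>K. conn K z y) (\<lambda>K. conn K y w)) K"
      by (intro disjointlyI[of K1 _ K'] h(1,7) that(1,2) y(2))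
    then show ?thesis using y(1) by blast
  qed
  have "z \<in> B \<longrightarrow> (\<exists>y. y \<notin> B \<and>
      (disjointly (\<lambda>K. conn (K \<inter> Pow S) x z) (disjointly (\<lambda>K. conn K z y) (\<lambda>K. conn K y u)) K \<or>
       disjointly (\<lambda>K. conn (K \<inter> Pow S) x z) (disjointly (\<lambda>K. conn K z y) (\<lambda>K. conn K y a)) K))"
  proof
    assume zB: "z \<in> B"
    have "\<not> conn (K \<inter> Pow B) z u \<or> \<not> conn (K \<inter> Pow B) z a"
      using assms(5) conn_trans[OF conn_sym, of "K \<inter> Pow B" z u a] by blast
    moreover have "conn K2 z u" by (rule conn_mono[OF _ h(8)]) auto
    ultimately show "\<exists>y. y \<notin> B \<and>
      (disjointly (\<lambda>K. conn (K \<inter> Pow S) x z) (disjointly (\<lambda>K. conn K z y) (\<lambda>K. conn K y u)) K \<or>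
       disjointly (\<lambda>K. conn (K \<inter> Pow S) x z) (disjointly (\<lambda>K. conn K z y) (\<lambda>K. conn K y a)) K)"
      using out[OF h(2,4) _ zB] out[OF h(3,5) h(9) zB] by blast
  qed
  with A show ?thesis by blast
qed

section \<open>Convolutions of power functions on the lattice\<close>

text \<open>The quantity max(1, |x - y|) of the two-point bounds. It keeps the triangle inequality
  although \<open>jd x x\<close> is 1; balls of radius below 1 are empty.\<close>

definition jd :: "int ^ 'd \<Rightarrow> int ^ 'd \<Rightarrow> real"
  where "jd x y = max 1 (real_of_int (linf_norm (x - y)))"

definition jball :: "int ^ 'd \<Rightarrow> real \<Rightarrow> (int ^ 'd) set"
  where "jball u r = {z. jd u z \<le> r}"

abbreviation dimr :: "'d itself \<Rightarrow> real" where "dimr _ \<equiv> real CARD('d)"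

lemma linf_norm_le_iff: "linf_norm x \<le> r \<longleftrightarrow> (\<forall>i. \<bar>x $ i\<bar> \<le> r)" for x :: "int ^ 'd"
  unfolding linf_norm_def by (subst Max_le_iff) auto

lemma abs_le_linf_norm: "\<bar>x $ i\<bar> \<le> linf_norm x" for x :: "int ^ 'd"
  using linf_norm_le_iff[of x "linf_norm x"] by simp

lemma linf_norm_triangle: "linf_norm (x + y) \<le> linf_norm x + linf_norm y" for x y :: "int ^ 'd"
  unfolding linf_norm_le_iff
proof
  fix i
  show "\<bar>(x + y) $ i\<bar> \<le> linf_norm x + linf_norm y"
    using abs_le_linf_norm[of x i] abs_le_linf_norm[of y i] by simp
qed

lemma linf_norm_minus_commute: "linf_norm (x - y) = linf_norm (y - x)" for x y :: "int ^ 'd"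
  unfolding linf_norm_def by (simp add: abs_minus_commute)

lemma jd_ge_1: "1 \<le> jd x y" by (simp add: jd_def)

lemma jd_pos [simp]: "0 < jd x y" using jd_ge_1[of x y] by simp

lemma jd_sym: "jd x y = jd y x" by (simp add: jd_def linf_norm_minus_commute)

lemma jd_triangle: "jd x z \<le> jd x y + jd y z"
proof -
  have "linf_norm (x - z) \<le> linf_norm (x - y) + linf_norm (y - z)"
    using linf_norm_triangle[of "x - y" "y - z"] by simp
  then have "real_of_int (linf_norm (x - z)) \<le> real_of_int (linf_norm (x - y)) + real_of_int (linf_norm (y - z))"
    by linarith
  then show ?thesis unfolding jd_def by linarith
qed

lemma jd_self [simp]: "jd x x = 1" for x :: "int ^ 'd"
proof -
  have "linf_norm (0 :: int ^ 'd) \<le> 0" by (simp add: linf_norm_le_iff)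
  then have "real_of_int (linf_norm (x - x)) \<le> 1" by simp
  then show ?thesis unfolding jd_def by linarith
qed

lemma mem_jball: "z \<in> jball u r \<longleftrightarrow> jd u z \<le> r" by (simp add: jball_def)

lemma jball_mono: "r \<le> r' \<Longrightarrow> jball u r \<subseteq> jball u r'" by (auto simp: jball_def)

lemma jball_cover:
  fixes u :: "int ^ 'd"
  shows "jball u r \<subseteq> vec_lambda ` (PiE UNIV (\<lambda>i. {u $ i - \<lfloor>r\<rfloor>..u $ i + \<lfloor>r\<rfloor>}))"
proof
  fix z assume "z \<in> jball u r"
  then have "real_of_int (linf_norm (u - z)) \<le> r" by (simp add: jball_def jd_def)
  then have "linf_norm (u - z) \<le> \<lfloor>r\<rfloor>" by (simp add: le_floor_iff)
  then have "\<bar>u $ i - z $ i\<bar> \<le> \<lfloor>r\<rfloor>" for i by (simp add: linf_norm_le_iff)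
  then have "z $ i \<in> {u $ i - \<lfloor>r\<rfloor>..u $ i + \<lfloor>r\<rfloor>}" for i
    by (smt (verit) atLeastAtMost_iff)
  then have "($) z \<in> PiE UNIV (\<lambda>i. {u $ i - \<lfloor>r\<rfloor>..u $ i + \<lfloor>r\<rfloor>})" by auto
  moreover have "z = vec_lambda (($) z)" by simp
  ultimately show "z \<in> vec_lambda ` (PiE UNIV (\<lambda>i. {u $ i - \<lfloor>r\<rfloor>..u $ i + \<lfloor>r\<rfloor>}))"
    by blast
qed

lemma finite_jball [simp]: "finite (jball u r)" for u :: "int ^ 'd"
  by (rule finite_subset[OF jball_cover]) (intro finite_imageI finite_PiE, auto)

lemma card_jball:
  fixes u :: "int ^ 'd"
  assumes "1 \<le> r"
  shows "real (card (jball u r)) \<le> (3 * r) powr dimr TYPE('d)"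
proof -
  let ?P = "PiE UNIV (\<lambda>i. {u $ i - \<lfloor>r\<rfloor>..u $ i + \<lfloor>r\<rfloor>})"
  have "card (jball u r) \<le> card (vec_lambda ` ?P)"
    by (rule card_mono[OF _ jball_cover]) (intro finite_imageI finite_PiE, auto)
  also have "\<dots> \<le> card ?P" by (rule card_image_le) (intro finite_PiE, auto)
  also have "\<dots> = (nat (2 * \<lfloor>r\<rfloor> + 1)) ^ CARD('d)" by (simp add: card_PiE)
  finally have "real (card (jball u r)) \<le> real ((nat (2 * \<lfloor>r\<rfloor> + 1)) ^ CARD('d))" by linarith
  also have "\<dots> = (real (nat (2 * \<lfloor>r\<rfloor> + 1))) ^ CARD('d)" by simp
  also have "\<dots> \<le> (3 * r) ^ CARD('d)"
  proof (rule power_mono)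
    have "1 \<le> \<lfloor>r\<rfloor>" "real_of_int \<lfloor>r\<rfloor> \<le> r" using assms by linarith+
    then show "real (nat (2 * \<lfloor>r\<rfloor> + 1)) \<le> 3 * r" by linarith
  qed simp
  also have "\<dots> = (3 * r) powr dimr TYPE('d)" using assms by (simp add: powr_realpow)
  finally show ?thesis .
qed

section \<open>Sums of powers of the distance\<close>

lemma geometric_le:
  fixes q :: real
  assumes "0 \<le> q" "q < 1"
  shows "(\<Sum>n<N. q ^ n) \<le> 1 / (1 - q)"
proof -
  have "(\<Sum>n<N. q ^ n) = (1 - q ^ N) / (1 - q)" using assms by (simp add: sum_gp_strict)
  also have "\<dots> \<le> 1 / (1 - q)" using assms by (intro divide_right_mono) auto
  finally show ?thesis .
qed

text \<open>Dyadic shells around \<open>u\<close> contribute a geometric series of ratio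
  \<open>q\<close>. The range of \<open>r\<close> starts at 1/2 because \<open>convolution\<close>
  applies the bound at half of a distance that is at least 1.\<close>

lemma tail_sum:
  assumes "dimr TYPE('d) < t"
  obtains C where "C > 0" "\<And>(u :: int ^ 'd) r A. finite A \<Longrightarrow> 1 / 2 \<le> r \<Longrightarrow> (\<And>z. z \<in> A \<Longrightarrow> r \<le> jd u z) \<Longrightarrow>
    (\<Sum>z\<in>A. jd u z powr - t) \<le> C * r powr (dimr TYPE('d) - t)"
proof -
  let ?d = "dimr TYPE('d)"
  define q where "q = 2 powr (?d - t)"
  have q: "0 < q" "q < 1" using assms by (simp_all add: q_def powr_less_one)
  define c where "c = 6 powr ?d"
  have main: "(\<Sum>z\<in>A. jd u z powr - t) \<le> c / (1 - q) * r powr (?d - t)"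
    if A: "finite A" "1 / 2 \<le> r" "\<And>z. z \<in> A \<Longrightarrow> r \<le> jd u z" for u :: "int ^ 'd" and r A
  proof -
    define B where "B N = {z \<in> A. jd u z < r * 2 ^ N}" for N :: nat
    have r: "0 < r" using A(2) by simp
    have shell: "(\<Sum>z\<in>B N. jd u z powr - t) \<le> c * r powr (?d - t) * (\<Sum>n<N. q ^ n)" for N
    proof (induction N)
      case 0
      have "B 0 = {}" using A(3) by (fastforce simp: B_def)
      then show ?case by simp
    next
      case (Suc N)
      define H where "H = {z \<in> A. r * 2 ^ N \<le> jd u z \<and> jd u z < r * 2 ^ Suc N}"
      have un: "B (Suc N) = B N \<union> H" "B N \<inter> H = {}"
        using r by (auto simp: B_def H_def intro: less_le_trans)
      have "(\<Sum>z\<in>H. jd u z powr - t) \<le> (\<Sum>z\<in>H. (r * 2 ^ N) powr - t)"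
        using assms r by (intro sum_mono powr_mono2') (auto simp: H_def intro: le_less_trans[of 0 ?d t, OF _ assms, THEN less_imp_le])
      also have "\<dots> = real (card H) * (r * 2 ^ N) powr - t" by simp
      also have "\<dots> \<le> (3 * (r * 2 ^ Suc N)) powr ?d * (r * 2 ^ N) powr - t"
      proof (rule mult_right_mono)
        have "real (card H) \<le> real (card (jball u (r * 2 ^ Suc N)))"
          by (intro of_nat_mono card_mono) (auto simp: H_def mem_jball)
        also have "\<dots> \<le> (3 * (r * 2 ^ Suc N)) powr ?d"
        proof (rule card_jball)
          have "1 \<le> (2::real) ^ N" by simp
          then have "1 / 2 * (2 * 1) \<le> r * (2 * 2 ^ N)" using A(2) by (intro mult_mono) auto
          then show "1 \<le> r * 2 ^ Suc N" by simp
        qed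
        finally show "real (card H) \<le> (3 * (r * 2 ^ Suc N)) powr ?d" .
      qed simp
      also have "\<dots> = c * r powr (?d - t) * q ^ N"
      proof -
        have "(3 * (r * 2 ^ Suc N)) powr ?d = c * (r * 2 ^ N) powr ?d"
          using r by (simp add: c_def powr_mult[symmetric])
        moreover have "(r * 2 ^ N) powr ?d * (r * 2 ^ N) powr - t = (r * 2 ^ N) powr (?d - t)"
          using r by (simp add: powr_add[symmetric])
        moreover have "(r * 2 ^ N) powr (?d - t) = r powr (?d - t) * q ^ N"
        proof -
          have "(r * 2 ^ N) powr (?d - t) = r powr (?d - t) * (2 powr real N) powr (?d - t)"
            using r by (simp add: powr_mult powr_realpow)
          also have "(2 powr real N) powr (?d - t) = q powr real N"
            by (simp add: q_def powr_powr mult.commute)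
          also have "q powr real N = q ^ N" using q by (simp add: powr_realpow)
          finally show ?thesis .
        qed
        ultimately show ?thesis by simp
      qed
      finally have "(\<Sum>z\<in>H. jd u z powr - t) \<le> c * r powr (?d - t) * q ^ N" .
      moreover have "(\<Sum>z\<in>B (Suc N). jd u z powr - t) = (\<Sum>z\<in>B N. jd u z powr - t) + (\<Sum>z\<in>H. jd u z powr - t)"
        unfolding un(1) using A(1) un(2) by (intro sum.union_disjoint) (auto simp: B_def H_def)
      ultimately show ?case using Suc by (simp add: distrib_left)
    qed
    obtain N where N: "\<And>z. z \<in> A \<Longrightarrow> jd u z < r * 2 ^ N"
    proof -
      obtain N where "Max (insert 0 (jd u ` A)) / r < 2 ^ N"
        using real_arch_pow[of 2 "Max (insert 0 (jd u ` A)) / r"] by auto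
      then have M: "Max (insert 0 (jd u ` A)) < r * 2 ^ N" using r by (simp add: field_simps)
      show ?thesis
      proof (rule that)
        fix z assume "z \<in> A"
        then have "jd u z \<le> Max (insert 0 (jd u ` A))" using A(1) by (intro Max_ge) auto
        then show "jd u z < r * 2 ^ N" using M by simp
      qed
    qed
    then have "A = B N" by (auto simp: B_def)
    then have "(\<Sum>z\<in>A. jd u z powr - t) \<le> c * r powr (?d - t) * (\<Sum>n<N. q ^ n)" using shell[of N] by simp
    also have "\<dots> \<le> c * r powr (?d - t) * (1 / (1 - q))"
      using geometric_le[of q N] q by (intro mult_left_mono) (auto simp: c_def)
    finally show ?thesis by simp
  qed
  have "0 < c / (1 - q)" using q by (simp add: c_def)
  from this main show ?thesis by (rule that)
qed

text \<open>Dyadic shells again, now counted inwards from radius \<open>r\<close>. They exhaust the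
  ball since \<open>jd\<close> is at least 1; for the same reason a nonempty shell has outer radius
  at least 1, as the volume bound requires.\<close>

lemma ball_sum:
  assumes "0 \<le> t" "t < dimr TYPE('d)"
  obtains C where "C > 0" "\<And>(u :: int ^ 'd) r A. finite A \<Longrightarrow> 1 \<le> r \<Longrightarrow> (\<And>z. z \<in> A \<Longrightarrow> jd u z \<le> r) \<Longrightarrow>
    (\<Sum>z\<in>A. jd u z powr - t) \<le> C * r powr (dimr TYPE('d) - t)"
proof -
  let ?d = "dimr TYPE('d)"
  define q where "q = 2 powr (t - ?d)"
  have q: "0 < q" "q < 1" using assms by (simp_all add: q_def powr_less_one)
  define c where "c = 3 powr ?d * 2 powr t"
  have main: "(\<Sum>z\<in>A. jd u z powr - t) \<le> c / (1 - q) * r powr (?d - t)"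
    if A: "finite A" "1 \<le> r" "\<And>z. z \<in> A \<Longrightarrow> jd u z \<le> r" for u :: "int ^ 'd" and r A
  proof -
    define B where "B N = {z \<in> A. r / 2 ^ N < jd u z}" for N :: nat
    have r: "0 < r" using A(2) by simp
    have shell: "(\<Sum>z\<in>B N. jd u z powr - t) \<le> c * r powr (?d - t) * (\<Sum>n<N. q ^ n)" for N
    proof (induction N)
      case 0
      have "B 0 = {}" using A(3) by (fastforce simp: B_def)
      then show ?case by simp
    next
      case (Suc N)
      define s where "s = r / 2 ^ N"
      have s: "0 < s" using r by (simp add: s_def)
      define H where "H = {z \<in> A. s / 2 < jd u z \<and> jd u z \<le> s}"
      have un: "B (Suc N) = B N \<union> H" "B N \<inter> H = {}"
        using s by (auto simp: B_def H_def s_def mult.commute)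
      have "(\<Sum>z\<in>H. jd u z powr - t) \<le> c * r powr (?d - t) * q ^ N"
      proof (cases "H = {}")
        case True
        then show ?thesis using q by (simp add: c_def)
      next
        case False
        then obtain z where "z \<in> H" by auto
        then have s1: "1 \<le> s" using jd_ge_1[of u z] by (simp add: H_def)
        have "(\<Sum>z\<in>H. jd u z powr - t) \<le> (\<Sum>z\<in>H. (s / 2) powr - t)"
          using assms s by (intro sum_mono powr_mono2') (auto simp: H_def)
        also have "\<dots> = real (card H) * (s / 2) powr - t" by simp
        also have "\<dots> \<le> (3 * s) powr ?d * (s / 2) powr - t"
        proof (rule mult_right_mono)
          have "real (card H) \<le> real (card (jball u s))"
            by (intro of_nat_mono card_mono) (auto simp: H_def mem_jball)
          also have "\<dots> \<le> (3 * s) powr ?d" by (rule card_jball[OF s1])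
          finally show "real (card H) \<le> (3 * s) powr ?d" .
        qed simp
        also have "\<dots> = c * s powr (?d - t)"
          using s by (simp add: c_def powr_mult powr_divide powr_minus powr_diff field_simps)
        also have "s powr (?d - t) = r powr (?d - t) * q ^ N"
        proof -
          have "s = r * 2 powr - real N"
            by (simp add: s_def powr_minus powr_realpow divide_inverse)
          then have "s powr (?d - t) = r powr (?d - t) * (2 powr - real N) powr (?d - t)"
            using r by (simp add: powr_mult)
          also have "(2 powr - real N) powr (?d - t) = q powr real N"
            by (simp add: q_def powr_powr algebra_simps)
          also have "q powr real N = q ^ N" using q by (simp add: powr_realpow)
          finally show ?thesis .
        qed
        finally show ?thesis by (simp add: mult.assoc)
      qed
      moreover have "(\<Sum>z\<in>B (Suc N). jd u z powr - t) = (\<Sum>z\<in>B N. jd u z powr - t) + (\<Sum>z\<in>H. jd u z powr - t)"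
        unfolding un(1) using A(1) un(2) by (intro sum.union_disjoint) (auto simp: B_def H_def)
      ultimately show ?case using Suc by (simp add: distrib_left)
    qed
    obtain N where "r < 2 ^ N" using real_arch_pow[of 2 r] by auto
    then have "r / 2 ^ N < 1" by simp
    then have "r / 2 ^ N < jd u z" for z using jd_ge_1[of u z] by linarith
    then have "A = B N" by (auto simp: B_def)
    then have "(\<Sum>z\<in>A. jd u z powr - t) \<le> c * r powr (?d - t) * (\<Sum>n<N. q ^ n)" using shell[of N] by simp
    also have "\<dots> \<le> c * r powr (?d - t) * (1 / (1 - q))"
      using geometric_le[of q N] q by (intro mult_left_mono) (auto simp: c_def)
    finally show ?thesis by simp
  qed
  have "0 < c / (1 - q)" using q by (simp add: c_def)
  from this main show ?thesis by (rule that)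
qed

text \<open>Split according to whether \<open>z\<close> is near \<open>y\<close>, near
  \<open>u\<close>, or far from both; each part is of the same order. The condition
  \<open>x < d\<close> controls the sum near \<open>u\<close>, and \<open>2 < x\<close> makes the
  tail converge.\<close>

lemma convolution:
  assumes "2 < x" "x < dimr TYPE('d)"
  obtains C where "C > 0" "\<And>(y :: int ^ 'd) u A. finite A \<Longrightarrow>
    (\<Sum>z\<in>A. jd y z powr (2 - dimr TYPE('d)) * jd z u powr - x) \<le> C * jd y u powr (2 - x)"
proof -
  let ?d = "dimr TYPE('d)"
  obtain C1 where C1: "C1 > 0" "\<And>(u :: int ^ 'd) r A. finite A \<Longrightarrow> 1 \<le> r \<Longrightarrow> (\<And>z. z \<in> A \<Longrightarrow> jd u z \<le> r) \<Longrightarrow>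
    (\<Sum>z\<in>A. jd u z powr - (?d - 2)) \<le> C1 * r powr (?d - (?d - 2))"
    by (rule ball_sum[where 'd = 'd, of "?d - 2"]) (use assms in auto)
  obtain C2 where C2: "C2 > 0" "\<And>(u :: int ^ 'd) r A. finite A \<Longrightarrow> 1 \<le> r \<Longrightarrow> (\<And>z. z \<in> A \<Longrightarrow> jd u z \<le> r) \<Longrightarrow>
    (\<Sum>z\<in>A. jd u z powr - x) \<le> C2 * r powr (?d - x)"
    by (rule ball_sum[where 'd = 'd, of x]) (use assms in auto)
  obtain C3 where C3: "C3 > 0" "\<And>(u :: int ^ 'd) r A. finite A \<Longrightarrow> 1 / 2 \<le> r \<Longrightarrow> (\<And>z. z \<in> A \<Longrightarrow> r \<le> jd u z) \<Longrightarrow>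
    (\<Sum>z\<in>A. jd u z powr - (?d - 2 + x)) \<le> C3 * r powr (?d - (?d - 2 + x))"
    by (rule tail_sum[where 'd = 'd, of "?d - 2 + x"]) (use assms in auto)
  define C where "C = 2 powr x * C1 + 2 powr (?d - 2) * C2 + 3 powr (?d - 2) * C3 * 2 powr (x - 2)"
  have "(\<Sum>z\<in>A. jd y z powr (2 - ?d) * jd z u powr - x) \<le> C * jd y u powr (2 - x)"
    if A: "finite A" for y u :: "int ^ 'd" and A
  proof -
    define s where "s = jd y u"
    have s: "1 \<le> s" by (simp add: s_def jd_ge_1)
    define F where "F z = jd y z powr (2 - ?d) * jd z u powr - x" for z
    have F0: "0 \<le> F z" for z by (simp add: F_def)
    define A1 A2 A3 where "A1 = {z \<in> A. jd y z \<le> s / 2}" and "A2 = {z \<in> A. jd z u \<le> s / 2}"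
      and "A3 = {z \<in> A. s / 2 < jd y z \<and> s / 2 < jd z u}"
    have tri: "s \<le> jd y z + jd z u" for z unfolding s_def by (rule jd_triangle)
    have "sum F A1 \<le> (\<Sum>z\<in>A1. (s / 2) powr - x * jd y z powr - (?d - 2))"
    proof (rule sum_mono)
      fix z assume "z \<in> A1"
      then have "s / 2 \<le> jd z u" using tri[of z] by (simp add: A1_def)
      then have "jd z u powr - x \<le> (s / 2) powr - x" using s assms by (intro powr_mono2') auto
      then show "F z \<le> (s / 2) powr - x * jd y z powr - (?d - 2)"
        unfolding F_def by (subst mult.commute) (intro mult_mono, auto)
    qed
    also have "\<dots> \<le> (s / 2) powr - x * (C1 * s powr (?d - (?d - 2)))"
      unfolding sum_distrib_left[symmetric] using A s
      by (intro mult_left_mono C1(2)) (auto simp: A1_def)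
    also have "\<dots> = 2 powr x * C1 * s powr (2 - x)"
      using s by (simp add: powr_divide powr_minus powr_diff field_simps)
    finally have 1: "sum F A1 \<le> 2 powr x * C1 * s powr (2 - x)" .
    have "sum F A2 \<le> (\<Sum>z\<in>A2. (s / 2) powr (2 - ?d) * jd u z powr - x)"
    proof (rule sum_mono)
      fix z assume "z \<in> A2"
      then have "s / 2 \<le> jd y z" using tri[of z] by (simp add: A2_def)
      then have "jd y z powr (2 - ?d) \<le> (s / 2) powr (2 - ?d)" using s assms by (intro powr_mono2') auto
      then show "F z \<le> (s / 2) powr (2 - ?d) * jd u z powr - x"
        unfolding F_def jd_sym[of u z] by (intro mult_right_mono) auto
    qed
    also have "\<dots> \<le> (s / 2) powr (2 - ?d) * (C2 * s powr (?d - x))"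
      unfolding sum_distrib_left[symmetric] using A s
      by (intro mult_left_mono C2(2)) (auto simp: A2_def jd_sym[of u])
    also have "\<dots> = 2 powr (?d - 2) * C2 * s powr (2 - x)"
      using s by (simp add: powr_divide powr_diff field_simps)
    finally have 2: "sum F A2 \<le> 2 powr (?d - 2) * C2 * s powr (2 - x)" .
    have "sum F A3 \<le> (\<Sum>z\<in>A3. 3 powr (?d - 2) * jd u z powr - (?d - 2 + x))"
    proof (rule sum_mono)
      fix z assume z: "z \<in> A3"
      \<comment> \<open>In this region the distance of \<open>y\<close> and \<open>u\<close> is
        below \<open>2 * jd y z\<close>, so the factor at \<open>y\<close> can be absorbed into a
        power of \<open>jd z u\<close>.\<close>
      then have "jd z u \<le> 3 * jd y z"
        using jd_triangle[of z u y] by (simp add: A3_def s_def jd_sym[of z y])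
      then have "jd z u / 3 \<le> jd y z" by simp
      then have "jd y z powr (2 - ?d) \<le> (jd z u / 3) powr (2 - ?d)" using assms by (intro powr_mono2') auto
      also have "\<dots> = 3 powr (?d - 2) * jd z u powr (2 - ?d)"
        by (simp add: powr_divide powr_diff field_simps)
      finally have "F z \<le> 3 powr (?d - 2) * jd z u powr (2 - ?d) * jd z u powr - x"
        unfolding F_def by (intro mult_right_mono) auto
      also have "\<dots> = 3 powr (?d - 2) * jd u z powr - (?d - 2 + x)"
        by (simp add: jd_sym[of u z] powr_add[symmetric] mult.assoc)
      finally show "F z \<le> 3 powr (?d - 2) * jd u z powr - (?d - 2 + x)" .
    qed
    also have "\<dots> \<le> 3 powr (?d - 2) * (C3 * (s / 2) powr (?d - (?d - 2 + x)))"
      unfolding sum_distrib_left[symmetric] using A s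
      by (intro mult_left_mono C3(2)) (auto simp: A3_def jd_sym[of u])
    also have "\<dots> = 3 powr (?d - 2) * C3 * 2 powr (x - 2) * s powr (2 - x)"
      using s by (simp add: powr_divide powr_diff field_simps)
    finally have 3: "sum F A3 \<le> 3 powr (?d - 2) * C3 * 2 powr (x - 2) * s powr (2 - x)" .
    have "A = A1 \<union> A2 \<union> A3" unfolding A1_def A2_def A3_def by force
    have fin: "finite A1" "finite A2" "finite A3" using A by (auto simp: A1_def A2_def A3_def)
    have un: "sum F (X \<union> Y) \<le> sum F X + sum F Y" if "finite X" "finite Y" for X Y
      using sum.union_inter[OF that, of F] sum_nonneg[of "X \<inter> Y" F] F0 by simp
    have "sum F A \<le> sum F A1 + sum F A2 + sum F A3"
      using un[of "A1 \<union> A2" A3] un[of A1 A2] fin \<open>A = A1 \<union> A2 \<union> A3\<close> by simp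
    also have "\<dots> \<le> C * s powr (2 - x)" using 1 2 3 by (simp add: C_def distrib_right)
    finally show ?thesis by (simp add: F_def s_def)
  qed
  moreover have "C > 0" using C1 C2 C3 unfolding C_def by (intro add_pos_pos mult_pos_pos) auto
  ultimately show ?thesis by (intro that)
qed

section \<open>Tree-graph moments and reaching the boundary\<close>

definition edges_in :: "'v set set \<Rightarrow> 'v set \<Rightarrow> 'v set set"
  where "edges_in E W = {e \<in> E. e \<subseteq> W}"

text \<open>The clause \<open>x \<in> S\<close> is there because \<open>conn\<close> is reflexive;
  confinement of the path to \<open>S\<close> comes from summing over subsets of
  \<open>edges_in E S\<close> alone.\<close>

definition tau :: "'v set set \<Rightarrow> real \<Rightarrow> 'v set \<Rightarrow> 'v \<Rightarrow> 'v \<Rightarrow> real"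
  where "tau E p S x y = bpr p (edges_in E S) (\<lambda>K. x \<in> S \<and> conn K x y)"

definition inner_boundary :: "'v set set \<Rightarrow> 'v set \<Rightarrow> 'v set"
  where "inner_boundary E S = {u \<in> S. \<exists>v. v \<notin> S \<and> {u, v} \<in> E}"

lemma finite_edges_in: "finite W \<Longrightarrow> finite (edges_in E W)"
  by (rule finite_subset[of _ "Pow W"]) (auto simp: edges_in_def)

lemma edges_in_Pow: "edges_in E W \<subseteq> Pow W"
  by (auto simp: edges_in_def)

lemma edges_in_conn: "K \<subseteq> edges_in E W \<Longrightarrow> conn K x y \<Longrightarrow> x \<in> W \<Longrightarrow> y \<in> W"
  using edges_in_Pow[of E W] by (intro conn_in_Pow[of K W x y]) (auto simp: Int_absorb2)

lemma edges_in_empty: "K \<subseteq> edges_in E W \<Longrightarrow> {} \<notin> E \<Longrightarrow> {} \<notin> K"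
  by (auto simp: edges_in_def)

text \<open>Edges not contained in \<open>S\<close> integrate out, so connections inside
  \<open>S\<close> have the same probability in every ambient volume \<open>W\<close>.\<close>

lemma bpr_conn_subset:
  assumes "finite W" "S \<subseteq> W" "x \<in> S"
  shows "bpr p (edges_in E W) (\<lambda>K. conn (K \<inter> Pow S) x y) = tau E p S x y"
proof -
  have "bpr p (edges_in E W) (\<lambda>K. conn (K \<inter> Pow S) x y) =
      bpr p (edges_in E S) (\<lambda>K. conn (K \<inter> Pow S) x y)"
    unfolding bpr_def
  proof (rule bex_restrict)
    show "finite (edges_in E W)" using assms by (intro finite_edges_in)
    show "edges_in E S \<subseteq> edges_in E W" using assms by (auto simp: edges_in_def)
    fix K assume "K \<subseteq> edges_in E W"
    then have "K \<inter> edges_in E S \<inter> Pow S = K \<inter> Pow S" by (auto simp: edges_in_def)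
    then show "of_bool (conn (K \<inter> Pow S) x y) = (of_bool (conn (K \<inter> edges_in E S \<inter> Pow S) x y) :: real)"
      by simp
  qed
  also have "\<dots> = tau E p S x y"
    unfolding tau_def bpr_def
  proof (intro bex_cong)
    fix K assume "K \<subseteq> edges_in E S"
    then have "K \<inter> Pow S = K" using edges_in_Pow[of E S] by (simp add: Int_absorb2)
    then show "of_bool (conn (K \<inter> Pow S) x y) = (of_bool (x \<in> S \<and> conn K x y) :: real)"
      using assms(3) by simp
  qed
  finally show ?thesis .
qed

lemma bpr_conn: "x \<in> W \<Longrightarrow> bpr p (edges_in E W) (\<lambda>K. conn K x y) = tau E p W x y"
  by (simp add: tau_def)

lemma sum_PiE_split:
  fixes g h :: "('i \<Rightarrow> 'a) \<Rightarrow> real"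
  assumes "finite A" "I \<subseteq> A"
  shows "(\<Sum>f\<in>PiE A (\<lambda>_. B). g (restrict f I) * h (restrict f (A - I))) =
    (\<Sum>f\<in>PiE I (\<lambda>_. B). g f) * (\<Sum>f\<in>PiE (A - I) (\<lambda>_. B). h f)"
proof -
  have "(\<Sum>f\<in>PiE I (\<lambda>_. B). g f) * (\<Sum>f\<in>PiE (A - I) (\<lambda>_. B). h f) =
      (\<Sum>(f1, f2)\<in>PiE I (\<lambda>_. B) \<times> PiE (A - I) (\<lambda>_. B). g f1 * h f2)"
    by (simp add: sum_product sum.cartesian_product)
  also have "\<dots> = (\<Sum>f\<in>PiE A (\<lambda>_. B). g (restrict f I) * h (restrict f (A - I)))"
  proof (rule sum.reindex_bij_witness[where
      i = "\<lambda>f. (restrict f I, restrict f (A - I))" and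
      j = "\<lambda>(f1, f2). restrict (\<lambda>i. if i \<in> I then f1 i else f2 i) A"], goal_cases)
    case (1 x)
    then show ?case using assms(2)
      by (auto simp: PiE_iff fun_eq_iff extensional_def restrict_def)
  next
    case (2 x)
    then show ?case using assms(2) by (auto simp: PiE_iff)
  next
    case (3 f)
    then show ?case using assms(2)
      by (auto simp: PiE_iff fun_eq_iff extensional_def restrict_def)
  next
    case (4 f)
    then show ?case using assms(2) by (auto simp: PiE_iff)
  next
    case (5 x)
    obtain f1 f2 where x: "x = (f1, f2)" by (cases x)
    with 5 have "restrict (restrict (\<lambda>i. if i \<in> I then f1 i else f2 i) A) I = f1"
      "restrict (restrict (\<lambda>i. if i \<in> I then f1 i else f2 i) A) (A - I) = f2"
      using assms(2) by (auto simp: PiE_iff fun_eq_iff extensional_def restrict_def)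
    then show ?case by (simp add: x)
  qed
  finally show ?thesis by simp
qed

text \<open>What is used of the model at criticality, in finite-volume form: edges have length at
  most \<open>L\<close>, nearest-neighbour edges are available for lattice paths, and the two-point
  bounds hold. In the lower bound \<open>W\<close> must be large depending on \<open>x\<close> and
  \<open>y\<close>, since a finite volume only approximates the infinite one.\<close>

locale perc =
  fixes E :: "(int ^ 'd) set set" and p a b L d :: real
  assumes d_eq: "d = real CARD('d)"
    and p01: "0 < p" "p < 1"
    and dim: "7 \<le> CARD('d)"
    and E_form: "\<And>e. e \<in> E \<Longrightarrow> \<exists>x y. e = {x, y} \<and> x \<noteq> y \<and> jd x y \<le> L"
    and E_nn: "\<And>x y. l1_norm (x - y) = 1 \<Longrightarrow> {x, y} \<in> E"
    and ab: "0 < a" "0 < b" "1 \<le> L"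
    and upper: "\<And>W x y. finite W \<Longrightarrow> tau E p W x y \<le> b * jd x y powr (2 - d)"
    and lower: "\<And>x y. \<exists>W0. finite W0 \<and>
      (\<forall>W. finite W \<longrightarrow> W0 \<subseteq> W \<longrightarrow> a * jd x y powr (2 - d) \<le> tau E p W x y)"
begin

abbreviation F where "F \<equiv> edges_in E"
abbreviation t where "t \<equiv> tau E p"
abbreviation Pr where "Pr W \<equiv> bpr p (edges_in E W)"
abbreviation bd where "bd \<equiv> inner_boundary E"

text \<open>The functional \<phi>(S) started at an arbitrary point, with boundary vertices instead
  of boundary edges; for finite \<open>S\<close> the two differ by \<open>p\<close> and at most the
  degree.\<close>

definition phi_in :: "(int ^ 'd) set \<Rightarrow> int ^ 'd \<Rightarrow> real"
  where "phi_in S x = (\<Sum>u\<in>bd S. t S x u)"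

lemma d7: "7 \<le> d" using dim by (simp add: d_eq)

lemma p_le: "0 \<le> p" "p \<le> 1" using p01 by auto

lemma E_ne: "{} \<notin> E" using E_form by fastforce

lemma E_edge: "{x, y} \<in> E \<Longrightarrow> x \<noteq> y \<and> jd x y \<le> L"
  using E_form[of "{x, y}"] by (auto simp: doubleton_eq_iff jd_sym)

lemma t_nonneg: "0 \<le> t S x y"
  unfolding tau_def by (intro bpr_nonneg p_le)

lemma finite_bd: "finite S \<Longrightarrow> finite (bd S)"
  by (simp add: inner_boundary_def)

lemma phi_in_nonneg: "0 \<le> phi_in S x"
  unfolding phi_in_def by (intro sum_nonneg t_nonneg)

lemma Pr_conn_le: "finite W \<Longrightarrow> x \<in> W \<Longrightarrow> Pr W (\<lambda>K. conn K x y) \<le> b * jd x y powr (2 - d)"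
  using upper[of W x y] by (simp add: bpr_conn)

lemma powr_jd_le: "x \<le> y \<Longrightarrow> jd u v powr x \<le> jd u v powr y"
  by (intro powr_mono jd_ge_1)

text \<open>Tree-graph bound by induction on the number of targets; the weight
  \<open>jd z u powr (- 9 / 4)\<close> records the distance to the ball. The exponent 17/4 is at
  least 4, which closes the induction: two subtrees give twice -9/4, and summing over the branch
  point turns -9/2 into -5/2. It is below 9/2, which lets high moments win against the threshold
  r^(9/2) in \<open>joint_bound\<close>.\<close>

lemma tree_moment:
  "1 \<le> k \<Longrightarrow> \<exists>C>0. \<forall>W A u r z. finite W \<longrightarrow> finite (A :: nat set) \<longrightarrow> card A = k \<longrightarrow> 1 \<le> r \<longrightarrow> z \<in> W \<longrightarrow>
    (\<Sum>f\<in>PiE A (\<lambda>_. W \<inter> jball u r). Pr W (\<lambda>K. \<forall>i\<in>A. conn K z (f i)))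
      \<le> C * r powr (17 / 4 * k) * jd z u powr (- 9 / 4)"
proof (induction k rule: less_induct)
  case (less k)
  show ?case
  proof (cases "k = 1")
    case True
    obtain C where C: "C > 0" "\<And>(y :: int ^ 'd) u A. finite A \<Longrightarrow>
        (\<Sum>z\<in>A. jd y z powr (2 - d) * jd z u powr - (17 / 4)) \<le> C * jd y u powr (2 - 17 / 4)"
      by (rule convolution[where 'd = 'd, of "17 / 4", folded d_eq]) (use d7 in auto)
    have "(\<Sum>f\<in>PiE A (\<lambda>_. W \<inter> jball u r). Pr W (\<lambda>K. \<forall>i\<in>A. conn K z (f i)))
        \<le> b * C * r powr (17 / 4 * k) * jd z u powr (- 9 / 4)"
      if h: "finite W" "finite A" "card A = k" "1 \<le> r" "z \<in> W" for W u r and z :: "int ^ 'd" and A :: "nat set"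
    proof -
      obtain i :: nat where A: "A = {i}" using h(3) True card_1_singletonE by blast
      let ?B = "W \<inter> jball u r"
      have "(\<Sum>f\<in>PiE A (\<lambda>_. ?B). Pr W (\<lambda>K. \<forall>i\<in>A. conn K z (f i))) =
          (\<Sum>x\<in>?B. Pr W (\<lambda>K. conn K z x))"
        unfolding A
        by (rule sum.reindex_bij_witness[where j = "\<lambda>f. f i" and i = "\<lambda>x. restrict (\<lambda>_. x) {i}"])
          (auto simp: PiE_iff extensional_def fun_eq_iff)
      also have "\<dots> \<le> (\<Sum>x\<in>?B. b * r powr (17 / 4) * (jd z x powr (2 - d) * jd x u powr - (17 / 4)))"
      proof (rule sum_mono)
        fix x assume x: "x \<in> ?B"
        \<comment> \<open>The indicator of the ball is replaced by the larger weight (r /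
          \<open>jd x u\<close>)^(17/4), so that the convolution bound applies.\<close>
        have "1 = r powr (17 / 4) * r powr - (17 / 4)" using h(4) by (simp add: powr_minus)
        also have "\<dots> \<le> r powr (17 / 4) * jd x u powr - (17 / 4)"
          using x by (intro mult_left_mono powr_mono2') (auto simp: mem_jball jd_sym)
        finally have "b * jd z x powr (2 - d) * 1 \<le>
            b * jd z x powr (2 - d) * (r powr (17 / 4) * jd x u powr - (17 / 4))"
          using ab by (intro mult_left_mono) auto
        then show "Pr W (\<lambda>K. conn K z x) \<le> b * r powr (17 / 4) * (jd z x powr (2 - d) * jd x u powr - (17 / 4))"
          using Pr_conn_le[OF h(1,5), of x] by (simp add: mult_ac)
      qed
      also have "\<dots> \<le> b * r powr (17 / 4) * (C * jd z u powr (2 - 17 / 4))"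
        unfolding sum_distrib_left[symmetric] using ab h by (intro mult_left_mono C) auto
      finally show ?thesis using True by (simp add: mult_ac)
    qed
    then show ?thesis using C ab by (intro exI[of _ "b * C"]) auto
  next
    case False
    then have k2: "2 \<le> k" using less.prems by simp
    obtain C where C: "C > 0" "\<And>(y :: int ^ 'd) u A. finite A \<Longrightarrow>
        (\<Sum>z\<in>A. jd y z powr (2 - d) * jd z u powr - (9 / 2)) \<le> C * jd y u powr (2 - 9 / 2)"
      by (rule convolution[where 'd = 'd, of "9 / 2", folded d_eq]) (use d7 in auto)
    have "\<forall>m. \<exists>c>0. 1 \<le> m \<and> m < k \<longrightarrow> (\<forall>W A u r z. finite W \<longrightarrow> finite (A :: nat set) \<longrightarrow> card A = m \<longrightarrow> 1 \<le> r \<longrightarrow> z \<in> W \<longrightarrow>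
      (\<Sum>f\<in>PiE A (\<lambda>_. W \<inter> jball u r). Pr W (\<lambda>K. \<forall>i\<in>A. conn K z (f i)))
        \<le> c * r powr (17 / 4 * m) * jd z u powr (- 9 / 4))"
      (is "\<forall>m. \<exists>c>0. 1 \<le> m \<and> m < k \<longrightarrow> ?P m c")
    proof
      fix m
      show "\<exists>c>0. 1 \<le> m \<and> m < k \<longrightarrow> ?P m c"
      proof (cases "1 \<le> m \<and> m < k")
        case True
        then show ?thesis using less.IH[of m] by simp
      qed (auto intro: exI[of _ 1])
    qed
    from choice[OF this] obtain c where cc: "\<forall>m. c m > 0 \<and> (1 \<le> m \<and> m < k \<longrightarrow> ?P m (c m))" ..
    have c: "c m > 0" "1 \<le> m \<Longrightarrow> m < k \<Longrightarrow> ?P m (c m)" for m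
      using cc[rule_format, of m] by (simp, intro mp[OF conjunct2[OF cc[THEN spec, of m]]] conjI)
    define M where "M = (\<Sum>i<k. c i)"
    have M: "c i \<le> M" if "i < k" for i
      unfolding M_def using that c(1) by (intro member_le_sum) (auto intro: less_imp_le)
    have M0: "0 \<le> M" unfolding M_def using c(1) by (intro sum_nonneg less_imp_le)
    define Ck where "Ck = 2 ^ k * (b * C * M\<^sup>2) + 1"
    have "(\<Sum>f\<in>PiE A (\<lambda>_. W \<inter> jball u r). Pr W (\<lambda>K. \<forall>i\<in>A. conn K z (f i)))
        \<le> Ck * r powr (17 / 4 * k) * jd z u powr (- 9 / 4)"
      if h: "finite W" "finite A" "card A = k" "1 \<le> r" "z \<in> W" for W u r z and A :: "nat set"
    proof -
      let ?B = "W \<inter> jball u r"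
      define II where "II = {I. I \<subseteq> A \<and> I \<noteq> {} \<and> I \<noteq> A}"
      have II_fin: "finite II" using h(2) unfolding II_def by simp
      have II_card: "card II \<le> 2 ^ k"
      proof -
        have "card II \<le> card (Pow A)" unfolding II_def using h(2) by (intro card_mono) auto
        then show ?thesis using h(2,3) by (simp add: card_Pow)
      qed
      define Q where "Q J z f = Pr W (\<lambda>K. \<forall>i\<in>J. conn K z (f i))" for J :: "nat set" and z f
      have Q0: "0 \<le> Q J z f" for J z f unfolding Q_def by (intro bpr_nonneg p_le)
      \<comment> \<open>The first branch point splits the targets into two nonempty groups; van den
        Berg-Kesten separates the stem from the two subtrees, each with fewer targets.\<close>
      have step: "Q A z f \<le> (\<Sum>(z', I)\<in>W \<times> II. b * jd z z' powr (2 - d) * (Q I z' (restrict f I) * Q (A - I) z' (restrict f (A - I))))"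
        for f
      proof -
        define ev where "ev = (\<lambda>(z', I). disjointly (\<lambda>K. conn K z z')
           (disjointly (\<lambda>K. \<forall>i\<in>I. conn K z' (f i)) (\<lambda>K. \<forall>i\<in>A - I. conn K z' (f i))))"
        have "Q A z f \<le> (\<Sum>zI\<in>W \<times> II. Pr W (ev zI))"
          unfolding Q_def
        proof (rule bpr_Un_le[OF p_le])
          show "finite (W \<times> II)" using h(1) II_fin by simp
          fix K assume K: "K \<subseteq> F W" "\<forall>i\<in>A. conn K z (f i)"
          have "finite K" using K(1) finite_edges_in[OF h(1)] finite_subset by metis
          moreover have "{} \<notin> K" using edges_in_empty[OF K(1) E_ne] .
          ultimately obtain z' I where zI: "I \<subseteq> A" "I \<noteq> {}" "I \<noteq> A"
            "disjointly (\<lambda>K. conn K z z') (disjointly (\<lambda>K. \<forall>i\<in>I. conn K z' (f i)) (\<lambda>K. \<forall>i\<in>A - I. conn K z' (f i))) K"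
            using conn_branch[of K A z f] K(2) h(2,3) k2 by auto
          from zI(4) obtain K1 where "K1 \<subseteq> K" "conn K1 z z'" by (rule disjointlyE)
          then have "z' \<in> W" using edges_in_conn[OF K(1) conn_mono] h(5) by metis
          then show "\<exists>zI\<in>W \<times> II. ev zI K"
            using zI by (intro bexI[of _ "(z', I)"]) (auto simp: ev_def II_def)
        qed
        also have "\<dots> \<le> (\<Sum>(z', I)\<in>W \<times> II. b * jd z z' powr (2 - d) * (Q I z' (restrict f I) * Q (A - I) z' (restrict f (A - I))))"
        proof (intro sum_mono)
          fix zI assume zI: "zI \<in> W \<times> II"
          obtain z' I where eq: "zI = (z', I)" by (cases zI)
          have "Pr W (ev zI) \<le> Pr W (\<lambda>K. conn K z z') * Q I z' f * Q (A - I) z' f"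
            unfolding eq ev_def Q_def prod.case
            by (intro bk3 finite_edges_in h(1) p_le increasing_conn increasing_all)
          also have "\<dots> \<le> b * jd z z' powr (2 - d) * Q I z' f * Q (A - I) z' f"
            by (intro mult_right_mono Pr_conn_le h Q0)
          also have "\<dots> = b * jd z z' powr (2 - d) * (Q I z' (restrict f I) * Q (A - I) z' (restrict f (A - I)))"
            unfolding Q_def by simp
          finally show "Pr W (ev zI) \<le> (case zI of (z', I) \<Rightarrow> b * jd z z' powr (2 - d) * (Q I z' (restrict f I) * Q (A - I) z' (restrict f (A - I))))"
            by (simp only: eq prod.case)
        qed
        finally show ?thesis .
      qed
      have "(\<Sum>f\<in>PiE A (\<lambda>_. ?B). Q A z f) \<le> (\<Sum>f\<in>PiE A (\<lambda>_. ?B). \<Sum>(z', I)\<in>W \<times> II. b * jd z z' powr (2 - d) * (Q I z' (restrict f I) * Q (A - I) z' (restrict f (A - I))))"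
        by (intro sum_mono step)
      also have "\<dots> = (\<Sum>(z', I)\<in>W \<times> II. b * jd z z' powr (2 - d) *
          ((\<Sum>f\<in>PiE I (\<lambda>_. ?B). Q I z' f) * (\<Sum>f\<in>PiE (A - I) (\<lambda>_. ?B). Q (A - I) z' f)))"
      proof (subst sum.swap, intro sum.cong refl)
        fix zI assume "zI \<in> W \<times> II"
        then obtain z' I where eq: "zI = (z', I)" "I \<subseteq> A" by (auto simp: II_def)
        show "(\<Sum>f\<in>PiE A (\<lambda>_. ?B). case zI of (z', I) \<Rightarrow> b * jd z z' powr (2 - d) * (Q I z' (restrict f I) * Q (A - I) z' (restrict f (A - I)))) =
          (case zI of (z', I) \<Rightarrow> b * jd z z' powr (2 - d) *
          ((\<Sum>f\<in>PiE I (\<lambda>_. ?B). Q I z' f) * (\<Sum>f\<in>PiE (A - I) (\<lambda>_. ?B). Q (A - I) z' f)))"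
          unfolding eq prod.case sum_distrib_left[symmetric] sum_PiE_split[OF h(2) eq(2)] ..
      qed
      also have "\<dots> \<le> (\<Sum>(z', I)\<in>W \<times> II. b * M\<^sup>2 * r powr (17 / 4 * k) * (jd z z' powr (2 - d) * jd z' u powr - (9 / 2)))"
      proof (intro sum_mono)
        fix zI assume "zI \<in> W \<times> II"
        then obtain z' I where eq: "zI = (z', I)" "z' \<in> W" "I \<subseteq> A" "I \<noteq> {}" "I \<noteq> A" by (auto simp: II_def)
        have finI: "finite I" "finite (A - I)" using eq h(2) finite_subset by auto
        have cI: "1 \<le> card I" "card I < k"
          using eq h finI psubset_card_mono[of A I] by (auto simp: Suc_le_eq card_gt_0_iff)
        have cJ: "card (A - I) = k - card I" using eq finI h by (simp add: card_Diff_subset)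
        have m: "(\<Sum>f\<in>PiE J (\<lambda>_. ?B). Q J z' f) \<le> M * r powr (17 / 4 * card J) * jd z' u powr (- 9 / 4)"
          if J: "finite J" "1 \<le> card J" "card J < k" for J
        proof -
          have "(\<Sum>f\<in>PiE J (\<lambda>_. ?B). Q J z' f) \<le> c (card J) * r powr (17 / 4 * card J) * jd z' u powr (- 9 / 4)"
            unfolding Q_def using c(2)[OF J(2,3)] h(1,4) J(1) eq(2) by simp
          also have "\<dots> \<le> M * r powr (17 / 4 * card J) * jd z' u powr (- 9 / 4)"
            using M[OF J(3)] by (intro mult_right_mono) auto
          finally show ?thesis .
        qed
        have "(\<Sum>f\<in>PiE I (\<lambda>_. ?B). Q I z' f) * (\<Sum>f\<in>PiE (A - I) (\<lambda>_. ?B). Q (A - I) z' f) \<le>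
           (M * r powr (17 / 4 * card I) * jd z' u powr (- 9 / 4)) * (M * r powr (17 / 4 * card (A - I)) * jd z' u powr (- 9 / 4))"
          using cI cJ finI M0 by (intro mult_mono m sum_nonneg Q0 mult_nonneg_nonneg) auto
        also have "\<dots> = M\<^sup>2 * (r powr (17 / 4 * card I) * r powr (17 / 4 * card (A - I))) * (jd z' u powr (- 9 / 4) * jd z' u powr (- 9 / 4))"
          by (simp add: power2_eq_square)
        also have "r powr (17 / 4 * card I) * r powr (17 / 4 * card (A - I)) = r powr (17 / 4 * k)"
        proof -
          have "17 / 4 * real (card I) + 17 / 4 * real (card (A - I)) = 17 / 4 * real k"
            using cI cJ by (simp add: of_nat_diff) argo
          then show ?thesis by (simp only: powr_add[symmetric])
        qed
        also have "jd z' u powr (- 9 / 4) * jd z' u powr (- 9 / 4) = jd z' u powr - (9 / 2)"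
          by (simp add: powr_add[symmetric])
        finally have "b * jd z z' powr (2 - d) * ((\<Sum>f\<in>PiE I (\<lambda>_. ?B). Q I z' f) * (\<Sum>f\<in>PiE (A - I) (\<lambda>_. ?B). Q (A - I) z' f))
            \<le> b * jd z z' powr (2 - d) * (M\<^sup>2 * r powr (17 / 4 * k) * jd z' u powr - (9 / 2))"
          using ab by (intro mult_left_mono) auto
        then show "(case zI of (z', I) \<Rightarrow> b * jd z z' powr (2 - d) *
          ((\<Sum>f\<in>PiE I (\<lambda>_. ?B). Q I z' f) * (\<Sum>f\<in>PiE (A - I) (\<lambda>_. ?B). Q (A - I) z' f))) \<le>
          (case zI of (z', I) \<Rightarrow> b * M\<^sup>2 * r powr (17 / 4 * k) * (jd z z' powr (2 - d) * jd z' u powr - (9 / 2)))"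
          by (simp add: eq(1) mult_ac)
      qed
      also have "\<dots> = real (card II) * (b * M\<^sup>2 * r powr (17 / 4 * k) * (\<Sum>z'\<in>W. jd z z' powr (2 - d) * jd z' u powr - (9 / 2)))"
        by (simp add: sum.cartesian_product[symmetric] sum_distrib_left[symmetric])
      also have "\<dots> \<le> 2 ^ k * (b * M\<^sup>2 * r powr (17 / 4 * k) * (C * jd z u powr (2 - 9 / 2)))"
      proof (rule mult_mono)
        have "real (card II) \<le> real (2 ^ k)" using II_card by (rule of_nat_mono)
        then show "real (card II) \<le> 2 ^ k" by simp
        show "b * M\<^sup>2 * r powr (17 / 4 * k) * (\<Sum>z'\<in>W. jd z z' powr (2 - d) * jd z' u powr - (9 / 2))
            \<le> b * M\<^sup>2 * r powr (17 / 4 * k) * (C * jd z u powr (2 - 9 / 2))"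
          using ab by (intro mult_left_mono C(2) h(1)) simp
        show "0 \<le> b * M\<^sup>2 * r powr (17 / 4 * k) * (\<Sum>z'\<in>W. jd z z' powr (2 - d) * jd z' u powr - (9 / 2))"
          using ab by (intro mult_nonneg_nonneg sum_nonneg) auto
      qed simp
      also have "\<dots> = 2 ^ k * (b * C * M\<^sup>2) * r powr (17 / 4 * k) * jd z u powr (2 - 9 / 2)"
        by (simp add: mult_ac)
      \<comment> \<open>The exponent 2 - 9/2 = -5/2 is stronger than the required -9/4.\<close>
      also have "\<dots> \<le> Ck * r powr (17 / 4 * k) * jd z u powr (- 9 / 4)"
        using ab C M0 unfolding Ck_def by (intro mult_mono powr_jd_le) auto
      finally show ?thesis unfolding Q_def .
    qed
    moreover have "Ck > 0" unfolding Ck_def using ab C M0 by (intro add_nonneg_pos) auto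
    ultimately show ?thesis by blast
  qed
qed


section \<open>Reaching the boundary from inside \<open>S\<close>\<close>

lemma Pr_disjointly_le:
  assumes "finite W" "x \<in> W" "y \<in> W"
  shows "Pr W (disjointly (\<lambda>K. conn K x y) (\<lambda>K. conn K y z)) \<le>
    b * jd x y powr (2 - d) * (b * jd y z powr (2 - d))"
proof -
  have "Pr W (disjointly (\<lambda>K. conn K x y) (\<lambda>K. conn K y z)) \<le> Pr W (\<lambda>K. conn K x y) * Pr W (\<lambda>K. conn K y z)"
    by (intro bk finite_edges_in assms p_le increasing_conn)
  also have "\<dots> \<le> b * jd x y powr (2 - d) * (b * jd y z powr (2 - d))"
    using ab by (intro mult_mono Pr_conn_le assms bpr_nonneg p_le) auto
  finally show ?thesis .
qed

lemma tau_harris: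
  assumes "finite S" "x \<in> S" "z \<in> S"
  shows "t S x z * t S z u \<le> t S x u"
proof -
  have "t S x z * t S z u = Pr S (\<lambda>K. conn K x z) * Pr S (\<lambda>K. conn K z u)"
    using assms by (simp add: bpr_conn)
  also have "\<dots> \<le> Pr S (\<lambda>K. conn K x z \<and> conn K z u)"
    by (intro bpr_harris finite_edges_in assms p_le increasing_conn)
  also have "\<dots> \<le> Pr S (\<lambda>K. conn K x u)"
    by (intro bpr_mono p_le) (auto intro: conn_trans)
  finally show ?thesis using assms by (simp add: bpr_conn)
qed

text \<open>A connection from \<open>z\<close> to \<open>v\<close> that stays in the ball leaves
  \<open>S\<close> through a boundary point in the ball. Going out to distance r and back costs
  order r^(4-d); for r of the order of the squared distance D^2 this is below the order D^(2-d) of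
  the connection itself, as 2(4 - d) <= 2 - d.\<close>

lemma reach:
  obtains k where "1 \<le> k" "\<And>S z v. finite S \<Longrightarrow> z \<in> S \<Longrightarrow> v \<notin> S \<Longrightarrow>
    a / 2 * jd z v powr (2 - d) \<le> (\<Sum>u \<in> bd S \<inter> jball z (k * (jd z v)\<^sup>2). t S z u)"
proof -
  obtain C where C: "C > 0" "\<And>(u :: int ^ 'd) r A. finite A \<Longrightarrow> 1 / 2 \<le> r \<Longrightarrow> (\<And>z. z \<in> A \<Longrightarrow> r \<le> jd u z) \<Longrightarrow>
    (\<Sum>z\<in>A. jd u z powr - (2 * d - 4)) \<le> C * r powr (d - (2 * d - 4))"
    by (rule tail_sum[where 'd = 'd, of "2 * d - 4", folded d_eq]) (use d7 in auto)
  define c where "c = b\<^sup>2 * 2 powr (d - 2) * C"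
  have c: "0 < c" using ab C by (simp add: c_def)
  \<comment> \<open>The 2 keeps \<open>v\<close> well inside the ball, and \<open>2 * c / a\<close>
    makes the excursions cost at most half of the lower bound.\<close>
  define k where "k = max 2 (2 * c / a)"
  have k: "2 \<le> k" "c / k \<le> a / 2"
    using ab c by (auto simp: k_def max_def field_simps)
  have main: "a / 2 * jd z v powr (2 - d) \<le> (\<Sum>u \<in> bd S \<inter> jball z (k * (jd z v)\<^sup>2). t S z u)"
    if h: "finite S" "z \<in> S" "v \<notin> S" for S and z v :: "int ^ 'd"
  proof -
    define D where "D = jd z v"
    define r where "r = k * D\<^sup>2"
    have D1: "1 \<le> D" by (simp add: D_def jd_ge_1)
    have "D * 1 \<le> D * D" using D1 by (intro mult_left_mono) auto
    then have D2: "D \<le> D\<^sup>2" by (simp add: power2_eq_square)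
    have "2 * D\<^sup>2 \<le> r" unfolding r_def using k by (intro mult_right_mono) auto
    then have rD: "2 * D \<le> r" "1 \<le> r" using D2 D1 by linarith+
    obtain W0 where W0: "finite W0"
      "\<And>W. finite W \<Longrightarrow> W0 \<subseteq> W \<Longrightarrow> a * jd z v powr (2 - d) \<le> t W z v"
      using lower[of z v] by blast
    define W where "W = W0 \<union> S"
    have W: "finite W" "z \<in> W" "S \<subseteq> W" using W0 h by (auto simp: W_def)
    define U V where "U = bd S \<inter> jball z r" and "V = W - jball z r"
    have fin: "finite U" "finite V" using finite_bd[OF h(1)] W by (auto simp: U_def V_def)
    have "a * D powr (2 - d) \<le> Pr W (\<lambda>K. conn K z v)"
      unfolding D_def bpr_conn[OF W(2)] using W by (intro W0(2)) (auto simp: W_def)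
    also have "\<dots> \<le> Pr W (\<lambda>K. \<exists>u\<in>U. conn (K \<inter> Pow S) z u) +
        Pr W (\<lambda>K. \<exists>w\<in>V. disjointly (\<lambda>K. conn K z w) (\<lambda>K. conn K w v) K)"
    proof (rule bpr_disj_le[OF p_le])
      fix K assume K: "K \<subseteq> F W" "conn K z v"
      have finK: "finite K" using K(1) finite_edges_in[OF W(1)] finite_subset by metis
      show "(\<exists>u\<in>U. conn (K \<inter> Pow S) z u) \<or> (\<exists>w\<in>V. disjointly (\<lambda>K. conn K z w) (\<lambda>K. conn K w v) K)"
      proof (cases "conn {e \<in> K. e \<inter> - jball z r = {}} z v")
        case True
        let ?K = "{e \<in> K. e \<inter> - jball z r = {}}"
        have "finite ?K" using finK by simp
        from conn_exit[OF this True h(2,3)] obtain u w K1 where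
          u: "u \<in> S" "w \<notin> S" "{u, w} \<in> ?K" "K1 \<subseteq> ?K \<inter> Pow S" "conn K1 z u" by (elim exE conjE)
        have "{u, w} \<in> E" using u(3) K(1) by (auto simp: edges_in_def)
        moreover have "u \<in> jball z r" using u(3) by auto
        ultimately have "u \<in> U" using u(1,2) by (auto simp: U_def inner_boundary_def)
        moreover have "conn (K \<inter> Pow S) z u" by (rule conn_mono[OF _ u(5)]) (use u(4) in auto)
        ultimately show ?thesis by blast
      next
        case False
        then have "\<exists>w\<in>- jball z r. disjointly (\<lambda>K. conn K z w) (\<lambda>K. conn K w v) K"
          by (intro conn_through finK K(2)) simp
        then obtain w where w: "w \<notin> jball z r" "disjointly (\<lambda>K. conn K z w) (\<lambda>K. conn K w v) K" by blast
        from w(2) obtain K1 where "K1 \<subseteq> K" "conn K1 z w" by (rule disjointlyE)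
        then have "w \<in> W" using edges_in_conn[OF K(1) conn_mono] W(2) by metis
        then show ?thesis using w unfolding V_def by blast
      qed
    qed
    also have "Pr W (\<lambda>K. \<exists>u\<in>U. conn (K \<inter> Pow S) z u) \<le> (\<Sum>u\<in>U. t S z u)"
      unfolding bpr_conn_subset[OF W(1,3) h(2), symmetric]
      by (intro bpr_Un_le p_le fin)
    also have "Pr W (\<lambda>K. \<exists>w\<in>V. disjointly (\<lambda>K. conn K z w) (\<lambda>K. conn K w v) K) \<le>
        (\<Sum>w\<in>V. Pr W (disjointly (\<lambda>K. conn K z w) (\<lambda>K. conn K w v)))"
      by (intro bpr_Un_le p_le fin)
    also have "\<dots> \<le> (\<Sum>w\<in>V. b\<^sup>2 * 2 powr (d - 2) * jd z w powr - (2 * d - 4))"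
    proof (rule sum_mono)
      fix w assume w: "w \<in> V"
      then have "r < jd z w" "w \<in> W" by (auto simp: V_def mem_jball)
      then have "jd z w / 2 \<le> jd w v"
        using jd_triangle[of z w v] rD(1) by (simp add: D_def jd_sym[of v w])
      then have "jd w v powr (2 - d) \<le> (jd z w / 2) powr (2 - d)" using d7 by (intro powr_mono2') auto
      also have "\<dots> = 2 powr (d - 2) * jd z w powr (2 - d)"
        by (simp add: powr_divide powr_diff field_simps)
      finally have g: "jd w v powr (2 - d) \<le> 2 powr (d - 2) * jd z w powr (2 - d)" .
      have "Pr W (disjointly (\<lambda>K. conn K z w) (\<lambda>K. conn K w v)) \<le> b * jd z w powr (2 - d) * (b * jd w v powr (2 - d))"
        using W \<open>w \<in> W\<close> by (intro Pr_disjointly_le)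
      also have "\<dots> \<le> b * jd z w powr (2 - d) * (b * (2 powr (d - 2) * jd z w powr (2 - d)))"
        using g ab by (intro mult_left_mono) auto
      also have "\<dots> = b\<^sup>2 * 2 powr (d - 2) * (jd z w powr (2 - d) * jd z w powr (2 - d))"
        by (simp add: power2_eq_square)
      also have "jd z w powr (2 - d) * jd z w powr (2 - d) = jd z w powr - (2 * d - 4)"
        by (simp add: powr_add[symmetric])
      finally show "Pr W (disjointly (\<lambda>K. conn K z w) (\<lambda>K. conn K w v)) \<le> b\<^sup>2 * 2 powr (d - 2) * jd z w powr - (2 * d - 4)" .
    qed
    also have "\<dots> \<le> b\<^sup>2 * 2 powr (d - 2) * (C * r powr (d - (2 * d - 4)))"
      unfolding sum_distrib_left[symmetric] using rD fin
      by (intro mult_left_mono C(2)) (auto simp: V_def mem_jball)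
    also have "\<dots> = c * r powr (4 - d)" by (simp add: c_def)
    also have "c * r powr (4 - d) \<le> a / 2 * D powr (2 - d)"
    proof -
      have "r powr (4 - d) = k powr (4 - d) * (D\<^sup>2) powr (4 - d)"
        unfolding r_def using k D1 by (simp add: powr_mult)
      also have "(D\<^sup>2) powr (4 - d) = D powr (8 - 2 * d)"
      proof -
        have "D\<^sup>2 = D powr 2" using D1 by simp
        then have "(D\<^sup>2) powr (4 - d) = D powr (2 * (4 - d))" by (simp only: powr_powr)
        also have "2 * (4 - d) = 8 - 2 * d" by simp
        finally show ?thesis .
      qed
      also have "k powr (4 - d) * D powr (8 - 2 * d) \<le> k powr (-1) * D powr (2 - d)"
        using k D1 d7 by (intro mult_mono powr_mono) auto
      also have "k powr (-1) = 1 / k" using k by (simp add: powr_minus_divide)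
      finally have "c * r powr (4 - d) \<le> c * (1 / k * D powr (2 - d))" using c by (intro mult_left_mono) auto
      also have "\<dots> = c / k * D powr (2 - d)" by simp
      also have "\<dots> \<le> a / 2 * D powr (2 - d)" using k by (intro mult_right_mono) auto
      finally show ?thesis .
    qed
    finally show ?thesis unfolding D_def r_def U_def by simp
  qed
  show ?thesis
    by (rule that[of k]) (use k main in auto)
qed

lemma sum_Int_jball:
  fixes f :: "int ^ 'd \<Rightarrow> real"
  assumes "finite A"
  shows "sum f (A \<inter> jball z r) = (\<Sum>x\<in>A. f x * of_bool (jd z x \<le> r))"
  using assms by (simp add: sum.inter_restrict mem_jball of_bool_def if_distrib cong: if_cong)

text \<open>A point \<open>z\<close> within \<open>D\<close> of the boundary reaches it inside
  \<open>S\<close> at polynomial cost by \<open>reach\<close>, and Harris glues this to the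
  connection from \<open>x\<close>. The power is crude: D^(d-2) is the cost, D^(2d) and D^d count
  the choices of \<open>z\<close> and \<open>u\<close>, and the total is rounded up to
  D^(4d).\<close>

lemma phi_shell:
  obtains C where "0 < C" "\<And>S x D. finite S \<Longrightarrow> x \<in> S \<Longrightarrow> 1 \<le> D \<Longrightarrow>
    (\<Sum>u\<in>bd S. \<Sum>z\<in>S \<inter> jball u D. t S x z) \<le> C * D powr (4 * d) * phi_in S x"
proof -
  obtain k where k: "1 \<le> k" "\<And>S z v. finite S \<Longrightarrow> z \<in> S \<Longrightarrow> v \<notin> S \<Longrightarrow>
    a / 2 * jd z v powr (2 - d) \<le> (\<Sum>u \<in> bd S \<inter> jball z (k * (jd z v)\<^sup>2). t S z u)"
    by (rule reach) auto
  define l where "l = 1 + L"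
  have l: "1 \<le> l" using ab by (simp add: l_def)
  define C where "C = 2 / a * l powr (d - 2) * (3 * k * l\<^sup>2) powr d * 3 powr d"
  have "(\<Sum>u\<in>bd S. \<Sum>z\<in>S \<inter> jball u D. t S x z) \<le> C * D powr (4 * d) * phi_in S x"
    if h: "finite S" "x \<in> S" "1 \<le> D" for S and x :: "int ^ 'd" and D
  proof -
    define r where "r = k * (l * D)\<^sup>2"
    have lD: "1 \<le> l * D" using l h mult_mono[of 1 l 1 D] by simp
    then have "1 \<le> (l * D)\<^sup>2" by (simp add: one_le_power)
    then have r1: "1 \<le> r" unfolding r_def using k mult_mono[of 1 k 1 "(l * D)\<^sup>2"] by simp
    have pt: "t S x z \<le> 2 / a * (l * D) powr (d - 2) * (\<Sum>u'\<in>bd S \<inter> jball z r. t S x u')"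
      if u: "u \<in> bd S" "z \<in> S" "jd u z \<le> D" for u z
    proof -
      obtain v where v: "v \<notin> S" "{u, v} \<in> E" using u(1) by (auto simp: inner_boundary_def)
      have "jd z v \<le> jd z u + jd u v" by (rule jd_triangle)
      also have "\<dots> \<le> D + L" using u(3) E_edge[OF v(2)] by (simp add: jd_sym[of z u])
      also have "\<dots> \<le> l * D" using h(3) ab mult_left_mono[of 1 D L] by (simp add: l_def algebra_simps)
      finally have zv: "jd z v \<le> l * D" .
      have "a / 2 * (l * D) powr (2 - d) \<le> a / 2 * jd z v powr (2 - d)"
        using zv ab d7 by (intro mult_left_mono powr_mono2') auto
      also have "\<dots> \<le> (\<Sum>u' \<in> bd S \<inter> jball z (k * (jd z v)\<^sup>2). t S z u')"
        using h u v by (intro k(2))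
      also have "\<dots> \<le> (\<Sum>u' \<in> bd S \<inter> jball z r. t S z u')"
      proof (rule sum_mono2)
        have "k * (jd z v)\<^sup>2 \<le> r"
          unfolding r_def using k zv jd_ge_1[of z v] by (intro mult_left_mono power_mono) auto
        then show "bd S \<inter> jball z (k * (jd z v)\<^sup>2) \<subseteq> bd S \<inter> jball z r"
          using jball_mono by blast
      qed (use finite_bd[OF h(1)] t_nonneg in auto)
      finally have q: "a / 2 * (l * D) powr (2 - d) \<le> (\<Sum>u' \<in> bd S \<inter> jball z r. t S z u')" .
      have "t S x z * (a / 2 * (l * D) powr (2 - d)) \<le> t S x z * (\<Sum>u' \<in> bd S \<inter> jball z r. t S z u')"
        by (intro mult_left_mono q t_nonneg)
      also have "\<dots> \<le> (\<Sum>u' \<in> bd S \<inter> jball z r. t S x u')"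
        unfolding sum_distrib_left using h u by (intro sum_mono tau_harris) auto
      finally have "2 / a * (l * D) powr (d - 2) * (t S x z * (a / 2 * (l * D) powr (2 - d))) \<le>
          2 / a * (l * D) powr (d - 2) * (\<Sum>u' \<in> bd S \<inter> jball z r. t S x u')"
        using ab by (intro mult_left_mono) auto
      moreover have "(l * D) powr (d - 2) * (l * D) powr (2 - d) = 1"
        using lD l h(3) by (subst powr_add[symmetric]) simp
      then have "2 / a * (l * D) powr (d - 2) * (t S x z * (a / 2 * (l * D) powr (2 - d))) = t S x z"
        using ab by (simp add: field_simps)
      ultimately show ?thesis by simp
    qed
    define c where "c = 2 / a * (l * D) powr (d - 2)"
    have c0: "0 \<le> c" using ab by (simp add: c_def)
    have "(\<Sum>u\<in>bd S. \<Sum>z\<in>S \<inter> jball u D. t S x z) \<le>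
        (\<Sum>u\<in>bd S. \<Sum>z\<in>S \<inter> jball u D. c * (\<Sum>u'\<in>bd S \<inter> jball z r. t S x u'))"
      unfolding c_def by (intro sum_mono pt) (auto simp: mem_jball)
    also have "\<dots> \<le> (\<Sum>u\<in>bd S. \<Sum>z\<in>S. \<Sum>u'\<in>bd S. c * (t S x u' * (of_bool (jd u z \<le> D) * of_bool (jd z u' \<le> r))))"
    proof (rule sum_mono)
      fix u assume "u \<in> bd S"
      have "(\<Sum>z\<in>S \<inter> jball u D. c * (\<Sum>u'\<in>bd S \<inter> jball z r. t S x u')) =
          (\<Sum>z\<in>S. \<Sum>u'\<in>bd S. c * (t S x u' * (of_bool (jd u z \<le> D) * of_bool (jd z u' \<le> r))))"
        unfolding sum_Int_jball[OF h(1)] sum_Int_jball[OF finite_bd[OF h(1)]]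
        by (simp only: sum_distrib_left sum_distrib_right mult_ac)
      then show "(\<Sum>z\<in>S \<inter> jball u D. c * (\<Sum>u'\<in>bd S \<inter> jball z r. t S x u')) \<le>
          (\<Sum>z\<in>S. \<Sum>u'\<in>bd S. c * (t S x u' * (of_bool (jd u z \<le> D) * of_bool (jd z u' \<le> r))))" by simp
    qed
    \<comment> \<open>Reordered so that the reached point \<open>u'\<close> comes first; the inner
      sums only count lattice points in balls.\<close>
    also have "\<dots> = (\<Sum>u'\<in>bd S. c * t S x u' * (\<Sum>z\<in>S. of_bool (jd z u' \<le> r) * (\<Sum>u\<in>bd S. of_bool (jd u z \<le> D))))"
      by (subst sum.swap, subst (2) sum.swap, subst sum.swap)
        (simp add: sum_distrib_left mult_ac)
    also have "\<dots> \<le> (\<Sum>u'\<in>bd S. c * t S x u' * ((3 * r) powr d * (3 * D) powr d))"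
    proof (rule sum_mono)
      fix u' assume "u' \<in> bd S"
      have cnt: "(\<Sum>u\<in>A. of_bool (jd u z \<le> R)) \<le> (3 * R) powr d" if "finite A" "1 \<le> R" for A R and z :: "int ^ 'd"
      proof -
        have "(\<Sum>u\<in>A. of_bool (jd u z \<le> R)) = real (card {u \<in> A. jd u z \<le> R})"
          using that by (simp add: of_bool_def sum.If_cases Int_def)
        also have "\<dots> \<le> real (card (jball z R))"
          by (intro of_nat_mono card_mono) (auto simp: mem_jball jd_sym)
        also have "\<dots> \<le> (3 * R) powr d" using card_jball[OF that(2), of z] by (simp add: d_eq)
        finally show ?thesis .
      qed
      have "(\<Sum>z\<in>S. of_bool (jd z u' \<le> r) * (\<Sum>u\<in>bd S. of_bool (jd u z \<le> D))) \<le>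
          (\<Sum>z\<in>S. of_bool (jd z u' \<le> r) * (3 * D) powr d)"
        using h finite_bd by (intro sum_mono mult_left_mono cnt) auto
      also have "\<dots> \<le> (3 * r) powr d * (3 * D) powr d"
        unfolding sum_distrib_right[symmetric] using h r1 by (intro mult_right_mono cnt) auto
      finally show "c * t S x u' * (\<Sum>z\<in>S. of_bool (jd z u' \<le> r) * (\<Sum>u\<in>bd S. of_bool (jd u z \<le> D)))
          \<le> c * t S x u' * ((3 * r) powr d * (3 * D) powr d)"
        using c0 t_nonneg by (intro mult_left_mono) auto
    qed
    also have "\<dots> = c * ((3 * r) powr d * (3 * D) powr d) * phi_in S x"
      by (simp add: phi_in_def sum_distrib_left sum_distrib_right mult_ac)
    also have "\<dots> \<le> C * D powr (4 * d) * phi_in S x"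
    proof (intro mult_right_mono phi_in_nonneg)
      have "D\<^sup>2 = D powr 2" using h(3) by simp
      then have "(D\<^sup>2) powr d = D powr (2 * d)" by (simp only: powr_powr)
      then have "(3 * r) powr d = (3 * k * l\<^sup>2) powr d * D powr (2 * d)"
        unfolding r_def using k l h(3) by (simp add: powr_mult power_mult_distrib mult_ac)
      then have "c * ((3 * r) powr d * (3 * D) powr d) =
          C * (D powr (d - 2) * D powr (2 * d) * D powr d)"
        unfolding c_def C_def using l h(3) by (simp add: powr_mult powr_powr mult_ac)
      also have "D powr (d - 2) * D powr (2 * d) * D powr d = D powr (4 * d - 2)"
        by (simp add: powr_add[symmetric])
      also have "C * D powr (4 * d - 2) \<le> C * D powr (4 * d)"
        using h(3) ab by (intro mult_left_mono powr_mono) (auto simp: C_def)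
      finally show "c * ((3 * r) powr d * (3 * D) powr d) \<le> C * D powr (4 * d)" .
    qed
    finally show ?thesis .
  qed
  moreover have "0 < C" using ab l k unfolding C_def by (intro mult_pos_pos) auto
  ultimately show ?thesis by (intro that)
qed

end

lemma prod_of_bool: "finite A \<Longrightarrow> (\<Prod>i\<in>A. of_bool (P i) :: real) = of_bool (\<forall>i\<in>A. P i)"
  by (induction A rule: finite_induct) auto

lemma power_sum_PiE:
  fixes g :: "'a \<Rightarrow> real"
  assumes "finite B"
  shows "(\<Sum>x\<in>B. g x) ^ k = (\<Sum>f\<in>PiE {..<k} (\<lambda>_. B). \<Prod>i<k. g (f i))"
proof -
  have "(\<Sum>x\<in>B. g x) ^ k = (\<Prod>i<k. \<Sum>x\<in>B. g x)" by simp
  also have "\<dots> = (\<Sum>f\<in>PiE {..<k} (\<lambda>_. B). \<Prod>i<k. g (f i))"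
    using assms by (intro prod_sum_PiE) auto
  finally show ?thesis .
qed

text \<open>Truncation at the threshold \<open>T\<close>: the excess is charged to a high moment,
  weighted by a high negative power of \<open>T\<close>.\<close>

lemma le_add_power:
  fixes x T :: real
  assumes "0 \<le> x" "0 < T"
  shows "x \<le> T + x ^ Suc k / T ^ k"
proof (cases "x \<le> T")
  case True
  have "0 \<le> x ^ Suc k / T ^ k" using assms by simp
  then show ?thesis using True by linarith
next
  case False
  then have "1 \<le> (x / T) ^ k" using assms by (intro one_le_power) simp
  then have "x * 1 \<le> x * (x / T) ^ k" using assms by (intro mult_left_mono) auto
  also have "\<dots> = x ^ Suc k / T ^ k" by (simp add: power_divide)
  finally show ?thesis using assms by simp
qed

context perc
begin

subsection \<open>Volume of the cluster near the boundary\<close>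

definition joint :: "(int ^ 'd) set \<Rightarrow> (int ^ 'd) set \<Rightarrow> int ^ 'd \<Rightarrow> real \<Rightarrow> real"
  where "joint W S x r =
    (\<Sum>u\<in>bd S. \<Sum>y\<in>W \<inter> jball u r. Pr W (\<lambda>K. conn (K \<inter> Pow S) x u \<and> conn K x y))"

lemma card_jball_le: "1 \<le> r \<Longrightarrow> real (card (A \<inter> jball u r)) \<le> (3 * r) powr d" for u :: "int ^ 'd"
proof -
  assume "1 \<le> r"
  have "real (card (A \<inter> jball u r)) \<le> real (card (jball u r))"
    by (intro of_nat_mono card_mono) auto
  also have "\<dots> \<le> (3 * r) powr d" using card_jball[OF \<open>1 \<le> r\<close>, of u] by (simp add: d_eq)
  finally show ?thesis .
qed

lemma half_powr: "x / 2 \<le> y \<Longrightarrow> 0 < x \<Longrightarrow> y powr (2 - d) \<le> 2 powr (d - 2) * x powr (2 - d)"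
proof -
  assume h: "x / 2 \<le> y" "0 < x"
  then have "y powr (2 - d) \<le> (x / 2) powr (2 - d)" using d7 by (intro powr_mono2') auto
  also have "\<dots> = 2 powr (d - 2) * x powr (2 - d)" using h by (simp add: powr_divide powr_diff field_simps)
  finally show ?thesis .
qed

text \<open>If \<open>u\<close> and \<open>y\<close> are not joined in the ball of radius
  \<open>R\<close>, take the tripod of \<open>conn_far\<close>. For a centre \<open>z\<close>
  farther than \<open>r'\<close> from \<open>u\<close>, the points \<open>u\<close> and
  \<open>y\<close> look alike from \<open>z\<close>, which gives the first term. Otherwise a leg
  makes an excursion beyond \<open>R\<close>, costing R^(4-d), and only \<open>t S x z\<close> is
  kept, to be summed by \<open>phi_shell\<close>. The factor r^d counts the points
  \<open>y\<close>.\<close>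

lemma far_bound:
  obtains C1 C2 where "0 < C1" "0 < C2"
    "\<And>W S x r r' R. finite W \<Longrightarrow> S \<subseteq> W \<Longrightarrow> x \<in> S \<Longrightarrow> 1 \<le> r \<Longrightarrow> 2 * r \<le> r' \<Longrightarrow> 2 * r' \<le> R \<Longrightarrow>
      (\<Sum>u\<in>bd S. \<Sum>y\<in>W \<inter> jball u r. Pr W (\<lambda>K. conn (K \<inter> Pow S) x u \<and> conn K x y \<and>
          \<not> conn (K \<inter> Pow (jball u R)) u y))
      \<le> C1 * r powr d * (\<Sum>u\<in>bd S. \<Sum>z\<in>S - jball u r'. t S x z * t S z u * jd z u powr (2 - d)) +
        C2 * r powr d * R powr (4 - d) * r' powr (4 * d) * phi_in S x"
proof -
  obtain C where C: "C > 0" "\<And>(u :: int ^ 'd) r A. finite A \<Longrightarrow> 1 / 2 \<le> r \<Longrightarrow> (\<And>z. z \<in> A \<Longrightarrow> r \<le> jd u z) \<Longrightarrow>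
    (\<Sum>z\<in>A. jd u z powr - (2 * d - 4)) \<le> C * r powr (d - (2 * d - 4))"
    by (rule tail_sum[where 'd = 'd, of "2 * d - 4", folded d_eq]) (use d7 in auto)
  obtain C' where C': "0 < C'" "\<And>S x D. finite S \<Longrightarrow> x \<in> S \<Longrightarrow> 1 \<le> D \<Longrightarrow>
    (\<Sum>u\<in>bd S. \<Sum>z\<in>S \<inter> jball u D. t S x z) \<le> C' * D powr (4 * d) * phi_in S x"
    by (rule phi_shell) auto
  define c1 where "c1 = b * 2 powr (d - 2)"
  define c2 where "c2 = 2 * (b * 2 powr (d - 2))\<^sup>2"
  define C1 C2 where "C1 = c1 * 3 powr d" and "C2 = 3 powr d * c2 * C * C'"
  have pos: "0 < c1" "0 < c2" "0 < C1" "0 < C2" using ab C C' by (auto simp: c1_def c2_def C1_def C2_def)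
  have main: "(\<Sum>u\<in>bd S. \<Sum>y\<in>W \<inter> jball u r. Pr W (\<lambda>K. conn (K \<inter> Pow S) x u \<and> conn K x y \<and>
          \<not> conn (K \<inter> Pow (jball u R)) u y))
      \<le> C1 * r powr d * (\<Sum>u\<in>bd S. \<Sum>z\<in>S - jball u r'. t S x z * t S z u * jd z u powr (2 - d)) +
        C2 * r powr d * R powr (4 - d) * r' powr (4 * d) * phi_in S x"
    if h: "finite W" "S \<subseteq> W" "x \<in> S" "1 \<le> r" "2 * r \<le> r'" "2 * r' \<le> R" for W S r r' R and x :: "int ^ 'd"
  proof -
    have finS: "finite S" using h finite_subset by auto
    define A where "A u = (\<Sum>z\<in>S - jball u r'. t S x z * t S z u * jd z u powr (2 - d))" for u
    define B where "B u = (\<Sum>z\<in>S \<inter> jball u r'. t S x z)" for u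
    have B0: "0 \<le> B u" for u unfolding B_def by (intro sum_nonneg t_nonneg)
    have A0: "0 \<le> A u" for u unfolding A_def by (intro sum_nonneg mult_nonneg_nonneg t_nonneg) auto
    have pt: "Pr W (\<lambda>K. conn (K \<inter> Pow S) x u \<and> conn K x y \<and> \<not> conn (K \<inter> Pow (jball u R)) u y)
        \<le> c1 * A u + c2 * C * R powr (4 - d) * B u"
      if u: "u \<in> bd S" "y \<in> W \<inter> jball u r" for u y
    proof -
      define D1 where "D1 z = disjointly (\<lambda>K. conn (K \<inter> Pow S) x z) (disjointly (\<lambda>K. conn (K \<inter> Pow S) z u) (\<lambda>K. conn K z y))" for z
      \<comment> \<open>The leg that leaves the ball of radius \<open>R\<close> at \<open>v\<close>
        ends at \<open>w\<close>, which is either \<open>u\<close> or \<open>y\<close>.\<close>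
      define D2 where "D2 w = (\<lambda>(z, v). disjointly (\<lambda>K. conn (K \<inter> Pow S) x z) (disjointly (\<lambda>K. conn K z v) (\<lambda>K. conn K v w)))" for w
      define I where "I = (S \<inter> jball u r') \<times> (W - jball u R)"
      have finI: "finite I" using h finS by (simp add: I_def)
      have "Pr W (\<lambda>K. conn (K \<inter> Pow S) x u \<and> conn K x y \<and> \<not> conn (K \<inter> Pow (jball u R)) u y) \<le>
          Pr W (\<lambda>K. \<exists>z\<in>S - jball u r'. D1 z K) + Pr W (\<lambda>K. (\<exists>i\<in>I. D2 u i K) \<or> (\<exists>i\<in>I. D2 y i K))"
      proof (rule bpr_disj_le[OF p_le])
        fix K assume K: "K \<subseteq> F W" and c: "conn (K \<inter> Pow S) x u \<and> conn K x y \<and> \<not> conn (K \<inter> Pow (jball u R)) u y"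
        have finK: "finite K" using K finite_edges_in[OF h(1)] finite_subset by metis
        have neK: "{} \<notin> K" using edges_in_empty[OF K E_ne] .
        obtain z where z: "D1 z K" "z \<in> jball u R \<longrightarrow> (\<exists>v. v \<notin> jball u R \<and> (D2 u (z, v) K \<or> D2 y (z, v) K))"
          using conn_far[OF finK neK conjunct1[OF c] conjunct1[OF conjunct2[OF c]] conjunct2[OF conjunct2[OF c]]]
          unfolding D1_def D2_def prod.case by (elim exE conjE)
        from z(1) obtain K1 where "conn (K1 \<inter> Pow S) x z" unfolding D1_def by (rule disjointlyE)
        then have zS: "z \<in> S" using h(3) by (rule conn_in_Pow)
        show "(\<exists>z\<in>S - jball u r'. D1 z K) \<or> ((\<exists>i\<in>I. D2 u i K) \<or> (\<exists>i\<in>I. D2 y i K))"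
        proof (cases "z \<in> jball u r'")
          case True
          then have "z \<in> jball u R" using h by (auto simp: mem_jball)
          then obtain v where v: "v \<notin> jball u R" "D2 u (z, v) K \<or> D2 y (z, v) K" using z(2) by blast
          obtain w where w: "D2 w (z, v) K" using v(2) by blast
          then obtain K2 where "K2 \<subseteq> K" "disjointly (\<lambda>K. conn K z v) (\<lambda>K. conn K v w) K2"
            unfolding D2_def prod.case by (rule disjointlyE)
          from this(2) obtain K3 where "K3 \<subseteq> K2" "conn K3 z v" by (rule disjointlyE)
          then have "conn K z v" using \<open>K2 \<subseteq> K\<close> by (intro conn_mono[of K3 K]) auto
          then have "v \<in> W" using edges_in_conn[OF K] zS h(2) by blast
          then have "(z, v) \<in> I" using zS True v(1) by (simp add: I_def)
          then show ?thesis using v(2) by blast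
        next
          case False
          then show ?thesis using z(1) zS by blast
        qed
      qed
      also have "Pr W (\<lambda>K. \<exists>z\<in>S - jball u r'. D1 z K) \<le> (\<Sum>z\<in>S - jball u r'. Pr W (D1 z))"
        using finS by (intro bpr_Un_le p_le) auto
      also have "\<dots> \<le> (\<Sum>z\<in>S - jball u r'. c1 * (t S x z * t S z u * jd z u powr (2 - d)))"
      proof (rule sum_mono)
        fix z assume z: "z \<in> S - jball u r'"
        then have zW: "z \<in> W" using h by auto
        have "r' < jd u z" using z by (simp add: mem_jball)
        then have "jd z u / 2 \<le> jd z y"
          using jd_triangle[of z u y] u(2) h(5) by (simp add: mem_jball jd_sym[of y u] jd_sym[of u z])
        then have g: "jd z y powr (2 - d) \<le> 2 powr (d - 2) * jd z u powr (2 - d)"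
          by (rule half_powr) simp
        have "Pr W (D1 z) \<le> Pr W (\<lambda>K. conn (K \<inter> Pow S) x z) * Pr W (\<lambda>K. conn (K \<inter> Pow S) z u) * Pr W (\<lambda>K. conn K z y)"
          unfolding D1_def by (intro bk3 finite_edges_in h p_le increasing_conn increasing_conn_Int)
        also have "\<dots> \<le> t S x z * t S z u * (b * jd z y powr (2 - d))"
        proof -
          have "Pr W (\<lambda>K. conn (K \<inter> Pow S) x z) = t S x z" by (rule bpr_conn_subset[OF h(1,2,3)])
          moreover have "Pr W (\<lambda>K. conn (K \<inter> Pow S) z u) = t S z u" using z by (intro bpr_conn_subset[OF h(1,2)]) simp
          ultimately show ?thesis using Pr_conn_le[OF h(1) zW, of y] t_nonneg by (simp add: mult_left_mono)
        qed
        also have "\<dots> \<le> t S x z * t S z u * (b * (2 powr (d - 2) * jd z u powr (2 - d)))"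
          using g ab t_nonneg by (intro mult_left_mono) auto
        finally show "Pr W (D1 z) \<le> c1 * (t S x z * t S z u * jd z u powr (2 - d))"
          by (simp add: c1_def mult_ac)
      qed
      also have "\<dots> = c1 * A u" by (simp add: A_def sum_distrib_left)
      also have "Pr W (\<lambda>K. (\<exists>i\<in>I. D2 u i K) \<or> (\<exists>i\<in>I. D2 y i K)) \<le>
          Pr W (\<lambda>K. \<exists>i\<in>I. D2 u i K) + Pr W (\<lambda>K. \<exists>i\<in>I. D2 y i K)"
        by (rule bpr_disj_le[OF p_le])
      also have "\<dots> \<le> c2 / 2 * C * R powr (4 - d) * B u + c2 / 2 * C * R powr (4 - d) * B u"
      proof -
        have "Pr W (\<lambda>K. \<exists>i\<in>I. D2 w i K) \<le> c2 / 2 * C * R powr (4 - d) * B u" if w: "jd u w \<le> r" for w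
        proof -
          have "Pr W (\<lambda>K. \<exists>i\<in>I. D2 w i K) \<le> (\<Sum>i\<in>I. Pr W (D2 w i))"
            by (intro bpr_Un_le p_le finI)
          also have "\<dots> \<le> (\<Sum>(z, v)\<in>I. t S x z * (c2 / 2 * jd u v powr - (2 * d - 4)))"
          proof (rule sum_mono)
            fix i assume i: "i \<in> I"
            obtain z v where zv: "i = (z, v)" by (cases i)
            with i have m: "z \<in> S" "z \<in> W" "v \<in> W" "jd u z \<le> r'" "R < jd u v"
              using h by (auto simp: I_def mem_jball)
            have "jd u v / 2 \<le> jd z v" using jd_triangle[of u v z] m h by linarith
            then have g1: "jd z v powr (2 - d) \<le> 2 powr (d - 2) * jd u v powr (2 - d)"
              by (rule half_powr) simp
            have "jd u v / 2 \<le> jd v w" using jd_triangle[of u v w] m h w by (simp add: jd_sym[of w v])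
            then have g2: "jd v w powr (2 - d) \<le> 2 powr (d - 2) * jd u v powr (2 - d)"
              by (rule half_powr) simp
            have "Pr W (D2 w i) \<le> Pr W (\<lambda>K. conn (K \<inter> Pow S) x z) * Pr W (\<lambda>K. conn K z v) * Pr W (\<lambda>K. conn K v w)"
              unfolding D2_def zv prod.case by (intro bk3 finite_edges_in h p_le increasing_conn increasing_conn_Int)
            also have "\<dots> = t S x z * (Pr W (\<lambda>K. conn K z v) * Pr W (\<lambda>K. conn K v w))"
              by (simp add: bpr_conn_subset[OF h(1,2,3)])
            also have "\<dots> \<le> t S x z * ((b * jd z v powr (2 - d)) * (b * jd v w powr (2 - d)))"
              using m h ab by (intro mult_left_mono mult_mono Pr_conn_le t_nonneg bpr_nonneg p_le) auto
            also have "\<dots> \<le> t S x z * ((b * (2 powr (d - 2) * jd u v powr (2 - d))) * (b * (2 powr (d - 2) * jd u v powr (2 - d))))"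
              using g1 g2 ab by (intro mult_left_mono mult_mono t_nonneg) auto
            also have "\<dots> = t S x z * (c2 / 2 * (jd u v powr (2 - d) * jd u v powr (2 - d)))"
              by (simp add: c2_def power2_eq_square)
            also have "jd u v powr (2 - d) * jd u v powr (2 - d) = jd u v powr - (2 * d - 4)"
              by (simp add: powr_add[symmetric])
            finally show "Pr W (D2 w i) \<le> (case i of (z, v) \<Rightarrow> t S x z * (c2 / 2 * jd u v powr - (2 * d - 4)))"
              by (simp add: zv)
          qed
          also have "\<dots> = B u * (c2 / 2 * (\<Sum>v\<in>W - jball u R. jd u v powr - (2 * d - 4)))"
            by (simp only: I_def B_def sum_product sum.cartesian_product sum_distrib_left[of "c2 / 2"])
          also have "\<dots> \<le> B u * (c2 / 2 * (C * R powr (d - (2 * d - 4))))"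
            using h pos by (intro mult_left_mono C(2) B0) (auto simp: mem_jball)
          finally show ?thesis by (simp add: mult_ac)
        qed
        from this[of u] this[of y] show ?thesis using u(2) h(4) by (intro add_mono) (auto simp: mem_jball)
      qed
      finally show ?thesis by (simp add: mult_ac)
    qed
    have "(\<Sum>u\<in>bd S. \<Sum>y\<in>W \<inter> jball u r. Pr W (\<lambda>K. conn (K \<inter> Pow S) x u \<and> conn K x y \<and>
          \<not> conn (K \<inter> Pow (jball u R)) u y)) \<le>
        (\<Sum>u\<in>bd S. \<Sum>y\<in>W \<inter> jball u r. c1 * A u + c2 * C * R powr (4 - d) * B u)"
      by (intro sum_mono pt)
    also have "\<dots> = (\<Sum>u\<in>bd S. real (card (W \<inter> jball u r)) * (c1 * A u + c2 * C * R powr (4 - d) * B u))"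
      by simp
    also have "\<dots> \<le> (\<Sum>u\<in>bd S. (3 * r) powr d * (c1 * A u + c2 * C * R powr (4 - d) * B u))"
    proof (intro sum_mono mult_right_mono card_jball_le h(4))
      fix u
      show "0 \<le> c1 * A u + c2 * C * R powr (4 - d) * B u"
        using pos C A0[of u] B0[of u] by simp
    qed
    also have "\<dots> = C1 * r powr d * (\<Sum>u\<in>bd S. A u) + 3 powr d * c2 * C * r powr d * R powr (4 - d) * (\<Sum>u\<in>bd S. B u)"
    proof -
      have "(3 * r) powr d = 3 powr d * r powr d" using h(4) by (simp add: powr_mult)
      then show ?thesis
        by (simp add: C1_def sum.distrib distrib_left sum_distrib_left sum_distrib_right mult_ac)
    qed
    also have "\<dots> \<le> C1 * r powr d * (\<Sum>u\<in>bd S. A u) + 3 powr d * c2 * C * r powr d * R powr (4 - d) * (C' * r' powr (4 * d) * phi_in S x)"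
      unfolding B_def using C pos h by (intro add_left_mono mult_left_mono C'(2) finS) auto
    finally show ?thesis unfolding A_def C2_def by (simp add: mult_ac)
  qed
  show ?thesis by (rule that[of C1 C2]) (use pos main in auto)
qed

text \<open>Shells of ratio 4, so that the growth r^(9/2) becomes the integral power 2^(9n). Weight
  against mass leaves 2^(n(13-2d)), at most 2^(-n) in dimension at least 7. The constant 2^10 is 2^9
  from the shift by one shell and 2 from the geometric series.\<close>

lemma tail_iterate:
  fixes q :: "int ^ 'd \<Rightarrow> int ^ 'd \<Rightarrow> real"
  assumes fin: "finite U" "finite X" and q: "\<And>u z. 0 \<le> q u z"
    and B: "0 \<le> B" "\<And>n. (\<Sum>u\<in>U. \<Sum>z\<in>X \<inter> jball u (4 ^ n). q u z) \<le> B * 2 ^ (9 * n)"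
  shows "(\<Sum>u\<in>U. \<Sum>z\<in>X - jball u (4 ^ m). q u z * jd z u powr (2 - d)) \<le> 2 ^ 10 * B / 2 ^ m"
proof -
  have "finite (\<Union>u\<in>U. jd u ` X)" using fin by auto
  then obtain Y where Y: "\<And>u z. u \<in> U \<Longrightarrow> z \<in> X \<Longrightarrow> jd u z \<le> Y"
    using bdd_above_finite[of "\<Union>u\<in>U. jd u ` X"] by (fastforce simp: bdd_above_def)
  obtain N where N: "Y < 4 ^ N" using real_arch_pow[of 4 Y] by auto
  have fz: "q u z * jd z u powr (2 - d) \<le>
      (\<Sum>n\<in>{m..<N}. (4 ^ n) powr (2 - d) * (q u z * of_bool (jd u z \<le> 4 ^ Suc n)))"
    if uz: "u \<in> U" "z \<in> X - jball u (4 ^ m)" for u z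
  proof -
    have ex: "jd u z \<le> 4 ^ N" using Y[of u z] uz N by auto
    define k where "k = (LEAST n. jd u z \<le> 4 ^ n)"
    have k: "jd u z \<le> 4 ^ k" "k \<le> N" unfolding k_def using ex by (auto intro: LeastI Least_le)
    have "m < k"
    proof (rule ccontr)
      assume "\<not> m < k"
      then have "(4::real) ^ k \<le> 4 ^ m" by (intro power_increasing) auto
      then have "jd u z \<le> 4 ^ m" using k(1) by (rule order_trans[rotated])
      then show False using uz by (simp add: mem_jball)
    qed
    then obtain n where n: "k = Suc n" "m \<le> n" by (cases k) auto
    have "\<not> jd u z \<le> 4 ^ n" using not_less_Least[of n "\<lambda>n. jd u z \<le> 4 ^ n"] n unfolding k_def by simp
    then have "jd z u powr (2 - d) \<le> (4 ^ n) powr (2 - d)"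
      using d7 by (intro powr_mono2') (auto simp: jd_sym[of z u])
    then have "q u z * jd z u powr (2 - d) \<le> q u z * (4 ^ n) powr (2 - d)"
      by (intro mult_left_mono q)
    also have "\<dots> = (4 ^ n) powr (2 - d) * (q u z * of_bool (jd u z \<le> 4 ^ Suc n))"
      using k n by simp
    also have "\<dots> \<le> (\<Sum>n\<in>{m..<N}. (4 ^ n) powr (2 - d) * (q u z * of_bool (jd u z \<le> 4 ^ Suc n)))"
      using n k by (intro member_le_sum[of n "{m..<N}" "\<lambda>n. (4 ^ n) powr (2 - d) * (q u z * of_bool (jd u z \<le> 4 ^ Suc n))"])
        (auto intro!: mult_nonneg_nonneg q)
    finally show ?thesis .
  qed
  have "(\<Sum>u\<in>U. \<Sum>z\<in>X - jball u (4 ^ m). q u z * jd z u powr (2 - d)) \<le>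
      (\<Sum>u\<in>U. \<Sum>z\<in>X - jball u (4 ^ m). \<Sum>n\<in>{m..<N}. (4 ^ n) powr (2 - d) * (q u z * of_bool (jd u z \<le> 4 ^ Suc n)))"
    by (intro sum_mono fz)
  also have "\<dots> \<le> (\<Sum>u\<in>U. \<Sum>z\<in>X. \<Sum>n\<in>{m..<N}. (4 ^ n) powr (2 - d) * (q u z * of_bool (jd u z \<le> 4 ^ Suc n)))"
    using fin by (intro sum_mono sum_mono2) (auto intro!: sum_nonneg mult_nonneg_nonneg q)
  also have "\<dots> = (\<Sum>n\<in>{m..<N}. (4 ^ n) powr (2 - d) * (\<Sum>u\<in>U. \<Sum>z\<in>X \<inter> jball u (4 ^ Suc n). q u z))"
  proof -
    have "(\<Sum>z\<in>X. \<Sum>n\<in>{m..<N}. (4 ^ n) powr (2 - d) * (q u z * of_bool (jd u z \<le> 4 ^ Suc n))) =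
       (\<Sum>n\<in>{m..<N}. (4 ^ n) powr (2 - d) * (\<Sum>z\<in>X \<inter> jball u (4 ^ Suc n). q u z))" for u
      unfolding sum_Int_jball[OF fin(2)] sum_distrib_left by (rule sum.swap)
    then show ?thesis unfolding sum_distrib_left by (simp only: sum_distrib_left) (rule sum.swap)
  qed
  also have "\<dots> \<le> (\<Sum>n\<in>{m..<N}. (4 ^ n) powr (2 - d) * (B * 2 ^ (9 * Suc n)))"
    by (intro sum_mono mult_left_mono B) simp
  also have "\<dots> \<le> (\<Sum>n\<in>{m..<N}. 2 ^ 9 * B * (1 / 2) ^ n)"
  proof (rule sum_mono)
    fix n :: nat
    have "(4 ^ n) powr (2 - d) * 2 ^ (9 * n) = 2 powr (real n * (13 - 2 * d))"
    proof -
      have "(4::real) ^ n = 2 powr (2 * real n)" by (simp add: powr_realpow[symmetric] powr_powr[symmetric])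
      moreover have "(2::real) ^ (9 * n) = 2 powr (9 * real n)" by (simp add: powr_realpow[symmetric])
      ultimately show ?thesis by (simp add: powr_powr powr_add[symmetric] algebra_simps)
    qed
    also have "\<dots> \<le> 2 powr (- real n)"
    proof (rule powr_mono)
      have "real n * (13 - 2 * d) \<le> real n * (- 1)" using d7 by (intro mult_left_mono) auto
      then show "real n * (13 - 2 * d) \<le> - real n" by simp
    qed simp
    also have "\<dots> = (1 / 2) ^ n" by (simp add: powr_minus_divide powr_realpow power_one_over)
    finally have e: "(4 ^ n) powr (2 - d) * 2 ^ (9 * n) \<le> (1 / 2) ^ n" .
    have "(4 ^ n) powr (2 - d) * (B * 2 ^ (9 * Suc n)) =
        2 ^ 9 * B * ((4 ^ n) powr (2 - d) * 2 ^ (9 * n))"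
      by (simp add: power_add)
    also have "\<dots> \<le> 2 ^ 9 * B * (1 / 2) ^ n"
      using e B by (intro mult_left_mono) auto
    finally show "(4 ^ n) powr (2 - d) * (B * 2 ^ (9 * Suc n)) \<le> 2 ^ 9 * B * (1 / 2) ^ n" .
  qed
  also have "\<dots> = 2 ^ 9 * B * (\<Sum>n\<in>{m..<N}. (1 / 2) ^ n)" by (simp add: sum_distrib_left)
  also have "\<dots> \<le> 2 ^ 9 * B * (2 / 2 ^ m)"
  proof (intro mult_left_mono)
    show "(\<Sum>n\<in>{m..<N}. (1 / 2) ^ n) \<le> (2 / 2 ^ m :: real)"
    proof (cases "m \<le> N")
      case True
      then have "(\<Sum>n\<in>{m..<N}. (1 / 2) ^ n) = (2 / 2 ^ m - 2 / 2 ^ N :: real)"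
        by (induction N rule: dec_induct) (simp_all add: power_one_over)
      then show ?thesis by simp
    qed simp
  qed (use B in auto)
  finally show ?thesis by simp
qed

text \<open>By Harris, \<open>t S x z * t S z u\<close> is at most the probability that
  \<open>u\<close> is reached in \<open>S\<close> while \<open>z\<close> belongs to the cluster. So
  the far branch points are again controlled by \<open>joint\<close>, with a gain of 2^(-m): the
  bound improves itself.\<close>

lemma far_iterate:
  assumes h: "finite W" "S \<subseteq> W" "x \<in> S" and A: "0 \<le> A" "\<And>n. joint W S x (4 ^ n) \<le> A * 2 ^ (9 * n) * phi_in S x"
  shows "(\<Sum>u\<in>bd S. \<Sum>z\<in>S - jball u (4 ^ m). t S x z * t S z u * jd z u powr (2 - d))
    \<le> 2 ^ 10 * A * phi_in S x / 2 ^ m"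
proof -
  have finS: "finite S" using h finite_subset by auto
  have "(\<Sum>u\<in>bd S. \<Sum>z\<in>S - jball u (4 ^ m). t S x z * t S z u * jd z u powr (2 - d))
      \<le> 2 ^ 10 * (A * phi_in S x) / 2 ^ m"
  proof (rule tail_iterate)
    fix n
    have "(\<Sum>u\<in>bd S. \<Sum>z\<in>S \<inter> jball u (4 ^ n). t S x z * t S z u) \<le> joint W S x (4 ^ n)"
      unfolding joint_def
    proof (rule sum_mono)
      fix u
      have "(\<Sum>z\<in>S \<inter> jball u (4 ^ n). t S x z * t S z u) \<le>
         (\<Sum>z\<in>S \<inter> jball u (4 ^ n). Pr W (\<lambda>K. conn (K \<inter> Pow S) x u \<and> conn K x z))"
      proof (rule sum_mono)
        fix z assume "z \<in> S \<inter> jball u (4 ^ n)"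
        then have "t S x z * t S z u = Pr W (\<lambda>K. conn (K \<inter> Pow S) x z) * Pr W (\<lambda>K. conn (K \<inter> Pow S) z u)"
          using h by (simp add: bpr_conn_subset)
        also have "\<dots> \<le> Pr W (\<lambda>K. conn (K \<inter> Pow S) x z \<and> conn (K \<inter> Pow S) z u)"
          by (intro bpr_harris finite_edges_in h p_le increasing_conn_Int)
        also have "\<dots> \<le> Pr W (\<lambda>K. conn (K \<inter> Pow S) x u \<and> conn K x z)"
        proof (intro bpr_mono p_le)
          fix K assume c: "conn (K \<inter> Pow S) x z \<and> conn (K \<inter> Pow S) z u"
          have "conn K x z" by (rule conn_mono[OF _ conjunct1[OF c]]) simp
          then show "conn (K \<inter> Pow S) x u \<and> conn K x z" using c conn_trans[of _ x z u] by blast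
        qed
        finally show "t S x z * t S z u \<le> Pr W (\<lambda>K. conn (K \<inter> Pow S) x u \<and> conn K x z)" .
      qed
      also have "\<dots> \<le> (\<Sum>z\<in>W \<inter> jball u (4 ^ n). Pr W (\<lambda>K. conn (K \<inter> Pow S) x u \<and> conn K x z))"
        using h by (intro sum_mono2 bpr_nonneg p_le) auto
      finally show "(\<Sum>z\<in>S \<inter> jball u (4 ^ n). t S x z * t S z u) \<le>
         (\<Sum>z\<in>W \<inter> jball u (4 ^ n). Pr W (\<lambda>K. conn (K \<inter> Pow S) x u \<and> conn K x z))" .
    qed
    also have "\<dots> \<le> A * 2 ^ (9 * n) * phi_in S x" by (rule A)
    finally show "(\<Sum>u\<in>bd S. \<Sum>z\<in>S \<inter> jball u (4 ^ n). t S x z * t S z u) \<le> A * phi_in S x * 2 ^ (9 * n)"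
      by (simp add: mult_ac)
  qed (use finS finite_bd A phi_in_nonneg t_nonneg in auto)
  then show ?thesis by simp
qed

text \<open>The number of points joined to \<open>u\<close> locally is truncated at \<open>T\<close>
  and the excess charged to its \<open>k\<close>-th moment. \<open>conn_local_hit\<close> decouples
  the local cluster of \<open>u\<close> from the path out of \<open>x\<close>, at the price of one
  sum over \<open>z\<close> in the ball of radius \<open>R\<close>, the same for every
  \<open>k\<close>.\<close>

lemma local_bound:
  assumes "1 \<le> k"
  obtains C where "0 < C" "\<And>W S x u r R T. finite W \<Longrightarrow> S \<subseteq> W \<Longrightarrow> x \<in> S \<Longrightarrow> u \<in> S \<Longrightarrow> 1 \<le> r \<Longrightarrow> 1 \<le> R \<Longrightarrow> 0 < T \<Longrightarrow>
      (\<Sum>y\<in>W \<inter> jball u r. Pr W (\<lambda>K. conn (K \<inter> Pow S) x u \<and> conn (K \<inter> Pow (jball u R)) u y))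
      \<le> T * t S x u + C * r powr (17 / 4 * k) / T ^ (k - 1) * (\<Sum>z\<in>S \<inter> jball u R. t S x z)"
proof -
  obtain C where C: "0 < C" "\<forall>W A u r z. finite W \<longrightarrow> finite (A :: nat set) \<longrightarrow> card A = k \<longrightarrow> 1 \<le> r \<longrightarrow> z \<in> W \<longrightarrow>
    (\<Sum>f\<in>PiE A (\<lambda>_. W \<inter> jball u r). Pr W (\<lambda>K. \<forall>i\<in>A. conn K z (f i)))
      \<le> C * r powr (17 / 4 * k) * jd z u powr (- 9 / 4)"
    using tree_moment[OF assms] by (elim exE conjE)
  have main: "(\<Sum>y\<in>W \<inter> jball u r. Pr W (\<lambda>K. conn (K \<inter> Pow S) x u \<and> conn (K \<inter> Pow (jball u R)) u y))
      \<le> T * t S x u + C * r powr (17 / 4 * k) / T ^ (k - 1) * (\<Sum>z\<in>S \<inter> jball u R. t S x z)"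
    if h: "finite W" "S \<subseteq> W" "x \<in> S" "u \<in> S" "1 \<le> r" "1 \<le> R" "0 < T" for W S x u r R T
  proof -
    have finS: "finite S" using h finite_subset by auto
    define B where "B = W \<inter> jball u r"
    have finB: "finite B" using h by (simp add: B_def)
    define A where "A K \<longleftrightarrow> conn (K \<inter> Pow S) x u" for K
    define l where "l y K \<longleftrightarrow> conn (K \<inter> Pow (jball u R)) u y" for y K
    define N where "N K = (\<Sum>y\<in>B. of_bool (l y K) :: real)" for K
    have N0: "0 \<le> N K" for K unfolding N_def by (intro sum_nonneg) auto
    have k: "k = Suc (k - 1)" using assms by simp
    have "(\<Sum>y\<in>B. Pr W (\<lambda>K. A K \<and> l y K)) = bex p (F W) (\<lambda>K. of_bool (A K) * N K)"
      unfolding bpr_def bex_sum[symmetric] N_def sum_distrib_left by (simp add: of_bool_conj)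
    also have "\<dots> \<le> bex p (F W) (\<lambda>K. T * of_bool (A K) + 1 / T ^ (k - 1) * (of_bool (A K) * N K ^ k))"
    proof (intro bex_mono p_le)
      fix K
      have "N K \<le> T + N K ^ Suc (k - 1) / T ^ (k - 1)" by (rule le_add_power) (use N0 h in auto)
      then show "of_bool (A K) * N K \<le> T * of_bool (A K) + 1 / T ^ (k - 1) * (of_bool (A K) * N K ^ k)"
        using k by simp
    qed
    also have "\<dots> = T * Pr W A + 1 / T ^ (k - 1) * bex p (F W) (\<lambda>K. of_bool (A K) * N K ^ k)"
      by (simp only: bex_add bex_cmult bpr_def)
    also have "bex p (F W) (\<lambda>K. of_bool (A K) * N K ^ k) =
        (\<Sum>f\<in>PiE {..<k} (\<lambda>_. B). Pr W (\<lambda>K. A K \<and> (\<forall>i\<in>{..<k}. l (f i) K)))"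
      unfolding N_def power_sum_PiE[OF finB] bpr_def bex_sum[symmetric] sum_distrib_left
      by (simp only: prod_of_bool finite_lessThan of_bool_conj)
    also have "\<dots> \<le> (\<Sum>f\<in>PiE {..<k} (\<lambda>_. B). \<Sum>z\<in>S \<inter> jball u R. t S x z * Pr W (\<lambda>K. \<forall>i\<in>{..<k}. conn K u (f i)))"
    proof (rule sum_mono)
      fix f
      have "Pr W (\<lambda>K. A K \<and> (\<forall>i\<in>{..<k}. l (f i) K)) \<le>
         (\<Sum>z\<in>S \<inter> jball u R. Pr W (disjointly (\<lambda>K. conn (K \<inter> Pow S) x z) (\<lambda>K. \<forall>i\<in>{..<k}. conn K u (f i))))"
      proof (rule bpr_Un_le[OF p_le])
        show "finite (S \<inter> jball u R)" using finS by simp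
        fix K assume K: "K \<subseteq> F W" and c: "A K \<and> (\<forall>i\<in>{..<k}. l (f i) K)"
        have finK: "finite K" using K finite_edges_in[OF h(1)] finite_subset by metis
        have neK: "{} \<notin> K" using edges_in_empty[OF K E_ne] .
        have "u \<in> jball u R" using h by (simp add: mem_jball)
        then obtain z where z: "z \<in> jball u R"
          "disjointly (\<lambda>K. conn (K \<inter> Pow S) x z) (\<lambda>K. \<forall>i\<in>{..<k}. conn K u (f i)) K"
          using conn_local_hit[OF finK neK, of S x u "jball u R" "{..<k}" f] c unfolding A_def l_def by blast
        from z(2) obtain K1 where "conn (K1 \<inter> Pow S) x z" by (rule disjointlyE)
        then have "z \<in> S" using h(3) by (rule conn_in_Pow)
        then show "\<exists>z\<in>S \<inter> jball u R. disjointly (\<lambda>K. conn (K \<inter> Pow S) x z) (\<lambda>K. \<forall>i\<in>{..<k}. conn K u (f i)) K"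
          using z by blast
      qed
      also have "\<dots> \<le> (\<Sum>z\<in>S \<inter> jball u R. t S x z * Pr W (\<lambda>K. \<forall>i\<in>{..<k}. conn K u (f i)))"
      proof (rule sum_mono)
        fix z
        have "Pr W (disjointly (\<lambda>K. conn (K \<inter> Pow S) x z) (\<lambda>K. \<forall>i\<in>{..<k}. conn K u (f i))) \<le>
          Pr W (\<lambda>K. conn (K \<inter> Pow S) x z) * Pr W (\<lambda>K. \<forall>i\<in>{..<k}. conn K u (f i))"
          by (intro bk finite_edges_in h p_le increasing_all increasing_conn increasing_conn_Int)
        then show "Pr W (disjointly (\<lambda>K. conn (K \<inter> Pow S) x z) (\<lambda>K. \<forall>i\<in>{..<k}. conn K u (f i))) \<le>
          t S x z * Pr W (\<lambda>K. \<forall>i\<in>{..<k}. conn K u (f i))"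
          by (simp only: bpr_conn_subset[OF h(1,2,3)])
      qed
      finally show "Pr W (\<lambda>K. A K \<and> (\<forall>i\<in>{..<k}. l (f i) K)) \<le>
         (\<Sum>z\<in>S \<inter> jball u R. t S x z * Pr W (\<lambda>K. \<forall>i\<in>{..<k}. conn K u (f i)))" .
    qed
    also have "\<dots> = (\<Sum>z\<in>S \<inter> jball u R. t S x z) * (\<Sum>f\<in>PiE {..<k} (\<lambda>_. B). Pr W (\<lambda>K. \<forall>i\<in>{..<k}. conn K u (f i)))"
      unfolding sum_product by (rule sum.swap)
    also have "\<dots> \<le> (\<Sum>z\<in>S \<inter> jball u R. t S x z) * (C * r powr (17 / 4 * k) * jd u u powr (- 9 / 4))"
    proof (rule mult_left_mono)
      have "u \<in> W" using h by auto
      then show "(\<Sum>f\<in>PiE {..<k} (\<lambda>_. B). Pr W (\<lambda>K. \<forall>i\<in>{..<k}. conn K u (f i))) \<le> C * r powr (17 / 4 * k) * jd u u powr (- 9 / 4)"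
        unfolding B_def using C(2)[rule_format, OF h(1), of "{..<k}" r u u] h(5) by simp
      show "0 \<le> (\<Sum>z\<in>S \<inter> jball u R. t S x z)" by (intro sum_nonneg t_nonneg)
    qed
    finally have *: "(\<Sum>y\<in>B. Pr W (\<lambda>K. A K \<and> l y K)) \<le> T * Pr W A +
        1 / T ^ (k - 1) * ((\<Sum>z\<in>S \<inter> jball u R. t S x z) * (C * r powr (17 / 4 * k) * jd u u powr (- 9 / 4)))"
      using h(7) by (simp add: divide_right_mono)
    have "Pr W A = t S x u" unfolding A_def by (rule bpr_conn_subset[OF h(1,2,3)])
    with * show ?thesis unfolding A_def l_def B_def by (simp add: mult_ac)
  qed
  show ?thesis by (rule that[of C]) (use C(1) main in auto)
qed

text \<open>The bound is proved for the smallest admissible constant \<open>A\<close>, which is finite because \<open>W\<close> is: the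
  contribution of branch points far away from \<open>u\<close> is at most a quarter of it, and everything near
  \<open>u\<close> is controlled by a high moment of the local cluster.\<close>

lemma joint_bound:
  obtains C where "0 < C" "\<And>W S x n. finite W \<Longrightarrow> S \<subseteq> W \<Longrightarrow> x \<in> S \<Longrightarrow>
    joint W S x (4 ^ n) \<le> C * 2 ^ (9 * n) * phi_in S x"
proof -
  obtain C1 C2 where far: "0 < C1" "0 < C2"
    "\<And>W S x r r' R. finite W \<Longrightarrow> S \<subseteq> W \<Longrightarrow> x \<in> S \<Longrightarrow> 1 \<le> r \<Longrightarrow> 2 * r \<le> r' \<Longrightarrow> 2 * r' \<le> R \<Longrightarrow>
      (\<Sum>u\<in>bd S. \<Sum>y\<in>W \<inter> jball u r. Pr W (\<lambda>K. conn (K \<inter> Pow S) x u \<and> conn K x y \<and>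
          \<not> conn (K \<inter> Pow (jball u R)) u y))
      \<le> C1 * r powr d * (\<Sum>u\<in>bd S. \<Sum>z\<in>S - jball u r'. t S x z * t S z u * jd z u powr (2 - d)) +
        C2 * r powr d * R powr (4 - d) * r' powr (4 * d) * phi_in S x"
    by (rule far_bound) auto
  obtain C3 where shell: "0 < C3" "\<And>S x D. finite S \<Longrightarrow> x \<in> S \<Longrightarrow> 1 \<le> D \<Longrightarrow>
    (\<Sum>u\<in>bd S. \<Sum>z\<in>S \<inter> jball u D. t S x z) \<le> C3 * D powr (4 * d) * phi_in S x"
    by (rule phi_shell) auto
  define D where "D = CARD('d)"
  have dD: "d = real D" by (simp add: d_eq D_def)
  have D7: "7 \<le> D" using dim by (simp add: D_def)
  \<comment> \<open>The radius \<open>R\<close> will be 4^(\<alpha> n + \<beta>). Since 17/4 < 9/2,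
    the moment of order \<open>k\<close> gains 2^(-n k/2); with \<open>k = 16 * D * \<alpha>\<close>
    this cancels exactly the growing part 2^(8 D \<alpha> n) of the loss R^(4d) in
    \<open>phi_shell\<close>.\<close>
  define \<alpha> where "\<alpha> = D + 8 * D * D"
  define k where "k = 16 * D * \<alpha>"
  have k1: "1 \<le> k" using D7 by (simp add: k_def \<alpha>_def)
  obtain C4 where loc: "0 < C4" "\<And>W S x u r R T. finite W \<Longrightarrow> S \<subseteq> W \<Longrightarrow> x \<in> S \<Longrightarrow> u \<in> S \<Longrightarrow> 1 \<le> r \<Longrightarrow> 1 \<le> R \<Longrightarrow> 0 < T \<Longrightarrow>
      (\<Sum>y\<in>W \<inter> jball u r. Pr W (\<lambda>K. conn (K \<inter> Pow S) x u \<and> conn (K \<inter> Pow (jball u R)) u y))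
      \<le> T * t S x u + C4 * r powr (17 / 4 * k) / T ^ (k - 1) * (\<Sum>z\<in>S \<inter> jball u R. t S x z)"
    by (rule local_bound[OF k1]) auto
  obtain m0' where m0': "2 ^ 12 * C1 < 2 ^ m0'" using real_arch_pow[of 2 "2 ^ 12 * C1"] by auto
  define m0 where "m0 = Suc m0'"
  have m0: "2 ^ 12 * C1 \<le> 2 ^ m0" by (rule order_trans[OF less_imp_le[OF m0']]) (simp add: m0_def)
  obtain m1 where m1: "C2 < 4 ^ m1" using real_arch_pow[of 4 C2] by auto
  define \<beta> where "\<beta> = 4 * D * m0 + m1"
  define C5 where "C5 = C4 * C3 * 2 ^ (8 * D * \<beta>)"
  have C5: "0 < C5" using loc shell by (simp add: C5_def)
  have step: "joint W S x (4 ^ n) \<le> (2 + C5 + A / 4) * 2 ^ (9 * n) * phi_in S x"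
    if h: "finite W" "S \<subseteq> W" "x \<in> S" and A: "0 \<le> A" "\<And>n. joint W S x (4 ^ n) \<le> A * 2 ^ (9 * n) * phi_in S x"
    for W S x A n
  proof -
    have finS: "finite S" using h finite_subset by auto
    \<comment> \<open>With this choice 2^m beats \<open>r powr d\<close> by the factor 2^m0, and
      \<open>R\<close> beats \<open>r powr d * r' powr (4 * d)\<close> by the factor 4^m1.\<close>
    define m where "m = 2 * D * n + m0"
    define M where "M = D * n + 4 * D * m + m1"
    have M_eq: "M = \<alpha> * n + \<beta>" by (simp add: M_def m_def \<alpha>_def \<beta>_def algebra_simps)
    define r r' R T :: real where "r = 4 ^ n" and "r' = 4 ^ m" and "R = 4 ^ M" and "T = 2 ^ (9 * n)"
    have "1 * n \<le> 2 * D * n" using D7 by (intro mult_right_mono) auto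
    then have nm: "Suc n \<le> m" unfolding m_def m0_def by linarith
    have "1 * m \<le> D * m" using D7 by (intro mult_right_mono) auto
    then have mM: "Suc m \<le> M" using nm unfolding M_def by linarith
    have r1: "1 \<le> r" "1 \<le> R" "0 < T" by (simp_all add: r_def R_def T_def)
    have "2 * r \<le> 4 ^ Suc n" by (simp add: r_def)
    also have "\<dots> \<le> r'" unfolding r'_def using nm by (intro power_increasing) auto
    finally have rr': "2 * r \<le> r'" .
    have "2 * r' \<le> 4 ^ Suc m" by (simp add: r'_def)
    also have "\<dots> \<le> R" unfolding R_def using mM by (intro power_increasing) auto
    finally have r'R: "2 * r' \<le> R" .
    have pw: "r powr d = 4 ^ (n * D)" "r' powr (4 * d) = 4 ^ (4 * D * m)" "R powr (4 * d) = 4 ^ (4 * D * M)"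
    proof -
      have "r powr d = r ^ D" "r' powr (4 * d) = r' ^ (4 * D)" "R powr (4 * d) = R ^ (4 * D)"
        using powr_realpow[of r D] powr_realpow[of r' "4 * D"] powr_realpow[of R "4 * D"]
        by (simp_all add: dD r_def r'_def R_def)
      then show "r powr d = 4 ^ (n * D)" "r' powr (4 * d) = 4 ^ (4 * D * m)" "R powr (4 * d) = 4 ^ (4 * D * M)"
        by (simp_all add: r_def r'_def R_def power_mult[symmetric] mult_ac)
    qed
    have "joint W S x r \<le> (\<Sum>u\<in>bd S. \<Sum>y\<in>W \<inter> jball u r.
        Pr W (\<lambda>K. conn (K \<inter> Pow S) x u \<and> conn (K \<inter> Pow (jball u R)) u y) +
        Pr W (\<lambda>K. conn (K \<inter> Pow S) x u \<and> conn K x y \<and> \<not> conn (K \<inter> Pow (jball u R)) u y))"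
      unfolding joint_def by (intro sum_mono bpr_disj_le p_le) auto
    also have "\<dots> = (\<Sum>u\<in>bd S. \<Sum>y\<in>W \<inter> jball u r.
        Pr W (\<lambda>K. conn (K \<inter> Pow S) x u \<and> conn (K \<inter> Pow (jball u R)) u y)) +
        (\<Sum>u\<in>bd S. \<Sum>y\<in>W \<inter> jball u r.
        Pr W (\<lambda>K. conn (K \<inter> Pow S) x u \<and> conn K x y \<and> \<not> conn (K \<inter> Pow (jball u R)) u y))"
      (is "_ = ?loc + ?far") by (simp only: sum.distrib)
    also have "?loc \<le> (\<Sum>u\<in>bd S. T * t S x u + C4 * r powr (17 / 4 * k) / T ^ (k - 1) * (\<Sum>z\<in>S \<inter> jball u R. t S x z))"
      using h r1 by (intro sum_mono loc(2)) (auto simp: inner_boundary_def)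
    also have "\<dots> = T * phi_in S x + C4 * r powr (17 / 4 * k) / T ^ (k - 1) * (\<Sum>u\<in>bd S. \<Sum>z\<in>S \<inter> jball u R. t S x z)"
      by (simp only: sum.distrib sum_distrib_left phi_in_def)
    also have "\<dots> \<le> T * phi_in S x + C4 * r powr (17 / 4 * k) / T ^ (k - 1) * (C3 * R powr (4 * d) * phi_in S x)"
      using loc(1) r1 h finS by (intro add_left_mono mult_left_mono shell(2)) auto
    also have "\<dots> \<le> T * phi_in S x + C5 * T * phi_in S x"
    proof -
      have "r powr (17 / 4 * k) = 2 powr (real (2 * n) * (17 / 4 * k))"
      proof -
        have "r = 2 ^ (2 * n)" by (simp add: r_def power_mult)
        also have "\<dots> = 2 powr (real (2 * n))" by (simp only: powr_realpow zero_less_numeral)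
        finally show ?thesis by (simp only: powr_powr)
      qed
      moreover have "R powr (4 * d) = 2 powr real (8 * D * M)"
      proof -
        have "R powr (4 * d) = (2 ^ 2) ^ (4 * D * M)" using pw(3) by simp
        also have "\<dots> = 2 ^ (8 * D * M)" by (simp only: power_mult[symmetric]) (simp add: mult_ac)
        finally show ?thesis by (simp only: powr_realpow zero_less_numeral)
      qed
      moreover have "T ^ (k - 1) = 2 powr real (9 * n * (k - 1))"
      proof -
        have "T ^ (k - 1) = 2 ^ (9 * n * (k - 1))" unfolding T_def by (simp only: power_mult)
        then show ?thesis by (simp only: powr_realpow zero_less_numeral)
      qed
      ultimately have "r powr (17 / 4 * k) / T ^ (k - 1) * R powr (4 * d) =
          2 powr (real (2 * n) * (17 / 4 * k) - real (9 * n * (k - 1)) + real (8 * D * M))"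
        by (simp only: powr_add powr_diff)
      also have "real (2 * n) * (17 / 4 * k) - real (9 * n * (k - 1)) + real (8 * D * M) = real (9 * n + 8 * D * \<beta>)"
      proof -
        have "real (k - 1) = real k - 1" using k1 by (simp add: of_nat_diff)
        moreover have "real k = 16 * real D * real \<alpha>" by (simp add: k_def)
        ultimately show ?thesis by (simp add: M_eq algebra_simps)
      qed
      also have "2 powr real (9 * n + 8 * D * \<beta>) = T * 2 ^ (8 * D * \<beta>)"
        by (simp only: powr_realpow zero_less_numeral power_add T_def)
      finally have e: "r powr (17 / 4 * k) / T ^ (k - 1) * R powr (4 * d) = T * 2 ^ (8 * D * \<beta>)" .
      have "C4 * r powr (17 / 4 * k) / T ^ (k - 1) * (C3 * R powr (4 * d) * phi_in S x) =
         C4 * C3 * (r powr (17 / 4 * k) / T ^ (k - 1) * R powr (4 * d)) * phi_in S x" by simp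
      also have "\<dots> = C5 * T * phi_in S x" unfolding e C5_def by simp
      finally show ?thesis by simp
    qed
    also have "?far \<le> C1 * r powr d * (\<Sum>u\<in>bd S. \<Sum>z\<in>S - jball u r'. t S x z * t S z u * jd z u powr (2 - d)) +
        C2 * r powr d * R powr (4 - d) * r' powr (4 * d) * phi_in S x"
      using h r1 rr' r'R by (intro far(3))
    also have "\<dots> \<le> C1 * r powr d * (2 ^ 10 * A * phi_in S x / 2 ^ m) + T * phi_in S x"
    proof (rule add_mono)
      show "C1 * r powr d * (\<Sum>u\<in>bd S. \<Sum>z\<in>S - jball u r'. t S x z * t S z u * jd z u powr (2 - d))
        \<le> C1 * r powr d * (2 ^ 10 * A * phi_in S x / 2 ^ m)"
        unfolding r'_def using far(1) by (intro mult_left_mono far_iterate[OF h A]) auto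
      have "R powr (4 - d) \<le> R powr (- 1)" using d7 r1 by (intro powr_mono) auto
      also have "\<dots> = 1 / R" using r1 by (simp add: powr_minus_divide)
      finally have "C2 * r powr d * R powr (4 - d) * r' powr (4 * d) \<le> C2 * r powr d * (1 / R) * r' powr (4 * d)"
        using far(2) by (intro mult_right_mono mult_left_mono) auto
      also have "\<dots> = C2 / 4 ^ m1"
        unfolding pw unfolding R_def M_def by (simp add: power_add mult_ac)
      also have "\<dots> \<le> 1" using m1 by simp
      also have "1 \<le> T" by (simp add: T_def)
      finally show "C2 * r powr d * R powr (4 - d) * r' powr (4 * d) * phi_in S x \<le> T * phi_in S x"
        by (intro mult_right_mono phi_in_nonneg)
    qed
    also have "C1 * r powr d * (2 ^ 10 * A * phi_in S x / 2 ^ m) \<le> A / 4 * T * phi_in S x"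
    proof -
      have "(2::real) ^ (2 * D * n) = (2 ^ 2) ^ (n * D)" by (simp only: power_mult[symmetric] mult_ac)
      then have "(2::real) ^ (2 * D * n) = 4 ^ (n * D)" by simp
      then have "C1 * r powr d * (2 ^ 10 * A * phi_in S x / 2 ^ m) = C1 * 2 ^ 10 / 2 ^ m0 * (A * phi_in S x)"
        unfolding pw m_def by (simp add: power_add)
      also have "\<dots> \<le> 1 / 4 * (A * phi_in S x)"
        using m0 A phi_in_nonneg by (intro mult_right_mono) (auto simp: field_simps)
      also have "\<dots> = A / 4 * phi_in S x * 1" by simp
      also have "\<dots> \<le> A / 4 * phi_in S x * T"
        using A phi_in_nonneg by (intro mult_left_mono) (auto simp: T_def)
      finally show ?thesis by (simp add: mult_ac)
    qed
    finally show ?thesis unfolding r_def T_def by (simp add: algebra_simps)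
  qed
  define C where "C = (2 + C5) * 4 / 3"
  have "joint W S x (4 ^ n) \<le> C * 2 ^ (9 * n) * phi_in S x" if h: "finite W" "S \<subseteq> W" "x \<in> S" for W S x n
  proof -
    define q where "q n = 2 ^ (9 * n) * phi_in S x" for n :: nat
    \<comment> \<open>A trivial bound depending on \<open>W\<close>; it makes the supremum
      \<open>A\<close> below finite and settles the case where \<open>phi_in S x\<close>
      vanishes.\<close>
    have triv: "joint W S x r \<le> real (card W) * phi_in S x" for r
    proof -
      have "joint W S x r \<le> (\<Sum>u\<in>bd S. \<Sum>y\<in>W \<inter> jball u r. t S x u)"
        unfolding joint_def bpr_conn_subset[OF h, symmetric] by (intro sum_mono bpr_mono p_le) auto
      also have "\<dots> = (\<Sum>u\<in>bd S. real (card (W \<inter> jball u r)) * t S x u)" by simp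
      also have "\<dots> \<le> (\<Sum>u\<in>bd S. real (card W) * t S x u)"
        using h by (intro sum_mono mult_right_mono t_nonneg of_nat_mono card_mono) auto
      finally show ?thesis by (simp add: phi_in_def sum_distrib_left)
    qed
    have joint0: "0 \<le> joint W S x r" for r
      unfolding joint_def by (intro sum_nonneg bpr_nonneg p_le)
    show ?thesis
    proof (cases "phi_in S x = 0")
      case True
      then show ?thesis using triv[of "4 ^ n"] by simp
    next
      case False
      then have pos: "0 < phi_in S x" using phi_in_nonneg[of S x] by simp
      then have q0: "0 < q n" for n by (simp add: q_def)
      define A where "A = (SUP n. joint W S x (4 ^ n) / q n)"
      have bdd: "bdd_above (range (\<lambda>n. joint W S x (4 ^ n) / q n))"
      proof (rule bdd_aboveI2)
        fix n
        have "phi_in S x * 1 \<le> phi_in S x * 2 ^ (9 * n)" using pos by (intro mult_left_mono) auto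
        then have "real (card W) * phi_in S x \<le> real (card W) * q n"
          by (intro mult_left_mono) (simp_all add: q_def mult.commute)
        then show "joint W S x (4 ^ n) / q n \<le> real (card W)"
          using triv[of "4 ^ n"] q0[of n] by (simp add: divide_le_eq)
      qed
      have le: "joint W S x (4 ^ n) / q n \<le> A" for n
        unfolding A_def by (rule cSUP_upper[OF _ bdd]) simp
      have A0: "0 \<le> A" using le[of 0] joint0[of "4 ^ 0"] q0[of 0] by (meson divide_nonneg_pos order_trans)
      have leq: "joint W S x (4 ^ n) \<le> A * 2 ^ (9 * n) * phi_in S x" for n
        using le[of n] q0[of n] by (simp add: divide_le_eq q_def mult.assoc)
      \<comment> \<open>\<open>step\<close> applied with the optimal constant itself; as
        \<open>A\<close> is finite, the inequality can be solved for it.\<close>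
      have "A \<le> 2 + C5 + A / 4"
        unfolding A_def
      proof (rule cSUP_least)
        fix n
        show "joint W S x (4 ^ n) / q n \<le> 2 + C5 + (SUP n. joint W S x (4 ^ n) / q n) / 4"
          using step[OF h A0 leq, of n] q0[of n] unfolding A_def by (simp add: divide_le_eq q_def mult.assoc)
      qed simp
      then have "A \<le> C" by (simp add: C_def)
      then have "A * 2 ^ (9 * n) * phi_in S x \<le> C * 2 ^ (9 * n) * phi_in S x"
        using pos by (intro mult_right_mono) auto
      then show ?thesis using leq[of n] by linarith
    qed
  qed
  moreover have "0 < C" using C5 by (simp add: C_def)
  ultimately show ?thesis by (intro that)
qed

end

section \<open>Surgery in a ball\<close>

definition upd :: "int ^ 'd \<Rightarrow> 'd \<Rightarrow> int \<Rightarrow> int ^ 'd"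
  where "upd z i s = (\<chi> k. if k = i then s else z $ k)"

lemma upd_nth [simp]: "upd z i s $ k = (if k = i then s else z $ k)"
  by (simp add: upd_def)

lemma upd_same [simp]: "upd z i (z $ i) = z"
  by (simp add: vec_eq_iff)

lemma l1_norm_upd: "l1_norm (upd z i s - upd z i s') = \<bar>s - s'\<bar>" for z :: "int ^ 'd"
proof -
  have "l1_norm (upd z i s - upd z i s') = (\<Sum>k\<in>UNIV. if k = i then \<bar>s - s'\<bar> else 0)"
    unfolding l1_norm_def by (intro sum.cong) auto
  then show ?thesis by simp
qed

lemma conn_line_le:
  assumes nn: "\<And>x y. l1_norm (x - y) = 1 \<Longrightarrow> {x, y} \<in> E"
    and "s \<le> s'" "\<And>r. s \<le> r \<Longrightarrow> r \<le> s' \<Longrightarrow> upd z i r \<in> P"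
  shows "conn (edges_in E P) (upd z i s) (upd z i s')"
  using assms(2,3)
proof (induction s' rule: int_ge_induct)
  case (step s')
  have "{upd z i s', upd z i (s' + 1)} \<in> E"
    by (rule nn) (simp add: l1_norm_upd)
  then have "{upd z i s', upd z i (s' + 1)} \<in> edges_in E P"
    using step.hyps step.prems[of s'] step.prems[of "s' + 1"] by (simp add: edges_in_def)
  moreover have "conn (edges_in E P) (upd z i s) (upd z i s')" by (rule step.IH) (use step.prems in auto)
  ultimately show ?case by (rule conn_step[rotated])
qed simp

context perc
begin

lemma edge_jball:
  assumes "e \<in> E" "e \<inter> jball c R \<noteq> {}"
  shows "e \<subseteq> jball c (R + L)"
proof
  fix z assume z: "z \<in> e"
  obtain x y where xy: "e = {x, y}" "jd x y \<le> L" using E_form[OF assms(1)] by blast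
  obtain v where v: "v \<in> e" "jd c v \<le> R" using assms(2) by (auto simp: mem_jball)
  have "jd v z \<le> L" using z v xy ab by (auto simp: jd_sym)
  then show "z \<in> jball c (R + L)" using jd_triangle[of c z v] v by (simp add: mem_jball)
qed

section \<open>Two lattice paths in a ball that meet only in its centre\<close>

lemma conn_line:
  assumes "\<And>r. min s s' \<le> r \<Longrightarrow> r \<le> max s s' \<Longrightarrow> upd z i r \<in> P"
  shows "conn (F P) (upd z i s) (upd z i s')"
proof (cases "s \<le> s'")
  case True
  then show ?thesis using assms by (intro conn_line_le E_nn) auto
next
  case False
  then have "conn (F P) (upd z i s') (upd z i s)" using assms by (intro conn_line_le E_nn) auto
  then show ?thesis by (rule conn_sym)
qed

text \<open>The coordinates in \<open>J\<close> are moved to the values \<open>g\<close> one after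
  another; closure of \<open>P\<close> under such moves keeps every segment inside
  \<open>P\<close>.\<close>

lemma conn_coords:
  assumes "finite J" "y \<in> P"
    and "\<And>z i r. z \<in> P \<Longrightarrow> i \<in> J \<Longrightarrow> min (z $ i) (g i) \<le> r \<Longrightarrow> r \<le> max (z $ i) (g i) \<Longrightarrow> upd z i r \<in> P"
  shows "conn (F P) y (\<chi> k. if k \<in> J then g k else y $ k) \<and> (\<chi> k. if k \<in> J then g k else y $ k) \<in> P"
  using assms(1,3)
proof (induction J rule: finite_induct)
  case empty
  have "(\<chi> k. if k \<in> {} then g k else y $ k) = y" by (simp add: vec_eq_iff)
  then show ?case using assms(2) by simp
next
  case (insert j J)
  define z where "z = (\<chi> k. if k \<in> J then g k else y $ k)"
  have "conn (F P) y z \<and> z \<in> P"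
    unfolding z_def by (rule insert.IH) (rule insert.prems, auto)
  then have IH: "conn (F P) y z" "z \<in> P" by auto
  have eq: "(\<chi> k. if k \<in> insert j J then g k else y $ k) = upd z j (g j)"
    by (simp add: z_def vec_eq_iff)
  have "conn (F P) (upd z j (z $ j)) (upd z j (g j))"
    by (rule conn_line) (rule insert.prems[OF IH(2)], auto)
  then have "conn (F P) z (upd z j (g j))" by simp
  then have "conn (F P) y (upd z j (g j))" by (rule conn_trans[OF IH(1)])
  moreover have "upd z j (g j) \<in> P" using insert.prems[OF IH(2), of j "g j"] by simp
  ultimately show ?case unfolding eq by simp
qed

lemma jball_iff:
  fixes z :: "int ^ 'd"
  assumes "1 \<le> R"
  shows "z \<in> jball c R \<longleftrightarrow> (\<forall>i. \<bar>z $ i - c $ i\<bar> \<le> \<lfloor>R\<rfloor>)"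
proof -
  have "z \<in> jball c R \<longleftrightarrow> real_of_int (linf_norm (c - z)) \<le> R" using assms by (simp add: mem_jball jd_def)
  also have "\<dots> \<longleftrightarrow> linf_norm (c - z) \<le> \<lfloor>R\<rfloor>" by (simp add: le_floor_iff)
  also have "\<dots> \<longleftrightarrow> (\<forall>i. \<bar>z $ i - c $ i\<bar> \<le> \<lfloor>R\<rfloor>)"
    by (simp add: linf_norm_le_iff abs_minus_commute)
  finally show ?thesis .
qed

text \<open>The point closer to the centre in direction \<open>j\<close> moves inside its own hyperplane to the \<open>j\<close>-axis and
  then along this axis; the other one avoids it by descending along a parallel line at distance one,
  on the opposite side in direction \<open>i\<close>.\<close>

lemma fan_aux:
  fixes c y w :: "int ^ 'd"
  assumes R: "1 \<le> R" and yw: "y \<in> jball c R" "w \<in> jball c R"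
    and j: "y $ j \<noteq> w $ j" "\<bar>y $ j - c $ j\<bar> \<le> \<bar>w $ j - c $ j\<bar>"
  shows "\<exists>P P'. P \<subseteq> jball c R \<and> P' \<subseteq> jball c R \<and> P \<inter> P' \<subseteq> {c} \<and> y \<in> P \<and> w \<in> P' \<and>
    conn (F P) y c \<and> conn (F P') w c"
proof -
  have "\<exists>i. i \<noteq> j"
  proof (rule ccontr)
    assume "\<not> (\<exists>i. i \<noteq> j)"
    then have "(UNIV :: 'd set) = {j}" by auto
    then have "CARD('d) = card {j}" by (rule arg_cong)
    then show False using dim by simp
  qed
  then obtain i where i: "i \<noteq> j" by blast
  define N where "N = \<lfloor>R\<rfloor>"
  have N: "1 \<le> N" using R by (simp add: N_def)
  have Q: "z \<in> jball c R \<longleftrightarrow> (\<forall>k. \<bar>z $ k - c $ k\<bar> \<le> N)" for z using jball_iff[OF R] by (simp add: N_def)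
  \<comment> \<open>The side of the centre in direction \<open>i\<close> on which \<open>y\<close>
    lies. The path of \<open>y\<close> keeps to it within \<open>A1\<close>, and the line for
    \<open>w\<close> runs on the other side, at coordinate \<open>c $ i - s\<close>.\<close>
  define s :: int where "s = (if c $ i \<le> y $ i then 1 else - 1)"
  have s: "s = 1 \<or> s = - 1" by (simp add: s_def)
  define A1 where "A1 = {z \<in> jball c R. z $ j = y $ j \<and> 0 \<le> s * (z $ i - c $ i)}"
  define A2 where "A2 = {z. (\<forall>k. k \<noteq> j \<longrightarrow> z $ k = c $ k) \<and> min (c $ j) (y $ j) \<le> z $ j \<and> z $ j \<le> max (c $ j) (y $ j)}"
  define B1 where "B1 = {z \<in> jball c R. z $ j = w $ j}"
  define B2 where "B2 = {z. (\<forall>k. k \<noteq> j \<and> k \<noteq> i \<longrightarrow> z $ k = c $ k) \<and> z $ i = c $ i - s \<and>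
      min (c $ j) (w $ j) \<le> z $ j \<and> z $ j \<le> max (c $ j) (w $ j)}"
  have sub: "A1 \<subseteq> jball c R" "B1 \<subseteq> jball c R" by (auto simp: A1_def B1_def)
  have yj: "\<bar>y $ j - c $ j\<bar> \<le> N" "\<bar>w $ j - c $ j\<bar> \<le> N" using yw by (auto simp: Q)
  have A2Q: "A2 \<subseteq> jball c R"
  proof
    fix z assume z: "z \<in> A2"
    have "\<bar>z $ k - c $ k\<bar> \<le> N" for k
    proof (cases "k = j")
      case True
      then show ?thesis using z yj(1) unfolding A2_def by (auto simp: min_def max_def split: if_splits)
    next
      case False
      then show ?thesis using z N by (simp add: A2_def)
    qed
    then show "z \<in> jball c R" by (simp add: Q)
  qed
  have B2Q: "B2 \<subseteq> jball c R"
  proof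
    fix z assume z: "z \<in> B2"
    have "\<bar>z $ k - c $ k\<bar> \<le> N" for k
    proof -
      consider "k = j" | "k = i" | "k \<noteq> j" "k \<noteq> i" by blast
      then show ?thesis
      proof cases
        case 1
        then show ?thesis using z yj(2) unfolding B2_def by (auto simp: min_def max_def split: if_splits)
      next
        case 2
        then show ?thesis using z N s by (auto simp: B2_def)
      next
        case 3
        then show ?thesis using z N by (simp add: B2_def)
      qed
    qed
    then show "z \<in> jball c R" by (simp add: Q)
  qed
  have cQ: "c \<in> jball c R" using N by (simp add: Q)
  \<comment> \<open>In direction \<open>j\<close>, the point \<open>w\<close> is at least as far
    from \<open>c\<close> as \<open>y\<close> and different from it, so its hyperplane misses the
    axis segment between \<open>c\<close> and the hyperplane of \<open>y\<close>.\<close>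
  have hull: "\<not> (min (c $ j) (y $ j) \<le> w $ j \<and> w $ j \<le> max (c $ j) (y $ j))"
    using j by (auto simp: min_def max_def split: if_splits)
  have disj: "(A1 \<union> A2) \<inter> (B1 \<union> B2 \<union> {c}) \<subseteq> {c}"
  proof
    fix z assume z: "z \<in> (A1 \<union> A2) \<inter> (B1 \<union> B2 \<union> {c})"
    have "\<not> (z \<in> A1 \<and> z \<in> B1)" using j by (auto simp: A1_def B1_def)
    moreover have "\<not> (z \<in> A1 \<and> z \<in> B2)" using s by (auto simp: A1_def B2_def)
    moreover have "\<not> (z \<in> A2 \<and> z \<in> B1)" using hull by (auto simp: A2_def B1_def)
    moreover have "\<not> (z \<in> A2 \<and> z \<in> B2)" using s i by (auto simp: A2_def B2_def)
    ultimately show "z \<in> {c}" using z by blast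
  qed
  have mono: "conn (F X) v v' \<Longrightarrow> X \<subseteq> Y \<Longrightarrow> conn (F Y) v v'" for X Y v v'
    by (rule conn_mono[of "F X"]) (auto simp: edges_in_def)
  have y1: "y \<in> A1" using yw by (auto simp: A1_def s_def)
  have w1: "w \<in> B1" using yw by (auto simp: B1_def)
  define y' where "y' = (\<chi> k. if k \<in> - {j} then c $ k else y $ k)"
  have "conn (F A1) y y' \<and> y' \<in> A1"
    unfolding y'_def
  proof (rule conn_coords[OF _ y1])
    fix z k r assume h: "z \<in> A1" "k \<in> - {j}" "min (z $ k) (c $ k) \<le> r" "r \<le> max (z $ k) (c $ k)"
    have "\<bar>upd z k r $ l - c $ l\<bar> \<le> N" for l
      using h N unfolding A1_def by (auto simp: Q min_def max_def split: if_splits) (smt (verit))+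
    moreover have "0 \<le> s * (upd z k r $ i - c $ i)"
      using h s unfolding A1_def by (auto simp: min_def max_def split: if_splits)
    ultimately show "upd z k r \<in> A1" using h by (auto simp: A1_def Q)
  qed simp
  moreover have "conn (F A2) (upd c j (y $ j)) (upd c j (c $ j))"
    by (rule conn_line) (auto simp: A2_def)
  moreover have "y' = upd c j (y $ j)" by (simp add: y'_def vec_eq_iff)
  ultimately have yc: "conn (F (A1 \<union> A2)) y c"
    using conn_trans[OF mono[of A1 y y' "A1 \<union> A2"] mono[of A2 y' c "A1 \<union> A2"]] by auto
  define g where "g k = (if k = i then c $ i - s else c $ k)" for k
  define w' where "w' = (\<chi> k. if k \<in> - {j} then g k else w $ k)"
  have "conn (F B1) w w' \<and> w' \<in> B1"
    unfolding w'_def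
  proof (rule conn_coords[OF _ w1])
    fix z k r assume h: "z \<in> B1" "k \<in> - {j}" "min (z $ k) (g k) \<le> r" "r \<le> max (z $ k) (g k)"
    have "\<bar>g k - c $ k\<bar> \<le> N" using s N by (auto simp: g_def)
    moreover have "\<bar>z $ k - c $ k\<bar> \<le> N" using h by (auto simp: B1_def Q)
    ultimately have "\<bar>r - c $ k\<bar> \<le> N" using h(3,4) by (auto simp: min_def max_def split: if_splits)
    then have "\<bar>upd z k r $ l - c $ l\<bar> \<le> N" for l using h by (auto simp: B1_def Q)
    then show "upd z k r \<in> B1" using h by (auto simp: B1_def Q)
  qed simp
  moreover have "conn (F B2) (upd (upd c i (c $ i - s)) j (w $ j)) (upd (upd c i (c $ i - s)) j (c $ j))"
    by (rule conn_line) (use i in \<open>auto simp: B2_def\<close>)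
  moreover have "w' = upd (upd c i (c $ i - s)) j (w $ j)" using i by (simp add: w'_def g_def vec_eq_iff)
  moreover have "conn (F (B1 \<union> B2 \<union> {c})) (upd (upd c i (c $ i - s)) j (c $ j)) c"
  proof (rule conn_edge)
    have e: "upd (upd c i (c $ i - s)) j (c $ j) = upd c i (c $ i - s)" using i by (simp add: vec_eq_iff)
    have "upd c i (c $ i - s) \<in> B2" using i by (auto simp: B2_def)
    moreover have "{upd c i (c $ i - s), upd c i (c $ i)} \<in> E"
      by (rule E_nn) (use s l1_norm_upd[of c i "c $ i - s" "c $ i"] in auto)
    ultimately show "{upd (upd c i (c $ i - s)) j (c $ j), c} \<in> F (B1 \<union> B2 \<union> {c})"
      unfolding e by (simp add: edges_in_def)
  qed
  ultimately have wc: "conn (F (B1 \<union> B2 \<union> {c})) w c"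
    using conn_trans[OF conn_trans[OF mono[of B1 w w' "B1 \<union> B2 \<union> {c}"]
      mono[of B2 w' "upd (upd c i (c $ i - s)) j (c $ j)" "B1 \<union> B2 \<union> {c}"]], of c] by auto
  show ?thesis
    by (rule exI[of _ "A1 \<union> A2"], rule exI[of _ "B1 \<union> B2 \<union> {c}"])
      (use sub A2Q B2Q cQ disj y1 w1 yc wc in auto)
qed

text \<open>Some coordinate \<open>j\<close> tells the two points apart, and by symmetry
  \<open>y\<close> may be taken as the one closer to the centre in it.\<close>

lemma fan:
  fixes c y w :: "int ^ 'd"
  assumes R: "1 \<le> R" and yw: "y \<in> jball c R" "w \<in> jball c R" "y \<noteq> w"
  shows "\<exists>P P'. P \<subseteq> jball c R \<and> P' \<subseteq> jball c R \<and> P \<inter> P' \<subseteq> {c} \<and> y \<in> P \<and> w \<in> P' \<and>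
    conn (F P) y c \<and> conn (F P') w c"
proof -
  obtain j where j: "y $ j \<noteq> w $ j" using yw(3) by (auto simp: vec_eq_iff)
  show ?thesis
  proof (cases "\<bar>y $ j - c $ j\<bar> \<le> \<bar>w $ j - c $ j\<bar>")
    case True
    then show ?thesis by (rule fan_aux[OF R yw(1,2) j])
  next
    case False
    then have "\<bar>w $ j - c $ j\<bar> \<le> \<bar>y $ j - c $ j\<bar>" by simp
    from fan_aux[OF R yw(2,1) j[symmetric] this] obtain P P' where
      "P \<subseteq> jball c R" "P' \<subseteq> jball c R" "P \<inter> P' \<subseteq> {c}" "w \<in> P" "y \<in> P'" "conn (F P) w c" "conn (F P') y c"
      by (elim exE conjE)
    then show ?thesis by (intro exI[of _ P'] exI[of _ P]) (simp add: Int_commute)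
  qed
qed

section \<open>Pivotal edges that leave \<open>S\<close>\<close>

definition pivotal_exit :: "(int ^ 'd) set \<Rightarrow> int ^ 'd \<Rightarrow> int ^ 'd \<Rightarrow> (int ^ 'd) \<times> (int ^ 'd) \<Rightarrow> (int ^ 'd) set set \<Rightarrow> bool"
  where "pivotal_exit S z x = (\<lambda>(u, v) K. conn (K \<inter> Pow S) z u \<and> {u, v} \<in> K \<and> conn K z x \<and> \<not> conn (K - {{u, v}}) z x)"

lemma pivotal_exit_unique:
  assumes p1: "pivotal_exit S z x (u1, v1) K" and p2: "pivotal_exit S z x (u2, v2) K"
    and S: "z \<in> S" "u1 \<in> S" "v1 \<notin> S" "u2 \<in> S" "v2 \<notin> S"
  shows "(u1, v1) = (u2, v2)"
proof (rule ccontr)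
  assume ne: "(u1, v1) \<noteq> (u2, v2)"
  then have e_ne: "{u1, v1} \<noteq> {u2, v2}" using S by (auto simp: doubleton_eq_iff)
  note p1' = p1[unfolded pivotal_exit_def prod.case] and p2' = p2[unfolded pivotal_exit_def prod.case]
  define U where "U = {y. conn (K - {{u1, v1}}) z y}"
  have KS: "K \<inter> Pow S \<subseteq> K - {{u1, v1}}" "K \<inter> Pow S \<subseteq> K - {{u2, v2}}" using S by auto
  have uU: "u1 \<in> U" "u2 \<in> U" unfolding U_def using p1' p2' conn_mono[OF KS(1)] by auto
  have zU: "z \<in> U" by (simp add: U_def)
  have xU: "x \<notin> U" using p1' by (simp add: U_def)
  have "conn K z x" using p1' by simp
  then obtain u w where uw: "u \<in> U" "w \<notin> U" "{u, w} \<in> K" "conn {e \<in> K. e \<inter> U = {}} w x"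
    using zU xU by (rule conn_last_exit)
  have "{u, w} = {u1, v1}"
  proof (rule ccontr)
    assume "{u, w} \<noteq> {u1, v1}"
    then have e: "{u, w} \<in> K - {{u1, v1}}" using uw(3) by simp
    have "conn (K - {{u1, v1}}) z u" using uw(1) by (simp add: U_def)
    from conn_step[OF this e] have "w \<in> U" by (simp add: U_def)
    then show False using uw(2) by simp
  qed
  then have wv: "w = v1" using uw(1,2) uU(1) by (auto simp: doubleton_eq_iff)
  have "conn (K - {{u2, v2}}) z u1" using p1' conn_mono[OF KS(2)] by simp
  moreover have "{u1, v1} \<in> K - {{u2, v2}}" using p1' e_ne by simp
  ultimately have "conn (K - {{u2, v2}}) z v1" by (rule conn_step)
  moreover have "conn (K - {{u2, v2}}) v1 x"
    using uw(4) unfolding wv by (rule conn_mono[rotated]) (use uU in auto)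
  ultimately have "conn (K - {{u2, v2}}) z x" by (rule conn_trans)
  then show False using p2' by simp
qed

text \<open>The edges opened at the ball lie along the two sets of \<open>fan\<close>, together with
  the exit edge and the links at \<open>y\<close> and \<open>w\<close>; all others at the ball are
  closed. The path from \<open>y\<close> to the centre starts in \<open>S\<close> and ends outside,
  so it has an exit edge. This edge is pivotal: the cluster of \<open>z\<close> off the ball,
  enlarged by the vertices \<open>V\<close> before the exit, can only be left through it.\<close>

lemma surgery:
  fixes c y w :: "int ^ 'd"
  assumes R: "1 \<le> R" and yw: "y \<in> jball c R" "w \<in> jball c R" "y \<noteq> w"
    and fin: "finite W" "jball c R \<subseteq> W" "S \<subseteq> W"
    and z: "z \<in> S" "z \<notin> jball c R" and x: "x \<notin> jball c R" and c: "c \<notin> S" and yS: "y \<in> S"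
    and y': "y' \<in> S" "y' \<notin> jball c R" "{y', y} \<in> E" "conn (K \<inter> Pow S) z y'"
    and w': "w' \<in> W" "w' \<notin> jball c R" "{w, w'} \<in> E" "conn K w' x"
    and K: "K \<subseteq> {e \<in> F W. e \<inter> jball c R = {}}" "\<not> conn K z x"
  shows "\<exists>B u v. B \<subseteq> {e \<in> F W. e \<inter> jball c R \<noteq> {}} \<and> u \<in> S \<and> v \<notin> S \<and> u \<in> jball c R \<and> {u, v} \<in> F W \<and>
    pivotal_exit S z x (u, v) (K \<union> B)"
proof -
  define Q where "Q = jball c R"
  obtain P P' where P: "P \<subseteq> Q" "P' \<subseteq> Q" "P \<inter> P' \<subseteq> {c}" "y \<in> P" "w \<in> P'" "conn (F P) y c" "conn (F P') w c"
    using fan[OF R yw] unfolding Q_def by (elim exE conjE)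
  have finP: "finite (F P)" using P(1) unfolding Q_def by (intro finite_edges_in) (rule finite_subset, auto)
  have "y \<in> S \<inter> P" "c \<notin> S \<inter> P" using yS P(4) c by auto
  from conn_exit_vertices[OF finP P(6) this]
  obtain u v V K1 K2 where h: "V \<subseteq> S \<inter> P" "y \<in> V" "u \<in> V" "v \<notin> S \<inter> P" "{u, v} \<in> F P" "K1 \<subseteq> F P \<inter> Pow V"
      "K2 \<subseteq> F P" "\<forall>e\<in>K2. e \<inter> V = {}" "conn K1 y u" "conn K2 v c"
    by (elim exE conjE)
  have vS: "v \<notin> S" "u \<in> S" "u \<in> Q" using h(1,3,4,5) P(1) by (auto simp: edges_in_def)
  have FQ: "F X \<subseteq> {e \<in> F W. e \<inter> Q \<noteq> {}}" if "X \<subseteq> Q" for X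
  proof
    fix e assume e: "e \<in> F X"
    then have "e \<in> E" "e \<subseteq> X" "e \<noteq> {}" using E_ne by (auto simp: edges_in_def)
    then show "e \<in> {e \<in> F W. e \<inter> Q \<noteq> {}}" using that fin(2) unfolding Q_def by (auto simp: edges_in_def)
  qed
  define B where "B = K1 \<union> {{u, v}} \<union> K2 \<union> F P' \<union> {{y', y}, {w, w'}}"
  define G where "G = K \<union> B"
  have e1: "{y', y} \<in> F W" "{w, w'} \<in> F W" using y'(1,3) yS fin w'(1,3) yw(2) by (auto simp: edges_in_def)
  have BQ: "B \<subseteq> {e \<in> F W. e \<inter> Q \<noteq> {}}"
  proof -
    have "K1 \<subseteq> F P" using h(6) by blast
    moreover have "{y', y} \<inter> Q \<noteq> {}" "{w, w'} \<inter> Q \<noteq> {}" using yw unfolding Q_def by auto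
    ultimately show ?thesis unfolding B_def using FQ[OF P(1)] FQ[OF P(2)] h(5,7) e1 by blast
  qed
  have KQ: "\<And>e. e \<in> K \<Longrightarrow> e \<inter> Q = {}" using K(1) unfolding Q_def by blast
  define A where "A = {b. conn K z b}"
  have AQ: "b \<notin> Q" if "b \<in> A" for b
  proof -
    have "b \<in> - Q"
      by (rule conn_closed[of K z b]) (use that z(2) KQ in \<open>auto simp: A_def Q_def\<close>)
    then show ?thesis by simp
  qed
  have cV: "c \<notin> V" using h(1) c by auto
  have VP: "b \<notin> P'" if "b \<in> V" for b using that h(1) P(3) cV by blast
  \<comment> \<open>Each kind of open edge is checked: those of \<open>K\<close> do not touch the
    ball, those of \<open>K2\<close> avoid \<open>V\<close>, those in \<open>P'\<close> avoid
    \<open>V\<close> because \<open>P\<close> and \<open>P'\<close> share at most the centre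
    \<open>c\<close>, which is not in \<open>S\<close>; and \<open>w'\<close> is not in
    \<open>A\<close>, being connected to \<open>x\<close> in \<open>K\<close>.\<close>
  have closed: "b' \<in> A \<union> V" if b: "b \<in> A \<union> V" "{b, b'} \<in> G - {{u, v}}" for b b'
  proof -
    consider "{b, b'} \<in> K" | "{b, b'} \<in> K1" | "{b, b'} \<in> K2" | "{b, b'} \<in> F P'" | "{b, b'} = {y', y}" | "{b, b'} = {w, w'}"
      using b(2) unfolding G_def B_def by blast
    then show ?thesis
    proof cases
      case 1
      then have "b \<notin> V" using KQ[OF 1] h(1) P(1) by auto
      then have "conn K z b" using b(1) by (simp add: A_def)
      then show ?thesis using conn_step[OF _ 1] by (simp add: A_def)
    next
      case 2
      then show ?thesis using h(6) by auto
    next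
      case 3
      then have "b \<notin> V" "b \<in> P" using h(7,8) by (auto simp: edges_in_def)
      then show ?thesis using b(1) AQ[of b] P(1) by auto
    next
      case 4
      then have "b \<in> P'" by (auto simp: edges_in_def)
      then show ?thesis using b(1) AQ[of b] VP[of b] P(2) by auto
    next
      case 5
      moreover have "y' \<in> A" using y'(4) unfolding A_def by (auto intro: conn_mono[rotated])
      ultimately show ?thesis using h(2) by (auto simp: doubleton_eq_iff)
    next
      case 6
      have "w \<notin> A \<union> V" using AQ[of w] VP[of w] P(2,5) by auto
      moreover have "w' \<notin> V" using w'(2) h(1) P(1) unfolding Q_def by auto
      moreover have "w' \<notin> A"
      proof
        assume "w' \<in> A"
        then have "conn K z x" using w'(4) conn_trans[of K z w' x] by (simp add: A_def)
        then show False using K(2) by simp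
      qed
      ultimately show ?thesis using b(1) 6 by (auto simp: doubleton_eq_iff)
    qed
  qed
  have "\<not> conn (G - {{u, v}}) z x"
  proof
    assume "conn (G - {{u, v}}) z x"
    then have "x \<in> A \<union> V" by (rule conn_closed) (use closed in \<open>auto simp: A_def\<close>)
    moreover have "x \<notin> V" using x h(1) P(1) unfolding Q_def by auto
    ultimately show False using K(2) by (simp add: A_def)
  qed
  moreover have zu: "conn (G \<inter> Pow S) z u"
  proof -
    have "conn (G \<inter> Pow S) z y'" using y'(4) by (rule conn_mono[rotated]) (auto simp: G_def)
    moreover have "{y', y} \<in> G \<inter> Pow S" using y'(1) yS by (auto simp: G_def B_def)
    moreover have "conn (G \<inter> Pow S) y u"
    proof (rule conn_mono[OF _ h(9)])
      have "K1 \<subseteq> Pow V" "Pow V \<subseteq> Pow S" using h(1,6) by auto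
      then show "K1 \<subseteq> G \<inter> Pow S" unfolding G_def B_def by blast
    qed
    ultimately show ?thesis by (blast intro: conn_trans[OF conn_step])
  qed
  moreover have uvG: "{u, v} \<in> G" by (simp add: G_def B_def)
  moreover have "conn G z x"
  proof -
    have 1: "conn G z u" using zu by (rule conn_mono[rotated]) auto
    have 2: "conn G v c" using h(10) by (rule conn_mono[rotated]) (auto simp: G_def B_def)
    have 3: "conn G c w" by (rule conn_sym, rule conn_mono[OF _ P(7)]) (auto simp: G_def B_def)
    have 4: "{w, w'} \<in> G" by (simp add: G_def B_def)
    have 5: "conn G w' x" using w'(4) by (rule conn_mono[rotated]) (auto simp: G_def)
    show ?thesis
      by (rule conn_trans[OF conn_step[OF conn_trans[OF conn_trans[OF conn_step[OF 1 uvG] 2] 3] 4] 5])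
  qed
  ultimately have "pivotal_exit S z x (u, v) (K \<union> B)" unfolding pivotal_exit_def G_def by simp
  moreover have "{u, v} \<in> F W" using BQ by (auto simp: B_def)
  ultimately show ?thesis using BQ vS unfolding Q_def
    by (intro exI[of _ B] exI[of _ u] exI[of _ v]) simp
qed

end

text \<open>Finite energy: given the configuration off \<open>F'\<close>, a prescribed state of its
  at most \<open>N\<close> edges has probability at least \<open>min p (1 - p) ^ N\<close>. The
  hypothesis \<open>down\<close> allows \<open>A\<close> to be tested on the configuration off
  \<open>F'\<close> alone.\<close>

lemma bpr_surgery:
  assumes "finite F" "0 < p" "p < 1" "F' \<subseteq> F" "card F' \<le> N"
    and down: "\<And>K. K \<subseteq> F \<Longrightarrow> A K \<Longrightarrow> A (K - F')"
    and ex: "\<And>K. K \<subseteq> F - F' \<Longrightarrow> A K \<Longrightarrow> \<exists>B\<subseteq>F'. D (K \<union> B)"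
  shows "min p (1 - p) ^ N * bpr p F A \<le> bpr p F D"
proof -
  define q where "q = min p (1 - p)"
  have q: "0 < q" "q \<le> 1" "q \<le> p" "q \<le> 1 - p" using assms(2,3) by (auto simp: q_def)
  have fin: "finite F'" "finite (F - F')" using assms finite_subset by auto
  have "bpr p F A \<le> bpr p F (\<lambda>K. A (K \<inter> (F - F')))"
  proof (rule bpr_mono)
    fix K assume K: "K \<subseteq> F" "A K"
    then have "K \<inter> (F - F') = K - F'" by auto
    then show "A (K \<inter> (F - F'))" using down[OF K] by simp
  qed (use assms in auto)
  also have "\<dots> = bpr p (F - F') (\<lambda>K. A (K \<inter> (F - F')))"
    unfolding bpr_def by (rule bex_restrict) (use assms in \<open>auto simp: Int_assoc\<close>)
  finally have 1: "bpr p F A \<le> bpr p (F - F') (\<lambda>K. A (K \<inter> (F - F')))" .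
  have "q ^ N * bpr p (F - F') (\<lambda>K. A (K \<inter> (F - F'))) =
      bex p (F - F') (\<lambda>K1. q ^ N * of_bool (A (K1 \<inter> (F - F'))))"
    by (simp only: bpr_def bex_cmult)
  also have "\<dots> \<le> bex p (F - F') (\<lambda>K1. bex p F' (\<lambda>K2. of_bool (D (K1 \<union> K2))))"
  proof (rule bex_mono)
    fix K1 assume K1: "K1 \<subseteq> F - F'"
    then have eq: "K1 \<inter> (F - F') = K1" by auto
    show "q ^ N * of_bool (A (K1 \<inter> (F - F'))) \<le> bex p F' (\<lambda>K2. of_bool (D (K1 \<union> K2)))"
    proof (cases "A K1")
      case True
      then obtain B where B: "B \<subseteq> F'" "D (K1 \<union> B)" using ex[OF K1] by blast
      have "card B + card (F' - B) = card F'"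
        using B(1) fin by (simp add: card_Diff_subset finite_subset card_mono)
      then have "q ^ N \<le> q ^ card B * q ^ card (F' - B)"
        unfolding power_add[symmetric] using q assms(5) by (intro power_decreasing) auto
      also have "\<dots> \<le> p ^ card B * (1 - p) ^ card (F' - B)"
        using q assms by (intro mult_mono power_mono) auto
      also have "\<dots> = p ^ card B * (1 - p) ^ card (F' - B) * of_bool (D (K1 \<union> B))" using B by simp
      also have "\<dots> \<le> bex p F' (\<lambda>K2. of_bool (D (K1 \<union> K2)))"
        unfolding bex_def
        by (rule member_le_sum[where f = "\<lambda>B. p ^ card B * (1 - p) ^ card (F' - B) * of_bool (D (K1 \<union> B))"])
          (use B fin assms in auto)
      finally show ?thesis using True eq by simp
    next
      case False
      then show ?thesis using eq assms by (simp add: bex_nonneg)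
    qed
  qed (use assms in auto)
  also have "\<dots> = bpr p F D"
  proof -
    have "bex p ((F - F') \<union> F') (\<lambda>K. of_bool (D K)) = bex p (F - F') (\<lambda>K1. bex p F' (\<lambda>K2. of_bool (D (K1 \<union> K2))))"
      using fin by (intro bex_Un) auto
    moreover have "(F - F') \<union> F' = F" using assms(4) by auto
    ultimately show ?thesis by (simp add: bpr_def)
  qed
  finally have "q ^ N * bpr p (F - F') (\<lambda>K. A (K \<inter> (F - F'))) \<le> bpr p F D" .
  moreover have "q ^ N * bpr p F A \<le> q ^ N * bpr p (F - F') (\<lambda>K. A (K \<inter> (F - F')))"
    using 1 q by (intro mult_left_mono) auto
  ultimately show ?thesis unfolding q_def by linarith
qed

context perc
begin

section \<open>Two separate arms arriving at a ball\<close>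

definition entry :: "(int ^ 'd) set \<Rightarrow> (int ^ 'd) set \<Rightarrow> int ^ 'd \<Rightarrow> int ^ 'd \<Rightarrow> (int ^ 'd) set set \<Rightarrow> bool"
  where "entry S Q z y K \<longleftrightarrow> (\<exists>y'\<in>S - Q. {y', y} \<in> E \<and> conn (K \<inter> Pow (S - Q)) z y')"

text \<open>All connections are looked for off \<open>Q\<close>, which leaves the edges at the ball
  free for the surgery; \<open>w \<noteq> y\<close> is what lets \<open>fan\<close> apply.\<close>

definition two_arms :: "(int ^ 'd) set \<Rightarrow> (int ^ 'd) set \<Rightarrow> (int ^ 'd) set \<Rightarrow> int ^ 'd \<Rightarrow> int ^ 'd \<Rightarrow> int ^ 'd \<Rightarrow> (int ^ 'd) set set \<Rightarrow> bool"
  where "two_arms W S Q z x y K \<longleftrightarrow> entry S Q z y K \<and> \<not> conn (K \<inter> Pow (W - Q)) z x \<and>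
    (\<exists>w w'. w \<in> Q \<and> w \<noteq> y \<and> w' \<in> W - Q \<and> {w, w'} \<in> E \<and> conn (K \<inter> Pow (W - Q)) w' x)"

definition exit_edges :: "(int ^ 'd) set \<Rightarrow> (int ^ 'd) set \<Rightarrow> ((int ^ 'd) \<times> (int ^ 'd)) set"
  where "exit_edges W S = {(u, v). u \<in> S \<and> v \<notin> S \<and> {u, v} \<in> F W}"

lemma finite_exit_edges: "finite W \<Longrightarrow> finite (exit_edges W S)"
  by (rule finite_subset[of _ "W \<times> W"]) (auto simp: exit_edges_def edges_in_def)

lemma entry_cong: "K \<inter> Pow (S - Q) = K' \<inter> Pow (S - Q) \<Longrightarrow> entry S Q z y K = entry S Q z y K'"
  by (simp add: entry_def)

lemma two_arms_surgery:
  assumes R: "1 \<le> R" and fin: "finite W" "jball c R \<subseteq> W" "S \<subseteq> W"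
    and z: "z \<in> S" "z \<notin> jball c R" and x: "x \<notin> jball c R" and c: "c \<notin> S"
    and y: "y \<in> S" "y \<in> jball c R" and N: "card {e \<in> F W. e \<inter> jball c R \<noteq> {}} \<le> N"
  shows "min p (1 - p) ^ N * Pr W (two_arms W S (jball c R) z x y) \<le>
    Pr W (\<lambda>K. \<exists>uv\<in>{uv \<in> exit_edges W S. fst uv \<in> jball c R}. pivotal_exit S z x uv K)"
proof (rule bpr_surgery[where F' = "{e \<in> F W. e \<inter> jball c R \<noteq> {}}", OF finite_edges_in[OF fin(1)] p01])
  let ?Q = "jball c R" and ?F = "{e \<in> F W. e \<inter> jball c R \<noteq> {}}"
  fix K assume K: "K \<subseteq> F W" and A: "two_arms W S ?Q z x y K"
  have "K \<inter> Pow (W - ?Q) = (K - ?F) \<inter> Pow (W - ?Q)" by auto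
  moreover have "K \<inter> Pow (S - ?Q) = (K - ?F) \<inter> Pow (S - ?Q)" by auto
  ultimately show "two_arms W S ?Q z x y (K - ?F)"
    using A entry_cong[of K S ?Q "K - ?F" z y] unfolding two_arms_def by simp
next
  let ?Q = "jball c R" and ?F = "{e \<in> F W. e \<inter> jball c R \<noteq> {}}"
  fix K assume K: "K \<subseteq> F W - ?F" and A: "two_arms W S ?Q z x y K"
  have KW: "K \<inter> Pow (W - ?Q) = K"
  proof
    show "K \<subseteq> K \<inter> Pow (W - ?Q)"
    proof
      fix e assume "e \<in> K"
      then have "e \<in> F W" "e \<inter> ?Q = {}" using K by auto
      then show "e \<in> K \<inter> Pow (W - ?Q)" using \<open>e \<in> K\<close> by (auto simp: edges_in_def)
    qed
  qed simp
  obtain y' where y': "y' \<in> S - ?Q" "{y', y} \<in> E" "conn (K \<inter> Pow (S - ?Q)) z y'"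
    using A unfolding two_arms_def entry_def by (elim exE conjE bexE)
  obtain w w' where w: "w \<in> ?Q" "w \<noteq> y" "w' \<in> W - ?Q" "{w, w'} \<in> E" "conn K w' x"
    using A unfolding two_arms_def KW by (elim exE conjE)
  have nx: "\<not> conn K z x" using A unfolding two_arms_def KW by simp
  have y'2: "conn (K \<inter> Pow S) z y'" by (rule conn_mono[OF _ y'(3)]) auto
  have KQ: "K \<subseteq> {e \<in> F W. e \<inter> ?Q = {}}" using K by auto
  from y'(1) w(3) have m: "y' \<in> S" "y' \<notin> ?Q" "w' \<in> W" "w' \<notin> ?Q" by auto
  obtain B u v where B: "B \<subseteq> ?F" "u \<in> S" "v \<notin> S" "u \<in> ?Q" "{u, v} \<in> F W" "pivotal_exit S z x (u, v) (K \<union> B)"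
    using surgery[OF R y(2) w(1) w(2)[symmetric] fin z x c y(1) m(1,2) y'(2) y'2 m(3,4) w(4,5) KQ nx]
    by (elim exE conjE)
  have "(u, v) \<in> {uv \<in> exit_edges W S. fst uv \<in> ?Q}" using B by (simp add: exit_edges_def)
  then show "\<exists>B\<subseteq>?F. \<exists>uv\<in>{uv \<in> exit_edges W S. fst uv \<in> ?Q}. pivotal_exit S z x uv (K \<union> B)"
    using B(1,6) by blast
qed (use N in auto)

text \<open>By \<open>pivotal_exit_unique\<close> at most one of the events occurs, and each of them
  forces \<open>z\<close> to be connected to \<open>x\<close>.\<close>

lemma pivotal_exit_sum:
  assumes "finite W" "z \<in> S" "z \<in> W"
  shows "(\<Sum>uv\<in>exit_edges W S. Pr W (pivotal_exit S z x uv)) \<le> t W z x"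
proof -
  have "(\<Sum>uv\<in>exit_edges W S. Pr W (pivotal_exit S z x uv)) =
      bex p (F W) (\<lambda>K. \<Sum>uv\<in>exit_edges W S. of_bool (pivotal_exit S z x uv K))"
    by (simp add: bpr_def bex_sum)
  also have "\<dots> \<le> bex p (F W) (\<lambda>K. of_bool (conn K z x))"
  proof (rule bex_mono[OF p_le])
    fix K
    show "(\<Sum>uv\<in>exit_edges W S. of_bool (pivotal_exit S z x uv K)) \<le> (of_bool (conn K z x) :: real)"
    proof (cases "\<exists>uv\<in>exit_edges W S. pivotal_exit S z x uv K")
      case True
      then obtain e where e: "e \<in> exit_edges W S" "pivotal_exit S z x e K" by blast
      have "(\<Sum>uv\<in>exit_edges W S. of_bool (pivotal_exit S z x uv K)) =
          (\<Sum>uv\<in>exit_edges W S. if uv = e then 1 else 0 :: real)"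
      proof (intro sum.cong refl)
        fix uv assume uv: "uv \<in> exit_edges W S"
        obtain u v u' v' where eq: "uv = (u, v)" "e = (u', v')" by (cases uv, cases e)
        have m: "u \<in> S" "v \<notin> S" "u' \<in> S" "v' \<notin> S" using uv e(1) eq by (simp_all add: exit_edges_def)
        have "uv = e" if "pivotal_exit S z x uv K"
          unfolding eq by (rule pivotal_exit_unique[of S z x u v K u' v']) (use that e(2) eq m assms(2) in simp_all)
        with e(2) have "pivotal_exit S z x uv K \<longleftrightarrow> uv = e" by blast
        then show "of_bool (pivotal_exit S z x uv K) = (if uv = e then 1 else 0 :: real)" by simp
      qed
      also have "\<dots> \<le> 1" using finite_exit_edges[OF assms(1)] by simp
      also have "conn K z x" using e(2) by (simp add: pivotal_exit_def split: prod.splits)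
      then have "1 = (of_bool (conn K z x) :: real)" by simp
      finally show ?thesis .
    next
      case False
      then have "(\<Sum>uv\<in>exit_edges W S. of_bool (pivotal_exit S z x uv K)) = (0 :: real)"
        by (intro sum.neutral) auto
      then show ?thesis by simp
    qed
  qed
  also have "\<dots> = t W z x" using bpr_conn[OF assms(3), of p E x] by (simp add: bpr_def)
  finally show ?thesis .
qed

text \<open>Reveal the cluster \<open>C K\<close> of \<open>z\<close> off \<open>Q\<close>. That it
  equals \<open>A\<close>, with an entry at \<open>y\<close>, depends only on edges touching
  \<open>A\<close>. The other edges are fresh, and with probability at least
  \<open>\<kappa> A\<close> they join the centre \<open>c\<close> to \<open>x\<close> off
  \<open>A\<close> and \<open>y\<close>, since each point \<open>v\<close> to be avoided costs at
  most \<open>H v\<close>. Averaging over \<open>A\<close> turns this cost into the sum over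
  \<open>v\<close> on the left.\<close>

lemma two_arms_lower:
  assumes fin: "finite W" "S \<subseteq> W" and z: "z \<in> S" "z \<notin> Q" and u: "u \<in> S" "u \<in> Q"
    and c: "c \<in> Q" "c \<notin> S" "c \<in> W" and x: "x \<in> W" "x \<notin> Q"
    and h: "\<And>y y'. y \<in> S \<inter> Q \<Longrightarrow> y' \<in> S - Q \<Longrightarrow> {y', y} \<in> E \<Longrightarrow> b * jd c y powr (2 - d) * (b * jd y x powr (2 - d)) \<le> \<eta>"
  shows "(t W c x - \<eta>) * t S z u -
      (\<Sum>v\<in>W - Q. b * jd c v powr (2 - d) * (b * jd v x powr (2 - d)) *
        Pr W (\<lambda>K. conn (K \<inter> Pow S) z u \<and> conn K z v))
    \<le> (\<Sum>y\<in>S \<inter> Q. Pr W (two_arms W S Q z x y))"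
proof -
  define C where "C K = {v. conn (K \<inter> Pow (W - Q)) z v}" for K
  define H where "H v = b * jd c v powr (2 - d) * (b * jd v x powr (2 - d))" for v
  define J where "J K \<longleftrightarrow> conn (K \<inter> Pow S) z u" for K
  define off where "off A y K \<longleftrightarrow> conn (K \<inter> Pow (W - insert y A)) c x" for A y K
  \<comment> \<open>Possible entry points have a neighbour outside \<open>Q\<close>. In the
    application they therefore lie near the rim of the ball, which makes the cost
    \<open>\<eta>\<close> of avoiding one of them small.\<close>
  define Y where "Y = {y \<in> S \<inter> Q. \<exists>y'\<in>S - Q. {y', y} \<in> E}"
  define \<kappa> where "\<kappa> A = t W c x - \<eta> - sum H A" for A
  have finS: "finite S" using fin finite_subset by auto
  have finY: "finite Y" using finS by (simp add: Y_def)
  have zW: "z \<in> W - Q" using z fin by auto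
  have CW: "C K \<subseteq> W - Q" for K unfolding C_def using conn_in_Pow[OF _ zW] by auto
  have H0: "0 \<le> H v" for v using ab by (simp add: H_def)
  have neF: "{} \<notin> F W" using E_ne by (simp add: edges_in_def)
  have indep: "Pr W (\<lambda>K. (C K = A \<and> entry S Q z y K) \<and> off A y K) =
      Pr W (\<lambda>K. C K = A \<and> entry S Q z y K) * Pr W (off A y)" for A y
    unfolding bpr_def of_bool_conj[of "_ \<and> _"]
  proof (rule bex_indep[where ?F1.0 = "{e \<in> F W. e \<inter> A \<noteq> {}}"])
    show "finite (F W)" by (rule finite_edges_in[OF fin(1)])
    fix K assume K: "K \<subseteq> F W"
    let ?F = "{e \<in> F W. e \<inter> A \<noteq> {}}"
    have "K \<inter> Pow (W - insert y A) = (K - ?F) \<inter> Pow (W - insert y A)" by auto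
    then show "of_bool (off A y K) = (of_bool (off A y (K - ?F)) :: real)" by (simp add: off_def)
    \<comment> \<open>Connections from \<open>z\<close> off \<open>Q\<close> use only edges inside
      its cluster, and these touch \<open>A\<close>.\<close>
    have comp: "conn (K \<inter> ?F \<inter> Pow X) z v" if "conn (K \<inter> Pow X) z v" "X \<subseteq> W - Q" "C K = A" for X v
    proof (rule conn_mono[OF _ conn_component[OF that(1)]])
      show "{e \<in> K \<inter> Pow X. e \<subseteq> {v. conn (K \<inter> Pow X) z v}} \<subseteq> K \<inter> ?F \<inter> Pow X"
      proof
        fix e assume e: "e \<in> {e \<in> K \<inter> Pow X. e \<subseteq> {v. conn (K \<inter> Pow X) z v}}"
        have "e \<subseteq> A"
        proof
          fix v' assume "v' \<in> e"
          then have "conn (K \<inter> Pow X) z v'" using e by auto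
          then have "conn (K \<inter> Pow (W - Q)) z v'" by (rule conn_mono[rotated]) (use that(2) in auto)
          then show "v' \<in> A" using that(3) by (auto simp: C_def)
        qed
        moreover have "e \<in> F W" "e \<noteq> {}" using e K neF by auto
        ultimately show "e \<in> K \<inter> ?F \<inter> Pow X" using e by auto
      qed
    qed
    have sub: "C (K \<inter> ?F) \<subseteq> C K" unfolding C_def by (auto intro: conn_mono[rotated])
    have eqA: "C K = A \<longleftrightarrow> C (K \<inter> ?F) = A"
    proof
      assume CK: "C K = A"
      then have "C K \<subseteq> C (K \<inter> ?F)" using comp[of "W - Q"] unfolding C_def by auto
      then show "C (K \<inter> ?F) = A" using sub CK by simp
    next
      assume CK: "C (K \<inter> ?F) = A"
      have "C K \<subseteq> A"
      proof
        fix v assume "v \<in> C K"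
        then have "conn (K \<inter> Pow (W - Q)) z v" by (simp add: C_def)
        then show "v \<in> A"
        proof (rule conn_closed)
          show "z \<in> A" using CK by (auto simp: C_def)
          fix v1 v2 assume v: "v1 \<in> A" "{v1, v2} \<in> K \<inter> Pow (W - Q)"
          then have e: "{v1, v2} \<in> K \<inter> ?F \<inter> Pow (W - Q)" using K by auto
          have "conn (K \<inter> ?F \<inter> Pow (W - Q)) z v1" using v(1) CK by (auto simp: C_def)
          from conn_step[OF this e] show "v2 \<in> A" using CK by (auto simp: C_def)
        qed
      qed
      then show "C K = A" using sub CK by simp
    qed
    have ent: "entry S Q z y K = entry S Q z y (K \<inter> ?F)" if CK: "C K = A"
    proof -
      have "conn (K \<inter> Pow (S - Q)) z v \<longleftrightarrow> conn (K \<inter> ?F \<inter> Pow (S - Q)) z v" for v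
        using comp[of "S - Q" v] CK fin(2) conn_mono[of "K \<inter> ?F \<inter> Pow (S - Q)" "K \<inter> Pow (S - Q)" z v] by auto
      then show ?thesis by (simp add: entry_def)
    qed
    have "(C K = A \<and> entry S Q z y K) \<longleftrightarrow> (C (K \<inter> ?F) = A \<and> entry S Q z y (K \<inter> ?F))"
      using eqA ent by blast
    then show "of_bool (C K = A \<and> entry S Q z y K) = (of_bool (C (K \<inter> ?F) = A \<and> entry S Q z y (K \<inter> ?F)) :: real)"
      by simp
  qed auto
  have off_lower: "max 0 (\<kappa> A) \<le> Pr W (off A y)" if A: "A \<subseteq> W - Q" and y: "y \<in> Y" for A y
  proof -
    have finA: "finite A" by (rule finite_subset[of _ W]) (use A fin in auto)
    have Aw: "insert y A \<subseteq> W" using A y fin by (auto simp: Y_def)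
    have "t W c x = Pr W (\<lambda>K. conn K c x)" using c(3) by (simp add: bpr_conn)
    also have "\<dots> \<le> Pr W (off A y) + Pr W (\<lambda>K. \<exists>v\<in>insert y A. disjointly (\<lambda>K. conn K c v) (\<lambda>K. conn K v x) K)"
    proof (rule bpr_disj_le[OF p_le])
      fix K assume K: "K \<subseteq> F W" "conn K c x"
      have finK: "finite K" using K(1) finite_edges_in[OF fin(1)] finite_subset by metis
      show "off A y K \<or> (\<exists>v\<in>insert y A. disjointly (\<lambda>K. conn K c v) (\<lambda>K. conn K v x) K)"
      proof (cases "conn {e \<in> K. e \<inter> insert y A = {}} c x")
        case True
        have "{e \<in> K. e \<inter> insert y A = {}} \<subseteq> K \<inter> Pow (W - insert y A)"
          using K(1) by (auto simp: edges_in_def)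
        then have "off A y K" unfolding off_def using True by (rule conn_mono)
        then show ?thesis ..
      next
        case False
        then show ?thesis by (intro disjI2 conn_through[OF finK K(2)]) simp
      qed
    qed
    also have "Pr W (\<lambda>K. \<exists>v\<in>insert y A. disjointly (\<lambda>K. conn K c v) (\<lambda>K. conn K v x) K) \<le>
        (\<Sum>v\<in>insert y A. Pr W (disjointly (\<lambda>K. conn K c v) (\<lambda>K. conn K v x)))"
      using finA by (intro bpr_Un_le p_le) auto
    also have "\<dots> \<le> (\<Sum>v\<in>insert y A. H v)"
      unfolding H_def using Aw c(3) by (intro sum_mono Pr_disjointly_le fin(1)) auto
    also have "\<dots> \<le> H y + sum H A"
      using finA H0[of y] by (simp add: sum.insert_if)
    also have "H y \<le> \<eta>" using y h unfolding H_def Y_def by blast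
    finally have "\<kappa> A \<le> Pr W (off A y)" by (simp add: \<kappa>_def)
    then show ?thesis using bpr_nonneg[OF p_le] by simp
  qed
  have arms: "(\<Sum>A\<in>Pow (W - Q). Pr W (\<lambda>K. (C K = A \<and> entry S Q z y K) \<and> off A y K)) \<le> Pr W (two_arms W S Q z x y)"
    if y: "y \<in> Y" for y
  proof -
    have "(\<Sum>A\<in>Pow (W - Q). Pr W (\<lambda>K. (C K = A \<and> entry S Q z y K) \<and> off A y K)) =
        bex p (F W) (\<lambda>K. \<Sum>A\<in>Pow (W - Q). of_bool ((C K = A \<and> entry S Q z y K) \<and> off A y K))"
      by (simp only: bpr_def bex_sum)
    also have "\<dots> \<le> bex p (F W) (\<lambda>K. of_bool (two_arms W S Q z x y K))"
    proof (rule bex_mono[OF p_le])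
      fix K assume K: "K \<subseteq> F W"
      have "(\<Sum>A\<in>Pow (W - Q). of_bool ((C K = A \<and> entry S Q z y K) \<and> off A y K)) =
          (\<Sum>A\<in>Pow (W - Q). if C K = A then of_bool (entry S Q z y K \<and> off (C K) y K) else 0 :: real)"
        by (intro sum.cong) auto
      also have "\<dots> = of_bool (entry S Q z y K \<and> off (C K) y K)"
        using fin(1) CW by (simp add: sum.delta)
      also have "\<dots> \<le> of_bool (two_arms W S Q z x y K)"
      proof -
        \<comment> \<open>The path from \<open>c\<close> to \<open>x\<close> leaves \<open>Q\<close>
          for the last time along an edge from \<open>w\<close> to \<open>w'\<close>. It avoids
          \<open>y\<close>, so \<open>w \<noteq> y\<close>, and it avoids the cluster of
          \<open>z\<close>, so \<open>x\<close> is not in that cluster.\<close>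
        have "two_arms W S Q z x y K" if e: "entry S Q z y K" and o: "off (C K) y K"
        proof -
          let ?K = "K \<inter> Pow (W - insert y (C K))"
          have cc: "c \<in> W - insert y (C K)" using c CW[of K] y by (auto simp: Y_def)
          have "conn ?K c x" using o by (simp add: off_def)
          then have xC: "x \<notin> C K" using conn_in_Pow[OF _ cc] by auto
          from \<open>conn ?K c x\<close> c(1) x(2) obtain w w' where w: "w \<in> Q" "w' \<notin> Q" "{w, w'} \<in> ?K"
            "conn {e \<in> ?K. e \<inter> Q = {}} w' x" by (rule conn_last_exit)
          have "{e \<in> ?K. e \<inter> Q = {}} \<subseteq> K \<inter> Pow (W - Q)" by auto
          then have "conn (K \<inter> Pow (W - Q)) w' x" using w(4) by (rule conn_mono)
          moreover have "w \<noteq> y" "w' \<in> W - Q" "{w, w'} \<in> E" using w K by (auto simp: edges_in_def)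
          moreover have "\<not> conn (K \<inter> Pow (W - Q)) z x" using xC by (simp add: C_def)
          ultimately show ?thesis unfolding two_arms_def using e w(1)
            by (intro conjI exI[of _ w] exI[of _ w'])
        qed
        then show ?thesis by auto
      qed
      finally show "(\<Sum>A\<in>Pow (W - Q). of_bool ((C K = A \<and> entry S Q z y K) \<and> off A y K)) \<le> (of_bool (two_arms W S Q z x y K) :: real)" .
    qed
    finally show ?thesis by (simp add: bpr_def)
  qed
  \<comment> \<open>A path in \<open>S\<close> from \<open>z\<close> to \<open>u\<close> must enter
    \<open>Q\<close>; the first point in \<open>Q\<close> is an entry point.\<close>
  have JY: "Pr W (\<lambda>K. C K = A \<and> J K) \<le> (\<Sum>y\<in>Y. Pr W (\<lambda>K. C K = A \<and> entry S Q z y K))" for A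
  proof (rule bpr_Un_le[OF p_le finY])
    fix K assume K: "K \<subseteq> F W" and j: "C K = A \<and> J K"
    have "finite (K \<inter> Pow S)" using K finite_edges_in[OF fin(1)] by (auto intro: finite_subset)
    from conn_exit[OF this, of z u "- Q"] j z u obtain y' y K1 where
      y: "y' \<in> - Q" "y \<notin> - Q" "{y', y} \<in> K \<inter> Pow S" "K1 \<subseteq> K \<inter> Pow S \<inter> Pow (- Q)" "conn K1 z y'"
      unfolding J_def by auto
    have "conn (K \<inter> Pow (S - Q)) z y'" by (rule conn_mono[OF _ y(5)]) (use y(4) in auto)
    moreover have m: "y' \<in> S - Q" "y \<in> S \<inter> Q" "{y', y} \<in> E" using y K by (auto simp: edges_in_def)
    ultimately have "entry S Q z y K" unfolding entry_def by blast
    moreover have "y \<in> Y" using m unfolding Y_def by blast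
    ultimately show "\<exists>y\<in>Y. C K = A \<and> entry S Q z y K" using j by blast
  qed
  have "(t W c x - \<eta>) * t S z u - (\<Sum>v\<in>W - Q. H v * Pr W (\<lambda>K. J K \<and> conn K z v)) \<le>
      (t W c x - \<eta>) * t S z u - (\<Sum>v\<in>W - Q. H v * Pr W (\<lambda>K. J K \<and> v \<in> C K))"
  proof (intro diff_left_mono sum_mono mult_left_mono H0 bpr_mono p_le)
    fix v K assume "J K \<and> v \<in> C K"
    then show "J K \<and> conn K z v" unfolding C_def by (auto intro: conn_mono[rotated])
  qed
  also have "\<dots> = bex p (F W) (\<lambda>K. of_bool (J K) * \<kappa> (C K))"
  proof -
    have "of_bool (J K) * \<kappa> (C K) = (t W c x - \<eta>) * of_bool (J K) - (\<Sum>v\<in>W - Q. H v * of_bool (J K \<and> v \<in> C K))" for K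
    proof -
      have "sum H (C K) = (\<Sum>v\<in>(W - Q) \<inter> C K. H v)" using CW[of K] by (simp add: Int_absorb1)
      also have "\<dots> = (\<Sum>v\<in>W - Q. H v * of_bool (v \<in> C K))"
        using fin(1) by (simp add: sum.inter_restrict of_bool_def if_distrib cong: if_cong)
      finally show ?thesis by (cases "J K") (simp_all add: \<kappa>_def)
    qed
    then have "bex p (F W) (\<lambda>K. of_bool (J K) * \<kappa> (C K)) =
        (t W c x - \<eta>) * Pr W J - (\<Sum>v\<in>W - Q. H v * Pr W (\<lambda>K. J K \<and> v \<in> C K))"
      by (simp only: bex_diff bex_cmult bex_sum bpr_def)
    moreover have "Pr W J = t S z u" unfolding J_def by (rule bpr_conn_subset[OF fin z(1)])
    ultimately show ?thesis by simp
  qed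
  also have "\<dots> = bex p (F W) (\<lambda>K. \<Sum>A\<in>Pow (W - Q). \<kappa> A * of_bool (C K = A \<and> J K))"
  proof (rule bex_cong)
    fix K
    have "(\<Sum>A\<in>Pow (W - Q). \<kappa> A * of_bool (C K = A \<and> J K)) =
        (\<Sum>A\<in>Pow (W - Q). if C K = A then of_bool (J K) * \<kappa> (C K) else 0)"
      by (intro sum.cong) auto
    also have "\<dots> = of_bool (J K) * \<kappa> (C K)" using fin(1) CW by (simp add: sum.delta)
    finally show "of_bool (J K) * \<kappa> (C K) = (\<Sum>A\<in>Pow (W - Q). \<kappa> A * of_bool (C K = A \<and> J K))" by simp
  qed
  also have "\<dots> = (\<Sum>A\<in>Pow (W - Q). \<kappa> A * Pr W (\<lambda>K. C K = A \<and> J K))"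
    by (simp only: bex_sum bex_cmult bpr_def)
  \<comment> \<open>\<open>\<kappa> A\<close> may be negative when \<open>A\<close> is large; only
    after truncation at 0 can it multiply the upper bound \<open>JY\<close>.\<close>
  also have "\<dots> \<le> (\<Sum>A\<in>Pow (W - Q). max 0 (\<kappa> A) * Pr W (\<lambda>K. C K = A \<and> J K))"
    by (intro sum_mono mult_right_mono bpr_nonneg p_le) simp
  also have "\<dots> \<le> (\<Sum>A\<in>Pow (W - Q). max 0 (\<kappa> A) * (\<Sum>y\<in>Y. Pr W (\<lambda>K. C K = A \<and> entry S Q z y K)))"
    by (intro sum_mono mult_left_mono JY) simp
  also have "\<dots> = (\<Sum>A\<in>Pow (W - Q). \<Sum>y\<in>Y. Pr W (\<lambda>K. C K = A \<and> entry S Q z y K) * max 0 (\<kappa> A))"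
    by (simp only: sum_distrib_left mult.commute)
  also have "\<dots> \<le> (\<Sum>A\<in>Pow (W - Q). \<Sum>y\<in>Y. Pr W (\<lambda>K. C K = A \<and> entry S Q z y K) * Pr W (off A y))"
    by (intro sum_mono mult_left_mono off_lower bpr_nonneg p_le) auto
  also have "\<dots> = (\<Sum>A\<in>Pow (W - Q). \<Sum>y\<in>Y. Pr W (\<lambda>K. (C K = A \<and> entry S Q z y K) \<and> off A y K))"
    by (simp only: indep)
  also have "\<dots> = (\<Sum>y\<in>Y. \<Sum>A\<in>Pow (W - Q). Pr W (\<lambda>K. (C K = A \<and> entry S Q z y K) \<and> off A y K))"
    by (rule sum.swap)
  also have "\<dots> \<le> (\<Sum>y\<in>Y. Pr W (two_arms W S Q z x y))"
    by (intro sum_mono arms)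
  also have "\<dots> \<le> (\<Sum>y\<in>S \<inter> Q. Pr W (two_arms W S Q z x y))"
    using finS by (intro sum_mono2 bpr_nonneg p_le) (auto simp: Y_def)
  finally show ?thesis unfolding J_def H_def .
qed


subsection \<open>The uniform bound\<close>

lemma tau_le_1: "finite S \<Longrightarrow> t S x y \<le> 1"
  unfolding tau_def by (intro bpr_le_1 finite_edges_in p_le)

lemma far_point: "\<exists>x. M \<le> jd z x" for z :: "int ^ 'd"
proof -
  obtain i :: 'd where True by simp
  define x where "x = upd z i (z $ i + \<lceil>M\<rceil>)"
  have "\<lceil>M\<rceil> \<le> \<bar>(z - x) $ i\<bar>" by (simp add: x_def)
  also have "\<dots> \<le> linf_norm (z - x)" by (rule abs_le_linf_norm)
  finally have "M \<le> real_of_int (linf_norm (z - x))" by linarith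
  then show ?thesis unfolding jd_def by (intro exI[of _ x]) linarith
qed

text \<open>The count is bounded independently of \<open>W\<close> and of the centre, so the price
  of a surgery does not depend on \<open>S\<close>.\<close>

lemma card_touching_edges:
  fixes c :: "int ^ 'd"
  assumes "1 \<le> R"
  shows "real (card {e \<in> F W. e \<inter> jball c R \<noteq> {}}) \<le> ((3 * (R + L)) powr d)\<^sup>2"
proof -
  define B where "B = jball c (R + L)"
  have "{e \<in> F W. e \<inter> jball c R \<noteq> {}} \<subseteq> (\<lambda>(x, y). {x, y}) ` (B \<times> B)"
  proof
    fix e assume e: "e \<in> {e \<in> F W. e \<inter> jball c R \<noteq> {}}"
    then have eE: "e \<in> E" "e \<inter> jball c R \<noteq> {}" by (auto simp: edges_in_def)
    then have "e \<subseteq> B" unfolding B_def by (rule edge_jball)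
    moreover obtain x y where "e = {x, y}" using E_form[OF eE(1)] by blast
    ultimately show "e \<in> (\<lambda>(x, y). {x, y}) ` (B \<times> B)" by (intro image_eqI[of _ _ "(x, y)"]) auto
  qed
  then have "card {e \<in> F W. e \<inter> jball c R \<noteq> {}} \<le> card ((\<lambda>(x, y). {x, y}) ` (B \<times> B))"
    by (rule card_mono[rotated]) (simp add: B_def)
  also have "\<dots> \<le> card (B \<times> B)" by (rule card_image_le) (simp add: B_def)
  also have "\<dots> = (card B)\<^sup>2" by (simp add: card_cartesian_product power2_eq_square)
  finally have "real (card {e \<in> F W. e \<inter> jball c R \<noteq> {}}) \<le> real ((card B)\<^sup>2)" by (rule of_nat_mono)
  also have "\<dots> = (real (card B))\<^sup>2" by simp
  also have "\<dots> \<le> ((3 * (R + L)) powr d)\<^sup>2"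
    using card_jball[of "R + L" c] assms ab by (intro power_mono) (auto simp: B_def d_eq)
  finally show ?thesis .
qed

text \<open>The lower bound of \<open>two_arms_lower\<close> and the upper bound of
  \<open>pivotal_exit_sum\<close> are both proportional to \<open>g\<close>, the order of the
  two-point function from \<open>z\<close> to \<open>x\<close>. It cancels, so \<open>x\<close> may
  be as far away as \<open>S\<close> requires without affecting the constant.\<close>

lemma uniform_bound:
  obtains C where "0 < C" "\<And>S z. finite S \<Longrightarrow> z \<in> S \<Longrightarrow> phi_in S z \<le> C"
proof -
  obtain C0 where C0: "0 < C0" "\<And>W S x n. finite W \<Longrightarrow> S \<subseteq> W \<Longrightarrow> x \<in> S \<Longrightarrow>
    joint W S x (4 ^ n) \<le> C0 * 2 ^ (9 * n) * phi_in S x"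
    by (rule joint_bound) auto
  obtain Cv where Cv: "0 < Cv" "\<And>(y :: int ^ 'd) u A. finite A \<Longrightarrow>
        (\<Sum>z\<in>A. jd y z powr (2 - d) * jd z u powr - (d - 2)) \<le> Cv * jd y u powr (2 - (d - 2))"
    by (rule convolution[where 'd = 'd, of "d - 2", folded d_eq]) (use d7 in auto)
  define k2 k4 a1 where "k2 = 2 powr (d - 2)" and "k4 = 4 powr (d - 2)" and "a1 = a / k2"
  have k: "0 < k2" "0 < k4" "0 < a1" using ab by (auto simp: k2_def k4_def a1_def)
  \<comment> \<open>The first entry makes \<open>R\<close> large against the edge length; the second
    bounds the loss from cluster points outside the ball, and the third that from the entry point,
    each by a quarter of the main term.\<close>
  define M0 where "M0 = max L (max (4 * b\<^sup>2 * k2 * k4 * 2 ^ 10 * C0 / a1) (4 * b\<^sup>2 * k2\<^sup>2 / a1))"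
  obtain m where m: "M0 < 2 ^ m" using real_arch_pow[of 2 M0] by auto
  define R :: real where "R = 4 * 4 ^ m"
  have "(2::real) ^ m \<le> 4 ^ m" by (intro power_mono) auto
  then have m4: "L \<le> 4 ^ m" "4 * b\<^sup>2 * k2\<^sup>2 / a1 \<le> 4 ^ m" using m by (auto simp: M0_def)
  have m2: "b\<^sup>2 * k2 * k4 * (2 ^ 10 * C0 / 2 ^ m) \<le> a1 / 4"
  proof -
    have "4 * b\<^sup>2 * k2 * k4 * 2 ^ 10 * C0 / a1 \<le> 2 ^ m" using m by (simp add: M0_def)
    then have "4 * b\<^sup>2 * k2 * k4 * 2 ^ 10 * C0 \<le> 2 ^ m * a1" using k by (simp add: divide_le_eq)
    then show ?thesis by (simp add: field_simps)
  qed
  have R: "1 \<le> R" "4 * L \<le> R" "4 * b\<^sup>2 * k2\<^sup>2 / a1 \<le> R" using m4 ab by (auto simp: R_def)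
  define V where "V = (3 * (R + L)) powr d"
  have V0: "0 < V" using R ab by (simp add: V_def)
  define N where "N = nat \<lceil>V\<^sup>2\<rceil>"
  define q where "q = min p (1 - p)"
  have q: "0 < q" using p01 by (simp add: q_def)
  \<comment> \<open>Found by solving the last inequality of the proof for \<open>\<phi>\<close>. The
    three terms come from the price of the surgery, from cluster points close to \<open>x\<close>,
    and from boundary points whose ball contains \<open>z\<close>.\<close>
  define C where "C = 2 / a1 * (V\<^sup>2 * b / q ^ N + 1 + 3 / 4 * a1 * V)"
  have "phi_in S z \<le> C" if finS: "finite S" and zS: "z \<in> S" for S and z :: "int ^ 'd"
  proof -
    define \<phi> where "\<phi> = phi_in S z"
    have \<phi>0: "0 \<le> \<phi>" by (simp add: \<phi>_def phi_in_nonneg)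
    have finbd: "finite (bd S)" by (rule finite_bd[OF finS])
    \<comment> \<open>A neighbour of \<open>u\<close> outside \<open>S\<close>, chosen as the centre
      of the ball at \<open>u\<close>.\<close>
    define v where "v u = (SOME v. v \<notin> S \<and> {u, v} \<in> E)" for u
    have v: "v u \<notin> S" "{u, v u} \<in> E" if "u \<in> bd S" for u
    proof -
      have "\<exists>v. v \<notin> S \<and> {u, v} \<in> E" using that by (simp add: inner_boundary_def)
      from someI_ex[OF this] show "v u \<notin> S" "{u, v u} \<in> E" by (simp_all add: v_def)
    qed
    have uv: "jd u (v u) \<le> L" if "u \<in> bd S" for u using E_edge[OF v(2)[OF that]] by simp
    define Q where "Q u = jball (v u) R" for u
    have "finite (insert 1 (jd z ` (S \<union> v ` bd S)))" using finS finbd by simp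
    then obtain \<rho> where \<rho>: "1 \<le> \<rho>" "\<And>y. y \<in> S \<Longrightarrow> jd z y \<le> \<rho>" "\<And>u. u \<in> bd S \<Longrightarrow> jd z (v u) \<le> \<rho>"
      using bdd_above_finite[of "insert 1 (jd z ` (S \<union> v ` bd S))"] unfolding bdd_above_def by auto
    define K3 where "K3 = real (card (bd S)) * (b\<^sup>2 * k2 * (b * Cv))"
    have K3: "0 \<le> K3" using ab k Cv by (simp add: K3_def)
    \<comment> \<open>The distance may depend on \<open>S\<close>: \<open>K3\<close> contains the
      number of boundary points, and beyond \<open>8 * \<rho>\<close> all points of \<open>S\<close>
      and all centres are about equally far from \<open>x\<close>.\<close>
    obtain x where x: "8 * \<rho> + 2 * R + K3 \<le> jd z x" using far_point by blast
    define n where "n = jd z x"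
    have n: "8 * \<rho> \<le> n" "2 * R \<le> n" "K3 \<le> n" "2 * R + \<rho> \<le> n" "1 \<le> n"
      using x \<rho>(1) R(1) K3 unfolding n_def by auto
    define g where "g = n powr (2 - d)"
    have g0: "0 < g" using n by (simp add: g_def)
    have "\<forall>u. \<exists>W0. finite W0 \<and> (\<forall>W. finite W \<longrightarrow> W0 \<subseteq> W \<longrightarrow> a * jd (v u) x powr (2 - d) \<le> t W (v u) x)"
      using lower by blast
    from choice[OF this] obtain W0 where W0: "\<And>u. finite (W0 u)"
      "\<And>u W. finite W \<Longrightarrow> W0 u \<subseteq> W \<Longrightarrow> a * jd (v u) x powr (2 - d) \<le> t W (v u) x" by auto
    define W where "W = S \<union> (\<Union>u\<in>bd S. Q u \<union> W0 u) \<union> {x}"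
    have W: "finite W" "S \<subseteq> W" "x \<in> W" "z \<in> W" "\<And>u. u \<in> bd S \<Longrightarrow> Q u \<subseteq> W" "\<And>u. u \<in> bd S \<Longrightarrow> W0 u \<subseteq> W"
      using finS finbd W0(1) zS by (auto simp: W_def Q_def)
    define J where "J u y = Pr W (\<lambda>K. conn (K \<inter> Pow S) z u \<and> conn K z y)" for u y
    have J0: "0 \<le> J u y" for u y unfolding J_def by (intro bpr_nonneg p_le)
    have vx: "jd (v u) x \<le> 2 * n" "n - \<rho> \<le> jd (v u) x" if "u \<in> bd S" for u
      using jd_triangle[of "v u" x z] jd_triangle[of z x "v u"] \<rho>(3)[OF that] n \<rho>(1)
      by (auto simp: n_def jd_sym[of _ z])
    have xQ: "x \<notin> Q u" if "u \<in> bd S" for u using vx[OF that] n R by (simp add: Q_def mem_jball)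
    have uQ: "u \<in> Q u" if "u \<in> bd S" for u using uv[OF that] R ab by (simp add: Q_def mem_jball jd_sym)
    have vQ: "v u \<in> Q u" for u using R by (simp add: Q_def mem_jball)
    have lowt: "a1 * g \<le> t W (v u) x" if u: "u \<in> bd S" for u
    proof -
      have "a1 * g = a * (2 * n) powr (2 - d)"
        using n by (simp add: a1_def g_def k2_def powr_mult powr_diff field_simps)
      also have "\<dots> \<le> a * jd (v u) x powr (2 - d)"
        using vx[OF u] ab d7 by (intro mult_left_mono powr_mono2') auto
      also have "\<dots> \<le> t W (v u) x" using W u by (intro W0(2))
      finally show ?thesis .
    qed
    define \<eta> where "\<eta> = a1 / 4 * g"
    \<comment> \<open>An entry point is within one edge of the outside of the ball, hence at
      distance at least \<open>R / 2\<close> from the centre; a detour through it costs order g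
      R^(2-d), at most g / R up to constants.\<close>
    have \<eta>: "b * jd (v u) y powr (2 - d) * (b * jd y x powr (2 - d)) \<le> \<eta>"
      if u: "u \<in> bd S" and y: "y \<in> S \<inter> Q u" "y' \<in> S - Q u" "{y', y} \<in> E" for u y y'
    proof -
      have "R < jd (v u) y'" using y(2) by (simp add: Q_def mem_jball)
      then have "R / 2 \<le> jd (v u) y"
        using jd_triangle[of "v u" y' y] E_edge[OF y(3)] R ab by (simp add: jd_sym[of y y'])
      then have 1: "jd (v u) y powr (2 - d) \<le> k2 * R powr (2 - d)" unfolding k2_def using R by (intro half_powr) auto
      have "n / 2 \<le> jd y x" using jd_triangle[of z x y] \<rho>(2)[of y] y(1) n \<rho>(1) by (simp add: n_def)
      then have 2: "jd y x powr (2 - d) \<le> k2 * g" unfolding k2_def g_def using n by (intro half_powr) auto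
      have "R powr (2 - d) \<le> R powr (- 1)" using R d7 by (intro powr_mono) auto
      also have "\<dots> = 1 / R" using R by (simp add: powr_minus_divide)
      finally have 3: "R powr (2 - d) \<le> 1 / R" .
      have "b * jd (v u) y powr (2 - d) * (b * jd y x powr (2 - d)) \<le> b * (k2 * (1 / R)) * (b * (k2 * g))"
      proof (intro mult_mono)
        have "k2 * R powr (2 - d) \<le> k2 * (1 / R)" using 3 k by (intro mult_left_mono) auto
        then show "jd (v u) y powr (2 - d) \<le> k2 * (1 / R)" using 1 by linarith
      qed (use 2 ab k R g0 in auto)
      also have "\<dots> = b\<^sup>2 * k2\<^sup>2 / R * g" by (simp add: power2_eq_square)
      also have "\<dots> \<le> a1 / 4 * g"
      proof (rule mult_right_mono)
        have "4 * b\<^sup>2 * k2\<^sup>2 \<le> R * a1" using R(3) k by (simp add: divide_le_eq)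
        then show "b\<^sup>2 * k2\<^sup>2 / R \<le> a1 / 4" using R(1) by (simp add: field_simps)
      qed (use g0 in simp)
      finally show ?thesis by (simp add: \<eta>_def)
    qed
    define U where "U = {u \<in> bd S. z \<notin> Q u}"
    have U: "U \<subseteq> bd S" "finite U" using finbd by (auto simp: U_def)
    \<comment> \<open>Points \<open>y\<close> at distance at least \<open>n / 4\<close> from
      \<open>x\<close> contribute a factor of order \<open>g\<close> and are summed later by the
      volume bound. For \<open>y\<close> nearer to \<open>x\<close>, \<open>J u y\<close> is
      replaced by the two-point function from \<open>z\<close>, and a convolution gives order
      n^(4-d), at most 1/n.\<close>
    have err: "(\<Sum>y\<in>W - Q u. b * jd (v u) y powr (2 - d) * (b * jd y x powr (2 - d)) * J u y) \<le>
        b\<^sup>2 * k2 * k4 * g * (\<Sum>y\<in>W - jball u (4 ^ m). J u y * jd y u powr (2 - d)) + b\<^sup>2 * k2 * (b * Cv) * g / n"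
      if u: "u \<in> bd S" for u
    proof -
      have far: "4 ^ m < jd u y \<and> jd y u / 2 \<le> jd (v u) y" if "y \<notin> Q u" for y
      proof -
        have "R < jd (v u) y" using that by (simp add: Q_def mem_jball)
        moreover have "jd (v u) y \<le> L + jd u y" using jd_triangle[of "v u" y u] uv[OF u] by (simp add: jd_sym[of "v u" u])
        moreover have "jd u y \<le> L + jd (v u) y" using jd_triangle[of u y "v u"] uv[OF u] by simp
        moreover have "0 < (4::real) ^ m" by simp
        ultimately show ?thesis using R(2) m4(1) by (simp add: jd_sym[of y u] R_def)
      qed
      have pt: "b * jd (v u) y powr (2 - d) * (b * jd y x powr (2 - d)) * J u y \<le>
          b\<^sup>2 * k2 * k4 * g * (J u y * jd y u powr (2 - d)) + b\<^sup>2 * k2 * g * (b * (jd z y powr (2 - d) * jd y x powr - (d - 2)))"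
        if y: "y \<in> W - Q u" for y
      proof (cases "n / 4 \<le> jd y x")
        case True
        have 1: "jd (v u) y powr (2 - d) \<le> k2 * jd y u powr (2 - d)"
          unfolding k2_def using far[of y] y by (intro half_powr) auto
        have "jd y x powr (2 - d) \<le> (n / 4) powr (2 - d)" using True n d7 by (intro powr_mono2') auto
        also have "\<dots> = k4 * g" using n by (simp add: k4_def g_def powr_divide powr_diff field_simps)
        finally have 2: "jd y x powr (2 - d) \<le> k4 * g" .
        have "b * jd (v u) y powr (2 - d) * (b * jd y x powr (2 - d)) * J u y \<le>
            b * (k2 * jd y u powr (2 - d)) * (b * (k4 * g)) * J u y"
          using 1 2 ab k g0 J0 by (intro mult_mono) auto
        also have "\<dots> = b\<^sup>2 * k2 * k4 * g * (J u y * jd y u powr (2 - d))" by (simp add: power2_eq_square)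
        moreover have "0 \<le> b\<^sup>2 * k2 * g * (b * (jd z y powr (2 - d) * jd y x powr - (d - 2)))" using ab k g0 by simp
        ultimately show ?thesis by linarith
      next
        case False
        have "n / 2 \<le> jd (v u) y"
          using jd_triangle[of "v u" x y] vx(2)[OF u] False n \<rho>(1) by simp
        then have 1: "jd (v u) y powr (2 - d) \<le> k2 * g" unfolding k2_def g_def using n by (intro half_powr) auto
        have 2: "J u y \<le> b * jd z y powr (2 - d)"
        proof -
          have "J u y \<le> Pr W (\<lambda>K. conn K z y)" unfolding J_def by (intro bpr_mono p_le) simp
          also have "\<dots> \<le> b * jd z y powr (2 - d)" by (rule Pr_conn_le[OF W(1,4)])
          finally show ?thesis .
        qed
        have "b * jd (v u) y powr (2 - d) * (b * jd y x powr (2 - d)) * J u y \<le>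
            b * (k2 * g) * (b * jd y x powr (2 - d)) * (b * jd z y powr (2 - d))"
          using 1 2 ab k g0 J0 by (intro mult_mono) auto
        also have "\<dots> = b\<^sup>2 * k2 * g * (b * (jd z y powr (2 - d) * jd y x powr - (d - 2)))"
          by (simp add: power2_eq_square)
        moreover have "0 \<le> b\<^sup>2 * k2 * k4 * g * (J u y * jd y u powr (2 - d))" using ab k g0 J0 by simp
        ultimately show ?thesis by linarith
      qed
      have "(\<Sum>y\<in>W - Q u. b * jd (v u) y powr (2 - d) * (b * jd y x powr (2 - d)) * J u y) \<le>
          (\<Sum>y\<in>W - Q u. b\<^sup>2 * k2 * k4 * g * (J u y * jd y u powr (2 - d)) + b\<^sup>2 * k2 * g * (b * (jd z y powr (2 - d) * jd y x powr - (d - 2))))"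
        by (intro sum_mono pt)
      also have "\<dots> = b\<^sup>2 * k2 * k4 * g * (\<Sum>y\<in>W - Q u. J u y * jd y u powr (2 - d)) +
          b\<^sup>2 * k2 * g * (b * (\<Sum>y\<in>W - Q u. jd z y powr (2 - d) * jd y x powr - (d - 2)))"
        by (simp only: sum.distrib sum_distrib_left)
      also have "\<dots> \<le> b\<^sup>2 * k2 * k4 * g * (\<Sum>y\<in>W - jball u (4 ^ m). J u y * jd y u powr (2 - d)) +
          b\<^sup>2 * k2 * g * (b * (Cv * n powr (2 - (d - 2))))"
      proof (rule add_mono)
        show "b\<^sup>2 * k2 * k4 * g * (\<Sum>y\<in>W - Q u. J u y * jd y u powr (2 - d)) \<le>
          b\<^sup>2 * k2 * k4 * g * (\<Sum>y\<in>W - jball u (4 ^ m). J u y * jd y u powr (2 - d))"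
        proof (intro mult_left_mono sum_mono2)
          show "W - Q u \<subseteq> W - jball u (4 ^ m)"
          proof
            fix y assume "y \<in> W - Q u"
            then show "y \<in> W - jball u (4 ^ m)" using far[of y] by (simp add: mem_jball)
          qed
        qed (use W(1) J0 ab k g0 in auto)
        show "b\<^sup>2 * k2 * g * (b * (\<Sum>y\<in>W - Q u. jd z y powr (2 - d) * jd y x powr - (d - 2))) \<le>
          b\<^sup>2 * k2 * g * (b * (Cv * n powr (2 - (d - 2))))"
          unfolding n_def using W(1) ab k g0 by (intro mult_left_mono Cv(2)) auto
      qed
      also have "n powr (2 - (d - 2)) \<le> n powr (- 1)" using n d7 by (intro powr_mono) auto
      also have "n powr (- 1) = 1 / n" using n by (simp add: powr_minus_divide)
      finally show ?thesis using ab k g0 Cv by (simp add: mult_ac)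
    qed
    have lowU: "(\<Sum>u\<in>U. 3 / 4 * a1 * g * t S z u) - (a1 / 4 * g * \<phi> + g) \<le> (\<Sum>u\<in>U. \<Sum>y\<in>S \<inter> Q u. Pr W (two_arms W S (Q u) z x y))"
    proof -
      have "(\<Sum>u\<in>U. 3 / 4 * a1 * g * t S z u - (\<Sum>y\<in>W - Q u. b * jd (v u) y powr (2 - d) * (b * jd y x powr (2 - d)) * J u y))
          \<le> (\<Sum>u\<in>U. \<Sum>y\<in>S \<inter> Q u. Pr W (two_arms W S (Q u) z x y))"
      proof (rule sum_mono)
        fix u assume "u \<in> U"
        then have u: "u \<in> bd S" "z \<notin> Q u" "u \<in> S" by (auto simp: U_def inner_boundary_def)
        have "(t W (v u) x - \<eta>) * t S z u - (\<Sum>y\<in>W - Q u. b * jd (v u) y powr (2 - d) * (b * jd y x powr (2 - d)) * J u y)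
          \<le> (\<Sum>y\<in>S \<inter> Q u. Pr W (two_arms W S (Q u) z x y))"
          unfolding J_def using W u zS uQ vQ[of u] v(1) xQ \<eta>[OF u(1)]
          by (intro two_arms_lower) auto
        moreover have "3 / 4 * a1 * g * t S z u \<le> (t W (v u) x - \<eta>) * t S z u"
          using lowt[OF u(1)] by (intro mult_right_mono t_nonneg) (simp add: \<eta>_def)
        ultimately show "3 / 4 * a1 * g * t S z u - (\<Sum>y\<in>W - Q u. b * jd (v u) y powr (2 - d) * (b * jd y x powr (2 - d)) * J u y)
          \<le> (\<Sum>y\<in>S \<inter> Q u. Pr W (two_arms W S (Q u) z x y))" by linarith
      qed
      moreover have "(\<Sum>u\<in>U. \<Sum>y\<in>W - Q u. b * jd (v u) y powr (2 - d) * (b * jd y x powr (2 - d)) * J u y) \<le> a1 / 4 * g * \<phi> + g"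
      proof -
        have "(\<Sum>u\<in>U. \<Sum>y\<in>W - Q u. b * jd (v u) y powr (2 - d) * (b * jd y x powr (2 - d)) * J u y) \<le>
            (\<Sum>u\<in>bd S. \<Sum>y\<in>W - Q u. b * jd (v u) y powr (2 - d) * (b * jd y x powr (2 - d)) * J u y)"
          using finbd U ab J0 by (intro sum_mono2 sum_nonneg mult_nonneg_nonneg) auto
        also have "\<dots> \<le> (\<Sum>u\<in>bd S. b\<^sup>2 * k2 * k4 * g * (\<Sum>y\<in>W - jball u (4 ^ m). J u y * jd y u powr (2 - d)) + b\<^sup>2 * k2 * (b * Cv) * g / n)"
          by (intro sum_mono err)
        also have "\<dots> = b\<^sup>2 * k2 * k4 * g * (\<Sum>u\<in>bd S. \<Sum>y\<in>W - jball u (4 ^ m). J u y * jd y u powr (2 - d)) + K3 * g / n"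
          by (simp add: sum.distrib sum_distrib_left K3_def)
        also have "\<dots> \<le> b\<^sup>2 * k2 * k4 * g * (2 ^ 10 * (C0 * \<phi>) / 2 ^ m) + g"
        proof (rule add_mono)
          have "(\<Sum>u\<in>bd S. \<Sum>y\<in>W - jball u (4 ^ m). J u y * jd y u powr (2 - d)) \<le> 2 ^ 10 * (C0 * \<phi>) / 2 ^ m"
          proof (rule tail_iterate[OF finbd W(1) J0])
            show "0 \<le> C0 * \<phi>" using C0 \<phi>0 by simp
            fix n
            show "(\<Sum>u\<in>bd S. \<Sum>y\<in>W \<inter> jball u (4 ^ n). J u y) \<le> C0 * \<phi> * 2 ^ (9 * n)"
              using C0(2)[OF W(1,2) zS, of n] unfolding joint_def J_def \<phi>_def by (simp add: mult_ac)
          qed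
          then show "b\<^sup>2 * k2 * k4 * g * (\<Sum>u\<in>bd S. \<Sum>y\<in>W - jball u (4 ^ m). J u y * jd y u powr (2 - d)) \<le>
             b\<^sup>2 * k2 * k4 * g * (2 ^ 10 * (C0 * \<phi>) / 2 ^ m)"
            using k g0 by (intro mult_left_mono) auto
          have "K3 * g \<le> n * g" using n(3) g0 by (intro mult_right_mono) auto
          then show "K3 * g / n \<le> g" using n(5) by (simp add: divide_le_eq mult.commute)
        qed
        also have "b\<^sup>2 * k2 * k4 * g * (2 ^ 10 * (C0 * \<phi>) / 2 ^ m) = b\<^sup>2 * k2 * k4 * (2 ^ 10 * C0 / 2 ^ m) * (g * \<phi>)" by simp
        also have "\<dots> \<le> a1 / 4 * (g * \<phi>)" using m2 g0 \<phi>0 by (intro mult_right_mono) auto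
        finally show ?thesis by simp
      qed
      ultimately show ?thesis by (simp add: sum_subtractf)
    qed
    have VR: "(3 * R) powr d \<le> V" unfolding V_def using R ab d7 by (intro powr_mono2) auto
    \<comment> \<open>Each exit edge is counted for at most \<open>V\<close> boundary points
      \<open>u\<close>, and each of these for at most \<open>V\<close> entry points
      \<open>y\<close>; this gives the factor \<open>V\<^sup>2\<close>.\<close>
    have upU: "(\<Sum>u\<in>U. \<Sum>y\<in>S \<inter> Q u. q ^ N * Pr W (two_arms W S (Q u) z x y)) \<le> V\<^sup>2 * (b * g)"
    proof -
      define X where "X = exit_edges W S"
      have finX: "finite X" unfolding X_def by (rule finite_exit_edges[OF W(1)])
      define P where "P e = Pr W (pivotal_exit S z x e)" for e
      have P0: "0 \<le> P e" for e unfolding P_def by (intro bpr_nonneg p_le)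
      have one: "q ^ N * Pr W (two_arms W S (Q u) z x y) \<le> (\<Sum>e\<in>X. of_bool (fst e \<in> Q u) * P e)"
        if "u \<in> U" "y \<in> S \<inter> Q u" for u y
      proof -
        have u: "u \<in> bd S" "z \<notin> Q u" using that by (auto simp: U_def)
        have "real (card {e \<in> F W. e \<inter> Q u \<noteq> {}}) \<le> V\<^sup>2"
          unfolding Q_def V_def by (rule card_touching_edges[OF R(1)])
        then have cN: "card {e \<in> F W. e \<inter> Q u \<noteq> {}} \<le> N" unfolding N_def by linarith
        have "q ^ N * Pr W (two_arms W S (Q u) z x y) \<le>
            Pr W (\<lambda>K. \<exists>e\<in>{e \<in> X. fst e \<in> Q u}. pivotal_exit S z x e K)"
          unfolding q_def Q_def X_def
          by (rule two_arms_surgery) (use R W u zS xQ[OF u(1)] v(1)[OF u(1)] that(2) cN in \<open>auto simp: Q_def\<close>)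
        also have "\<dots> \<le> (\<Sum>e\<in>{e \<in> X. fst e \<in> Q u}. P e)"
          unfolding P_def using finX by (intro bpr_Un_le p_le) auto
        also have "\<dots> = (\<Sum>e\<in>X. of_bool (fst e \<in> Q u) * P e)"
          unfolding sum.inter_filter[OF finX, of P "\<lambda>e. fst e \<in> Q u"] by (intro sum.cong) auto
        finally show ?thesis .
      qed
      have "(\<Sum>u\<in>U. \<Sum>y\<in>S \<inter> Q u. q ^ N * Pr W (two_arms W S (Q u) z x y)) \<le>
          (\<Sum>u\<in>U. \<Sum>y\<in>S \<inter> Q u. \<Sum>e\<in>X. of_bool (fst e \<in> Q u) * P e)"
        by (intro sum_mono one)
      also have "\<dots> = (\<Sum>u\<in>U. real (card (S \<inter> Q u)) * (\<Sum>e\<in>X. of_bool (fst e \<in> Q u) * P e))" by simp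
      also have "\<dots> \<le> (\<Sum>u\<in>U. V * (\<Sum>e\<in>X. of_bool (fst e \<in> Q u) * P e))"
      proof (intro sum_mono mult_right_mono sum_nonneg)
        fix u
        show "real (card (S \<inter> Q u)) \<le> V" unfolding Q_def using card_jball_le[OF R(1), of S "v u"] VR by linarith
      qed (use P0 in auto)
      also have "\<dots> = V * (\<Sum>e\<in>X. \<Sum>u\<in>U. of_bool (fst e \<in> Q u) * P e)"
        by (subst sum.swap) (simp only: sum_distrib_left)
      also have "\<dots> = V * (\<Sum>e\<in>X. real (card {u \<in> U. fst e \<in> Q u}) * P e)"
        using U(2) by (simp add: sum_distrib_right[symmetric] of_bool_def sum.If_cases Int_def)
      also have "\<dots> \<le> V * (\<Sum>e\<in>X. V * P e)"
      proof (intro mult_left_mono sum_mono mult_right_mono P0)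
        fix e :: "(int ^ 'd) \<times> (int ^ 'd)"
        have "{u \<in> U. fst e \<in> Q u} \<subseteq> UNIV \<inter> jball (fst e) (R + L)"
        proof
          fix u assume "u \<in> {u \<in> U. fst e \<in> Q u}"
          then have "jd (v u) (fst e) \<le> R" "jd u (v u) \<le> L" using uv U by (auto simp: Q_def mem_jball)
          then show "u \<in> UNIV \<inter> jball (fst e) (R + L)"
            using jd_triangle[of u "fst e" "v u"] by (simp add: mem_jball jd_sym[of "fst e" u])
        qed
        then have "real (card {u \<in> U. fst e \<in> Q u}) \<le> real (card (UNIV \<inter> jball (fst e) (R + L)))"
          by (intro of_nat_mono card_mono) auto
        also have "\<dots> \<le> V" unfolding V_def using R ab by (intro card_jball_le) auto
        finally show "real (card {u \<in> U. fst e \<in> Q u}) \<le> V" .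
      qed (use V0 in simp)
      also have "\<dots> = V\<^sup>2 * (\<Sum>e\<in>X. P e)" by (simp add: sum_distrib_left[symmetric] power2_eq_square)
      also have "\<dots> \<le> V\<^sup>2 * (b * g)"
      proof (rule mult_left_mono)
        have "(\<Sum>e\<in>X. P e) \<le> t W z x" unfolding X_def P_def by (rule pivotal_exit_sum[OF W(1) zS W(4)])
        also have "\<dots> \<le> b * g" using upper[OF W(1), of z x] by (simp add: g_def n_def)
        finally show "(\<Sum>e\<in>X. P e) \<le> b * g" .
      qed simp
      finally show ?thesis .
    qed
    \<comment> \<open>Boundary points whose ball contains \<open>z\<close> lie within
      \<open>R + L\<close> of \<open>z\<close>, and for these few the bound
      \<open>t S z u \<le> 1\<close> is enough.\<close>
    have \<phi>U: "\<phi> - V \<le> (\<Sum>u\<in>U. t S z u)"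
    proof -
      have "bd S = U \<union> (bd S - U)" using U by auto
      then have "\<phi> = (\<Sum>u\<in>U. t S z u) + (\<Sum>u\<in>bd S - U. t S z u)"
        unfolding \<phi>_def phi_in_def using finbd U(2) by (metis Diff_disjoint finite_Diff sum.union_disjoint)
      also have "(\<Sum>u\<in>bd S - U. t S z u) \<le> (\<Sum>u\<in>bd S - U. 1)" by (intro sum_mono tau_le_1 finS)
      also have "\<dots> = real (card (bd S - U))" by simp
      also have "\<dots> \<le> real (card (UNIV \<inter> jball z (R + L)))"
      proof (intro of_nat_mono card_mono)
        show "bd S - U \<subseteq> UNIV \<inter> jball z (R + L)"
        proof
          fix u assume "u \<in> bd S - U"
          then have "u \<in> bd S" "jd (v u) z \<le> R" by (auto simp: U_def Q_def mem_jball)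
          then show "u \<in> UNIV \<inter> jball z (R + L)"
            using jd_triangle[of u z "v u"] uv[of u] by (simp add: mem_jball jd_sym[of z u])
        qed
      qed simp
      also have "\<dots> \<le> V" unfolding V_def using R ab by (intro card_jball_le) auto
      finally show ?thesis by simp
    qed
    have "3 / 4 * a1 * g * (\<phi> - V) - (a1 / 4 * g * \<phi> + g) \<le> (\<Sum>u\<in>U. 3 / 4 * a1 * g * t S z u) - (a1 / 4 * g * \<phi> + g)"
      unfolding sum_distrib_left[symmetric] using \<phi>U k g0 by (intro diff_right_mono mult_left_mono) auto
    also have "\<dots> \<le> V\<^sup>2 * b / q ^ N * g"
    proof -
      have "q ^ N * (\<Sum>u\<in>U. \<Sum>y\<in>S \<inter> Q u. Pr W (two_arms W S (Q u) z x y)) \<le> V\<^sup>2 * (b * g)"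
        using upU by (simp only: sum_distrib_left)
      then have "(\<Sum>u\<in>U. \<Sum>y\<in>S \<inter> Q u. Pr W (two_arms W S (Q u) z x y)) \<le> V\<^sup>2 * (b * g) / q ^ N"
        using q by (simp add: le_divide_eq mult.commute)
      then show ?thesis using lowU by (simp add: mult_ac)
    qed
    finally have "(3 / 4 * a1 * (\<phi> - V) - (a1 / 4 * \<phi> + 1)) * g \<le> V\<^sup>2 * b / q ^ N * g"
      by (simp add: algebra_simps)
    then have "3 / 4 * a1 * (\<phi> - V) - (a1 / 4 * \<phi> + 1) \<le> V\<^sup>2 * b / q ^ N"
      using g0 by (rule mult_right_le_imp_le)
    moreover have "3 / 4 * a1 * (\<phi> - V) - (a1 / 4 * \<phi> + 1) = a1 / 2 * \<phi> - 3 / 4 * a1 * V - 1"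
      by (simp add: field_simps)
    ultimately have "a1 / 2 * \<phi> \<le> V\<^sup>2 * b / q ^ N + 1 + 3 / 4 * a1 * V" by linarith
    then have "2 / a1 * (a1 / 2 * \<phi>) \<le> C" unfolding C_def using k by (intro mult_left_mono) auto
    then show ?thesis using k by (simp add: \<phi>_def)
  qed
  moreover have "0 < C" unfolding C_def using k V0 ab q by (intro mult_pos_pos add_nonneg_pos add_pos_nonneg) auto
  ultimately show ?thesis by (intro that)
qed

end

section \<open>Infinite volume\<close>

text \<open>An event that depends on finitely many edges is a disjoint union of cylinders, one for
  each possible set of open edges, and their measures are the weights in \<open>bex\<close>.\<close>

lemma bond_percolation_event:
  assumes "finite F" "F \<subseteq> E" "0 \<le> p" "p \<le> 1"
  shows "{\<omega> \<in> space (bond_percolation E p). A {e \<in> F. \<omega> e}} \<in> sets (bond_percolation E p) \<and>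
    measure (bond_percolation E p) {\<omega> \<in> space (bond_percolation E p). A {e \<in> F. \<omega> e}} = bpr p F A"
proof -
  let ?N = "\<lambda>_ :: (int ^ 'd) set. measure_pmf (bernoulli_pmf p)"
  interpret product_prob_space ?N E
    by (rule product_prob_spaceI) (rule prob_space_measure_pmf)
  define M where "M = PiM E ?N"
  define cyl where "cyl K = prod_emb E ?N F (PiE F (\<lambda>e. {e \<in> K}))" for K
  have cyl_sets: "cyl K \<in> sets M" for K
    unfolding cyl_def M_def using assms by (intro sets_PiM_I) auto
  have cyl_iff: "\<omega> \<in> cyl K \<longleftrightarrow> {e \<in> F. \<omega> e} = K" if "K \<subseteq> F" "\<omega> \<in> space M" for K \<omega>
    using that assms(2) by (auto simp: cyl_def prod_emb_def M_def space_PiM PiE_iff)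
  have cyl_space: "cyl K \<subseteq> space M" for K using cyl_sets by (rule sets.sets_into_space)
  have cyl_meas: "measure M (cyl K) = p ^ card K * (1 - p) ^ card (F - K)" if K: "K \<subseteq> F" for K
  proof -
    have "measure M (cyl K) = (\<Prod>e\<in>F. measure (measure_pmf (bernoulli_pmf p)) {e \<in> K})"
      unfolding M_def cyl_def using assms by (intro measure_PiM_emb) auto
    also have "\<dots> = (\<Prod>e\<in>F. if e \<in> K then p else 1 - p)"
      using assms by (intro prod.cong) (auto simp: measure_pmf_single)
    also have "\<dots> = p ^ card K * (1 - p) ^ card (F - K)"
      using assms K by (simp add: prod.If_cases Int_absorb1 Diff_eq Int_commute)
    finally show ?thesis .
  qed
  define I where "I = {K \<in> Pow F. A K}"
  have I: "finite I" using assms by (simp add: I_def)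
  have eq: "{\<omega> \<in> space M. A {e \<in> F. \<omega> e}} = (\<Union>K\<in>I. cyl K)"
  proof (intro set_eqI iffI)
    fix \<omega> assume h: "\<omega> \<in> {\<omega> \<in> space M. A {e \<in> F. \<omega> e}}"
    then have "{e \<in> F. \<omega> e} \<in> I" by (auto simp: I_def)
    moreover have "\<omega> \<in> cyl {e \<in> F. \<omega> e}" using h by (subst cyl_iff) auto
    ultimately show "\<omega> \<in> (\<Union>K\<in>I. cyl K)" by blast
  next
    fix \<omega> assume "\<omega> \<in> (\<Union>K\<in>I. cyl K)"
    then obtain K where K: "K \<subseteq> F" "A K" "\<omega> \<in> cyl K" by (auto simp: I_def)
    then have "\<omega> \<in> space M" using cyl_space by auto
    then show "\<omega> \<in> {\<omega> \<in> space M. A {e \<in> F. \<omega> e}}" using K cyl_iff by auto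
  qed
  have "measure M (\<Union>K\<in>I. cyl K) = (\<Sum>K\<in>I. measure M (cyl K))"
    unfolding M_def
  proof (rule P.finite_measure_finite_Union)
    show "disjoint_family_on cyl I"
      unfolding disjoint_family_on_def
    proof (intro ballI impI)
      fix K K' assume h: "K \<in> I" "K' \<in> I" "K \<noteq> K'"
      show "cyl K \<inter> cyl K' = {}"
      proof (rule ccontr)
        assume "cyl K \<inter> cyl K' \<noteq> {}"
        then obtain \<omega> where w: "\<omega> \<in> cyl K" "\<omega> \<in> cyl K'" by auto
        then have "\<omega> \<in> space M" using cyl_space by auto
        then show False using w h cyl_iff by (auto simp: I_def)
      qed
    qed
  qed (use I cyl_sets in \<open>auto simp: M_def\<close>)
  also have "\<dots> = (\<Sum>K\<in>I. p ^ card K * (1 - p) ^ card (F - K))"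
    by (intro sum.cong refl cyl_meas) (auto simp: I_def)
  also have "\<dots> = bpr p F A"
    unfolding bpr_def bex_def I_def
      sum.inter_filter[of "Pow F" "\<lambda>K. p ^ card K * (1 - p) ^ card (F - K)" A, OF finite_Pow_iff[THEN iffD2, OF assms(1)]]
    by (intro sum.cong) auto
  finally have "measure M {\<omega> \<in> space M. A {e \<in> F. \<omega> e}} = bpr p F A" by (simp add: eq)
  moreover have "{\<omega> \<in> space M. A {e \<in> F. \<omega> e}} \<in> sets M"
    unfolding eq using I cyl_sets by (intro sets.finite_UN) auto
  ultimately show ?thesis unfolding M_def bond_percolation_def by simp
qed

lemma connected_in_iff:
  "connected_in E \<omega> S x y \<longleftrightarrow> x \<in> S \<and> conn {e \<in> E. e \<subseteq> S \<and> \<omega> e} x y"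
proof
  assume "connected_in E \<omega> S x y"
  then obtain \<gamma> where g: "\<gamma> \<noteq> []" "hd \<gamma> = x" "last \<gamma> = y" "set \<gamma> \<subseteq> S"
    "successively (\<lambda>u v. {u, v} \<in> E \<and> \<omega> {u, v}) \<gamma>" unfolding connected_in_def by blast
  have "conn {e \<in> E. e \<subseteq> S \<and> \<omega> e} (hd \<gamma>) (last \<gamma>)"
    using g(1,4,5)
  proof (induction \<gamma>)
    case (Cons u \<gamma>)
    show ?case
    proof (cases "\<gamma> = []")
      case False
      then have "{u, hd \<gamma>} \<in> {e \<in> E. e \<subseteq> S \<and> \<omega> e}"
        using Cons.prems by (auto simp: successively_Cons)
      moreover have "conn {e \<in> E. e \<subseteq> S \<and> \<omega> e} (hd \<gamma>) (last \<gamma>)"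
        using Cons False by (auto simp: successively_Cons)
      ultimately have "conn {e \<in> E. e \<subseteq> S \<and> \<omega> e} u (last \<gamma>)" by (rule conn_step_left)
      then show ?thesis using False by simp
    qed simp
  qed simp
  moreover have "x \<in> S" using g by (cases \<gamma>) auto
  ultimately show "x \<in> S \<and> conn {e \<in> E. e \<subseteq> S \<and> \<omega> e} x y" using g by simp
next
  assume h: "x \<in> S \<and> conn {e \<in> E. e \<subseteq> S \<and> \<omega> e} x y"
  then have "conn {e \<in> E. e \<subseteq> S \<and> \<omega> e} x y" by simp
  then show "connected_in E \<omega> S x y"
  proof (induction rule: conn_induct)
    case base
    then show ?case unfolding connected_in_def using h by (intro exI[of _ "[x]"]) simp
  next
    case (step u v)
    then obtain \<gamma> where "\<gamma> \<noteq> []" "hd \<gamma> = x" "last \<gamma> = u" "set \<gamma> \<subseteq> S"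
      "successively (\<lambda>u v. {u, v} \<in> E \<and> \<omega> {u, v}) \<gamma>" unfolding connected_in_def by blast
    then show ?case unfolding connected_in_def using step.hyps
      by (intro exI[of _ "\<gamma> @ [v]"]) (simp add: successively_append_iff)
  qed
qed

lemma connected_in_mono: "S \<subseteq> S' \<Longrightarrow> connected_in E \<omega> S x y \<Longrightarrow> connected_in E \<omega> S' x y"
  unfolding connected_in_def by (elim exE) (rule exI, fast)

text \<open>A path is finite and so stays in some ball. This makes infinite-volume connection events
  increasing unions of finite-volume ones, which gives their measurability and the limit of their
  probabilities.\<close>

lemma connected_in_exhaust:
  fixes x y :: "int ^ 'd"
  shows "connected_in E \<omega> S x y \<longleftrightarrow> (\<exists>n::nat. connected_in E \<omega> (S \<inter> jball 0 (real n)) x y)"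
proof
  assume "connected_in E \<omega> S x y"
  then obtain \<gamma> where g: "\<gamma> \<noteq> []" "hd \<gamma> = x" "last \<gamma> = y" "set \<gamma> \<subseteq> S"
    "successively (\<lambda>u v. {u, v} \<in> E \<and> \<omega> {u, v}) \<gamma>" unfolding connected_in_def by blast
  obtain n :: nat where n: "Max (jd 0 ` set \<gamma>) \<le> real n" using real_arch_simple by blast
  have "jd 0 z \<le> real n" if "z \<in> set \<gamma>" for z
  proof -
    have "jd 0 z \<le> Max (jd 0 ` set \<gamma>)" using that by (intro Max_ge) auto
    then show ?thesis using n by simp
  qed
  then have "set \<gamma> \<subseteq> S \<inter> jball 0 (real n)" using g(4) by (auto simp: mem_jball)
  then show "\<exists>n::nat. connected_in E \<omega> (S \<inter> jball 0 (real n)) x y"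
    unfolding connected_in_def using g by blast
qed (auto intro: connected_in_mono[rotated])

context
  fixes E :: "(int ^ 'd) set set" and p :: real
  assumes p: "0 \<le> p" "p \<le> 1"
begin

abbreviation "BM \<equiv> bond_percolation E p"

lemma two_point_finite:
  assumes "finite S"
  shows "{\<omega> \<in> space BM. connected_in E \<omega> S x y} \<in> sets BM" "two_point E S p x y = tau E p S x y"
proof -
  have eq: "connected_in E \<omega> S x y \<longleftrightarrow> x \<in> S \<and> conn {e \<in> edges_in E S. \<omega> e} x y" for \<omega>
  proof -
    have "{e \<in> E. e \<subseteq> S \<and> \<omega> e} = {e \<in> edges_in E S. \<omega> e}" by (auto simp: edges_in_def)
    then show ?thesis by (simp add: connected_in_iff)
  qed
  have "edges_in E S \<subseteq> E" by (auto simp: edges_in_def)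
  note ev = bond_percolation_event[OF finite_edges_in[OF assms] this p, of "\<lambda>K. x \<in> S \<and> conn K x y"]
  show "{\<omega> \<in> space BM. connected_in E \<omega> S x y} \<in> sets BM" unfolding eq using ev by blast
  show "two_point E S p x y = tau E p S x y" unfolding two_point_def eq tau_def using ev by blast
qed

lemma prob_space_BM: "prob_space BM"
  unfolding bond_percolation_def by (intro prob_space_PiM prob_space_measure_pmf)

lemma two_point_limit:
  "{\<omega> \<in> space BM. connected_in E \<omega> S x y} \<in> sets BM"
  "(\<lambda>n. tau E p (S \<inter> jball 0 (real n)) x y) \<longlonglongrightarrow> two_point E S p x y"
proof -
  interpret prob_space BM by (rule prob_space_BM)
  define A where "A n = {\<omega> \<in> space BM. connected_in E \<omega> (S \<inter> jball 0 (real n)) x y}" for n :: nat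
  have A: "A n \<in> sets BM" for n unfolding A_def by (rule two_point_finite) simp
  have un: "{\<omega> \<in> space BM. connected_in E \<omega> S x y} = (\<Union>n. A n)"
    unfolding A_def by (subst connected_in_exhaust) auto
  show "{\<omega> \<in> space BM. connected_in E \<omega> S x y} \<in> sets BM"
    unfolding un using A by (intro sets.countable_UN) auto
  have "(\<lambda>n. measure BM (A n)) \<longlonglongrightarrow> measure BM (\<Union>n. A n)"
  proof (rule finite_Lim_measure_incseq)
    show "incseq A"
    proof (rule monoI)
      fix m n :: nat assume "m \<le> n"
      then have sub: "S \<inter> jball 0 (real m) \<subseteq> S \<inter> jball 0 (real n)"
        by (intro Int_mono order_refl jball_mono) simp
      show "A m \<subseteq> A n" unfolding A_def
        by (intro Collect_mono conj_mono imp_refl impI connected_in_mono[OF sub])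
    qed
  qed (use A in auto)
  moreover have "measure BM (A n) = tau E p (S \<inter> jball 0 (real n)) x y" for n
    using two_point_finite(2)[of "S \<inter> jball 0 (real n)" x y] by (simp add: A_def two_point_def)
  ultimately show "(\<lambda>n. tau E p (S \<inter> jball 0 (real n)) x y) \<longlonglongrightarrow> two_point E S p x y"
    by (simp add: two_point_def un)
qed

lemma two_point_mono:
  assumes "S \<subseteq> S'"
  shows "two_point E S p x y \<le> two_point E S' p x y"
proof -
  interpret prob_space BM by (rule prob_space_BM)
  show ?thesis unfolding two_point_def
  proof (rule finite_measure_mono)
    show "{\<omega> \<in> space BM. connected_in E \<omega> S x y} \<subseteq> {\<omega> \<in> space BM. connected_in E \<omega> S' x y}"
      by (intro Collect_mono conj_mono imp_refl impI connected_in_mono[OF assms])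
  qed (rule two_point_limit(1))
qed

end

lemma two_point_nonneg: "0 \<le> two_point E S p x y"
  by (simp add: two_point_def)

text \<open>\<open>bernoulli_pmf\<close> truncates its parameter. Hence
  \<open>critical_probability\<close> can be replaced by its clamp to [0, 1] before anything is
  known about the set whose infimum it is.\<close>

lemma two_point_clamp: "two_point E S p x y = two_point E S (min 1 (max 0 p)) x y"
proof -
  have "bernoulli_pmf p = bernoulli_pmf (min 1 (max 0 p))"
    by (intro pmf_eqI) (simp add: bernoulli_pmf.rep_eq)
  then show ?thesis by (simp add: two_point_def bond_percolation_def)
qed

section \<open>The lattice edge sets and the parameters 0 and 1\<close>

lemma linf_le_l1: "linf_norm x \<le> l1_norm x" for x :: "int ^ 'd"
  unfolding linf_norm_le_iff
proof
  fix i
  show "\<bar>x $ i\<bar> \<le> l1_norm x" unfolding l1_norm_def by (rule member_le_sum[of i UNIV "\<lambda>i. \<bar>x $ i\<bar>"]) auto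
qed

lemma lattice_edgesD:
  fixes E :: "(int ^ 'd) set set"
  assumes "lattice_edges E"
  obtains L where "1 \<le> L" "\<And>e. e \<in> E \<Longrightarrow> \<exists>x y. e = {x, y} \<and> x \<noteq> y \<and> jd x y \<le> L"
    "\<And>x y. l1_norm (x - y) = 1 \<Longrightarrow> {x, y} \<in> E"
proof -
  have jd_le: "jd x y \<le> r" if "real_of_int (l1_norm (x - y)) \<le> r" "1 \<le> r" for x y :: "int ^ 'd" and r
    using that linf_le_l1[of "x - y"] unfolding jd_def by linarith
  have ne: "x \<noteq> y" if "l1_norm (x - y) = 1" for x y :: "int ^ 'd"
    using that by (auto simp: l1_norm_def)
  from assms consider "E = nearest_neighbour_edges" | l where "1 \<le> l" "E = spread_out_edges l"
    unfolding lattice_edges_def by blast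
  then show ?thesis
  proof cases
    case 1
    show ?thesis
    proof (rule that[of 1])
      fix e assume "e \<in> E"
      then obtain x y where xy: "e = {x, y}" "l1_norm (x - y) = 1" unfolding 1 nearest_neighbour_edges_def by blast
      have "jd x y \<le> 1" by (rule jd_le) (simp_all add: xy(2))
      then show "\<exists>x y. e = {x, y} \<and> x \<noteq> y \<and> jd x y \<le> 1" using xy ne by blast
    qed (unfold 1 nearest_neighbour_edges_def, auto)
  next
    case 2
    show ?thesis
    proof (rule that[of "real l"])
      fix e assume "e \<in> E"
      then obtain x y where xy: "e = {x, y}" "x \<noteq> y" "l1_norm (x - y) \<le> int l"
        unfolding 2 spread_out_edges_def by blast
      have "real_of_int (l1_norm (x - y)) \<le> real l" using xy(3) by linarith
      then have "jd x y \<le> real l" using 2 by (intro jd_le) auto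
      then show "\<exists>x y. e = {x, y} \<and> x \<noteq> y \<and> jd x y \<le> real l" using xy by blast
    next
      fix x y :: "int ^ 'd" assume h: "l1_norm (x - y) = 1"
      then have "l1_norm (x - y) \<le> int l" using 2 by simp
      then show "{x, y} \<in> E" unfolding 2 spread_out_edges_def using ne[OF h] by blast
    qed (use 2 in simp)
  qed
qed

lemma tau_0: "tau E 0 S x y = of_bool (x \<in> S \<and> x = y)" if "finite S"
proof -
  have "(\<Sum>K\<in>Pow (edges_in E S). 0 ^ card K * (1 - 0) ^ card (edges_in E S - K) * of_bool (x \<in> S \<and> conn K x y)) =
      (\<Sum>K\<in>{{}}. of_bool (x \<in> S \<and> conn K x y) :: real)"
  proof (rule sum.mono_neutral_cong_right)
    show "\<forall>K\<in>Pow (edges_in E S) - {{}}. 0 ^ card K * (1 - 0) ^ card (edges_in E S - K) * of_bool (x \<in> S \<and> conn K x y) = (0::real)"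
    proof
      fix K assume K: "K \<in> Pow (edges_in E S) - {{}}"
      then have "finite K" using finite_edges_in[OF that] finite_subset by auto
      then have "0 < card K" using K by (simp add: card_gt_0_iff)
      then show "0 ^ card K * (1 - 0) ^ card (edges_in E S - K) * of_bool (x \<in> S \<and> conn K x y) = (0::real)" by simp
    qed
  qed (use finite_edges_in[OF that] in auto)
  moreover have "conn {} x y \<longleftrightarrow> x = y" by (simp add: conn_def)
  ultimately show ?thesis unfolding tau_def bpr_def bex_def by simp
qed

lemma tau_1: "tau E 1 S x y = of_bool (x \<in> S \<and> conn (edges_in E S) x y)" if "finite S"
proof -
  let ?F = "edges_in E S"
  have fin: "finite ?F" by (rule finite_edges_in[OF that])
  have "(\<Sum>K\<in>Pow ?F. 1 ^ card K * (1 - 1) ^ card (?F - K) * of_bool (x \<in> S \<and> conn K x y)) =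
      (\<Sum>K\<in>{?F}. of_bool (x \<in> S \<and> conn K x y) :: real)"
  proof (rule sum.mono_neutral_cong_right)
    show "\<forall>K\<in>Pow ?F - {?F}. 1 ^ card K * (1 - 1) ^ card (?F - K) * of_bool (x \<in> S \<and> conn K x y) = (0::real)"
    proof
      fix K assume K: "K \<in> Pow ?F - {?F}"
      then have "?F - K \<noteq> {}" by auto
      then have "0 < card (?F - K)" using fin by (simp add: card_gt_0_iff)
      then show "1 ^ card K * (1 - 1) ^ card (?F - K) * of_bool (x \<in> S \<and> conn K x y) = (0::real)" by simp
    qed
  qed (use fin in auto)
  then show ?thesis unfolding tau_def bpr_def bex_def by simp
qed

lemma tau_mono_p:
  assumes "finite S" "0 \<le> p" "p \<le> p'" "p' \<le> 1"
  shows "tau E p S x y \<le> tau E p' S x y"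
  unfolding tau_def bpr_def
proof (rule bex_mono_p[OF finite_edges_in[OF assms(1)] assms(2-4)])
  show "mono (\<lambda>K. of_bool (x \<in> S \<and> conn K x y) :: real)"
    by (rule increasing_mono) (auto simp: increasing_def intro: conn_mono)
qed

text \<open>A path that is not confined to \<open>S\<close> has a first exit edge, and van den
  Berg-Kesten separates the pieces before and after it. The factor \<open>p\<close> of the exit edge
  is given away; in the application the factor \<open>p\<close> of the boundary edge of
  \<open>\<Lambda>\<close> takes its place.\<close>

lemma simon_lieb:
  assumes "finite T" "S \<subseteq> T" "z \<in> S" "0 \<le> p" "p \<le> 1"
  shows "tau E p T z x \<le> of_bool (x \<in> S) * tau E p S z x +
    (\<Sum>(u, v)\<in>{(u, v). u \<in> S \<and> v \<in> T - S \<and> {u, v} \<in> E}. tau E p S z u * tau E p T v x)"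
proof -
  define X where "X = {(u, v). u \<in> S \<and> v \<in> T - S \<and> {u, v} \<in> E}"
  have finX: "finite X" by (rule finite_subset[of _ "T \<times> T"]) (use assms in \<open>auto simp: X_def\<close>)
  have zT: "z \<in> T" using assms by auto
  define D where "D = (\<lambda>(u, v). disjointly (\<lambda>K. conn (K \<inter> Pow S) z u) (\<lambda>K. conn K v x))"
  have "tau E p T z x = bpr p (edges_in E T) (\<lambda>K. conn K z x)" using zT by (simp add: bpr_conn)
  also have "\<dots> \<le> bpr p (edges_in E T) (\<lambda>K. x \<in> S \<and> conn (K \<inter> Pow S) z x) + bpr p (edges_in E T) (\<lambda>K. \<exists>e\<in>X. D e K)"
  proof (rule bpr_disj_le[OF assms(4,5)])
    fix K assume K: "K \<subseteq> edges_in E T" "conn K z x"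
    have finK: "finite K" using K(1) finite_edges_in[OF assms(1)] finite_subset by metis
    show "(x \<in> S \<and> conn (K \<inter> Pow S) z x) \<or> (\<exists>e\<in>X. D e K)"
    proof (cases "conn {e \<in> K. e \<inter> - S = {}} z x")
      case True
      have "{e \<in> K. e \<inter> - S = {}} \<subseteq> K \<inter> Pow S" by auto
      then have "conn (K \<inter> Pow S) z x" using True by (rule conn_mono)
      then show ?thesis using conn_in_Pow assms(3) by metis
    next
      case False
      \<comment> \<open>The point \<open>x\<close> may lie in \<open>S\<close>, so the path is first
        cut at some \<open>v\<close> outside \<open>S\<close>; the exit is taken on the piece up to
        \<open>v\<close>, and the remainder is joined to the second piece.\<close>
      then have "\<exists>v\<in>- S. disjointly (\<lambda>K. conn K z v) (\<lambda>K. conn K v x) K"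
        by (intro conn_through finK K(2)) simp
      then obtain v where v: "v \<notin> S" "disjointly (\<lambda>K. conn K z v) (\<lambda>K. conn K v x) K" by blast
      from v(2) obtain K1 K2 where K12: "K1 \<subseteq> K" "K2 \<subseteq> K" "K1 \<inter> K2 = {}" "conn K1 z v" "conn K2 v x"
        by (rule disjointlyE)
      have "finite K1" using K12(1) finK finite_subset by metis
      from conn_exit[OF this K12(4) assms(3) v(1)] obtain u w A B where
        h: "u \<in> S" "w \<notin> S" "{u, w} \<in> K1" "A \<subseteq> K1 \<inter> Pow S" "B \<subseteq> K1" "A \<inter> B = {}" "conn A z u" "conn B w v"
        by (elim exE conjE)
      have e: "{u, w} \<in> edges_in E T" using h(3) K12(1) K(1) by auto
      have "conn (B \<union> K2) w x"
      proof (rule conn_trans)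
        show "conn (B \<union> K2) w v" by (rule conn_mono[OF _ h(8)]) simp
        show "conn (B \<union> K2) v x" by (rule conn_mono[OF _ K12(5)]) simp
      qed
      moreover have "conn (A \<inter> Pow S) z u" by (rule conn_mono[OF _ h(7)]) (use h(4) in auto)
      moreover have "A \<subseteq> K" "B \<union> K2 \<subseteq> K" "A \<inter> (B \<union> K2) = {}" using h(4,5,6) K12(1,2,3) by auto
      ultimately have "D (u, w) K" unfolding D_def prod.case by (intro disjointlyI[of A K "B \<union> K2"])
      moreover have "(u, w) \<in> X" using h(1,2) e by (auto simp: X_def edges_in_def)
      ultimately show ?thesis by blast
    qed
  qed
  also have "bpr p (edges_in E T) (\<lambda>K. x \<in> S \<and> conn (K \<inter> Pow S) z x) = of_bool (x \<in> S) * tau E p S z x"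
    using bpr_conn_subset[OF assms(1-3), of p E x] finite_edges_in[OF assms(1), of E]
    by (cases "x \<in> S") (simp_all add: bpr_def)
  also have "bpr p (edges_in E T) (\<lambda>K. \<exists>e\<in>X. D e K) \<le> (\<Sum>e\<in>X. bpr p (edges_in E T) (D e))"
    by (intro bpr_Un_le assms finX)
  also have "\<dots> \<le> (\<Sum>(u, v)\<in>X. tau E p S z u * tau E p T v x)"
  proof (rule sum_mono)
    fix e assume e: "e \<in> X"
    obtain u v where uv: "e = (u, v)" by (cases e)
    have "v \<in> T" using e uv by (simp add: X_def)
    have "bpr p (edges_in E T) (D e) \<le> bpr p (edges_in E T) (\<lambda>K. conn (K \<inter> Pow S) z u) * bpr p (edges_in E T) (\<lambda>K. conn K v x)"
      unfolding D_def uv prod.case by (intro bk finite_edges_in assms increasing_conn increasing_conn_Int)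
    then show "bpr p (edges_in E T) (D e) \<le> (case e of (u, v) \<Rightarrow> tau E p S z u * tau E p T v x)"
      using bpr_conn_subset[OF assms(1-3), of p E u] \<open>v \<in> T\<close> by (simp add: uv bpr_conn)
  qed
  finally show ?thesis unfolding X_def by simp
qed

lemma sum_le_phi:
  assumes "finite X" "X \<subseteq> {(u, v). u \<in> S \<and> v \<notin> S \<and> {u, v} \<in> E}" "0 \<le> p"
  shows "ennreal (\<Sum>(u, v)\<in>X. two_point E S p 0 u * p) \<le> phi E p S"
proof -
  let ?f = "\<lambda>(u, v). ennreal (two_point E S p 0 u * p)"
  let ?A = "{(u, v). u \<in> S \<and> v \<notin> S \<and> {u, v} \<in> E}"
  have "ennreal (\<Sum>(u, v)\<in>X. two_point E S p 0 u * p) = sum ?f X"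
    using mult_nonneg_nonneg[OF two_point_nonneg assms(3)]
    by (subst sum_ennreal[symmetric]) (auto simp: case_prod_beta)
  also have "\<dots> \<le> (SUP F\<in>{F. finite F \<and> F \<subseteq> ?A}. sum ?f F)"
    using assms by (intro SUP_upper) auto
  also have "\<dots> = infsum ?f ?A" by (rule nonneg_infsum_complete[symmetric]) simp
  finally show ?thesis by (simp add: phi_def)
qed

theorem corollary1p5:
  fixes E :: "(int ^ 'd) set set"
  assumes "lattice_edges E"
    and "CARD('d) > 6"
    and "critical_two_point_bounds E"
  shows "\<exists>C::real. C > 0 \<and>
    (\<forall>p S \<Lambda>. 0 \<le> p \<and> p \<le> critical_probability E \<and> 0 \<in> S \<and> S \<subseteq> \<Lambda> \<longrightarrow>
      phi E p \<Lambda> \<le> ennreal C * phi E p S)"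
proof -
  obtain L where L: "1 \<le> L" "\<And>e. e \<in> E \<Longrightarrow> \<exists>x y. e = {x, y} \<and> x \<noteq> y \<and> jd x y \<le> L"
    "\<And>x y. l1_norm (x - y) = 1 \<Longrightarrow> {x, y} \<in> E"
    using lattice_edgesD[OF assms(1)] by metis
  define d where "d = real CARD('d)"
  have d7: "7 \<le> d" using assms(2) by (simp add: d_def)
  define pc where "pc = critical_probability E"
  \<comment> \<open>The clamp leaves the model unchanged. The two-point bounds will place
    \<open>q\<close> strictly between 0 and 1, whence \<open>pc = q\<close>.\<close>
  define q where "q = min 1 (max 0 pc)"
  have q: "0 \<le> q" "q \<le> 1" by (auto simp: q_def)
  obtain a b where ab: "0 < a" "a \<le> b"
    and bounds: "\<And>x y. a * jd x y powr (2 - d) \<le> two_point E UNIV q x y"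
      "\<And>x y. two_point E UNIV q x y \<le> b * jd x y powr (2 - d)"
  proof -
    obtain a b where h: "0 < a" "a \<le> b"
      "\<And>x y. a * (real_of_int (max 1 (linf_norm (x - y))) powi (- (int CARD('d) - 2))) \<le> two_point E UNIV pc x y"
      "\<And>x y. two_point E UNIV pc x y \<le> b * (real_of_int (max 1 (linf_norm (x - y))) powi (- (int CARD('d) - 2)))"
      using assms(3) unfolding critical_two_point_bounds_def pc_def Let_def by blast
    have pw: "real_of_int (max 1 (linf_norm (x - y))) powi (- (int CARD('d) - 2)) = jd x y powr (2 - d)" for x y :: "int ^ 'd"
    proof -
      have "real_of_int (max 1 (linf_norm (x - y))) = jd x y" by (simp add: jd_def)
      moreover have "jd x y powr real_of_int (- (int CARD('d) - 2)) = jd x y powi (- (int CARD('d) - 2))"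
        by (rule powr_real_of_int') (use jd_ge_1[of x y] in auto)
      moreover have "real_of_int (- (int CARD('d) - 2)) = 2 - d" by (simp add: d_def)
      ultimately show ?thesis by simp
    qed
    show ?thesis
    proof (rule that[of a b])
      fix x y
      show "a * jd x y powr (2 - d) \<le> two_point E UNIV q x y" "two_point E UNIV q x y \<le> b * jd x y powr (2 - d)"
        using h(3,4)[of x y] two_point_clamp[of E UNIV pc x y] unfolding pw q_def by simp_all
    qed (use h in auto)
  qed
  note two_point_q = two_point_finite(2)[OF q] two_point_mono[OF q] two_point_limit(2)[OF q]
  obtain i :: 'd where True by simp
  \<comment> \<open>At parameter 0 distinct points are never connected, against the positive lower
    bound.\<close>
  have "q \<noteq> 0"
  proof
    assume q0: "q = 0"
    define y :: "int ^ 'd" where "y = upd 0 i 1"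
    have "y $ i \<noteq> 0 $ i" by (simp add: y_def)
    then have "0 \<noteq> y" by auto
    then have "tau E q (UNIV \<inter> jball 0 (real n)) 0 y = 0" for n
      unfolding q0 by (subst tau_0) auto
    then have "(\<lambda>n. 0) \<longlonglongrightarrow> two_point E UNIV q 0 y" using two_point_q(3)[of E UNIV 0 y] by simp
    then have "two_point E UNIV q 0 y = 0" by (simp add: LIMSEQ_const_iff)
    then show False using bounds(1)[of 0 y] ab jd_ge_1[of 0 y] by (simp add: mult_le_0_iff)
  qed
  \<comment> \<open>At parameter 1 all points are connected, against the decay of the upper bound; a
    point at distance \<open>M > b\<close> along an axis already gives the contradiction.\<close>
  moreover have "q \<noteq> 1"
  proof
    assume q1: "q = 1"
    define M where "M = nat \<lceil>b\<rceil> + 1"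
    define y :: "int ^ 'd" where "y = upd 0 i (int M)"
    define W where "W = (\<lambda>s. upd (0 :: int ^ 'd) i s) ` {0..int M}"
    have "conn (edges_in E W) (upd 0 i 0) (upd 0 i (int M))"
      by (rule conn_line_le[OF L(3)]) (auto simp: W_def)
    moreover have "upd (0 :: int ^ 'd) i 0 = 0" by (simp add: vec_eq_iff)
    moreover have "0 \<in> W" unfolding W_def by (rule image_eqI[of _ _ 0]) (simp_all add: vec_eq_iff)
    moreover have finW: "finite W" by (simp add: W_def)
    ultimately have "tau E q W 0 y = 1" unfolding q1 y_def by (subst tau_1) auto
    then have "1 \<le> two_point E UNIV q 0 y"
      using two_point_q(2)[of W UNIV E 0 y] two_point_q(1)[OF finW, of E 0 y] by simp
    also have "\<dots> \<le> b * jd 0 y powr (2 - d)" by (rule bounds)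
    also have "\<dots> \<le> b * jd 0 y powr (- 1)" using ab d7 jd_ge_1[of 0 y] by (intro mult_left_mono powr_mono) auto
    also have "\<dots> = b / jd 0 y" using jd_ge_1[of 0 y] by (simp add: powr_minus_divide)
    finally have "jd 0 y \<le> b" by (simp add: le_divide_eq)
    moreover have "int M \<le> linf_norm (0 - y)" using abs_le_linf_norm[of "0 - y" i] by (simp add: y_def)
    then have "real M \<le> jd 0 y" unfolding jd_def by linarith
    moreover have "b < real M" unfolding M_def by linarith
    ultimately show False by linarith
  qed
  ultimately have q01: "0 < q" "q < 1" using q by auto
  then have pq: "pc = q" by (auto simp: q_def min_def max_def split: if_splits)
  \<comment> \<open>Halving \<open>a\<close> leaves the room needed because finite-volume two-point
    functions only converge to the infinite-volume one from below.\<close>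
  interpret perc E q "a / 2" b L d
  proof
    show "d = real CARD('d)" by (simp add: d_def)
    show "tau E q W x y \<le> b * jd x y powr (2 - d)" if "finite W" for W x y
      using two_point_q(1)[OF that, of E x y] two_point_q(2)[of W UNIV E x y] bounds(2)[of x y] by simp
    show "\<exists>W0. finite W0 \<and> (\<forall>W. finite W \<longrightarrow> W0 \<subseteq> W \<longrightarrow> a / 2 * jd x y powr (2 - d) \<le> tau E q W x y)" for x y
    proof -
      have "0 < a * jd x y powr (2 - d)" using ab jd_ge_1[of x y] by simp
      then have "a / 2 * jd x y powr (2 - d) < two_point E UNIV q x y" using bounds(1)[of x y] by simp
      then have "\<forall>\<^sub>F n in sequentially. a / 2 * jd x y powr (2 - d) < tau E q (UNIV \<inter> jball 0 (real n)) x y"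
        by (rule order_tendstoD(1)[OF two_point_q(3)])
      then obtain n where n: "a / 2 * jd x y powr (2 - d) < tau E q (UNIV \<inter> jball 0 (real n)) x y"
        using eventually_sequentially by auto
      have "a / 2 * jd x y powr (2 - d) \<le> tau E q W x y" if W: "finite W" "UNIV \<inter> jball 0 (real n) \<subseteq> W" for W
        using n two_point_q(2)[OF W(2), of E x y] two_point_q(1)[OF W(1), of E x y]
          two_point_q(1)[of "UNIV \<inter> jball 0 (real n)" E x y] by simp
      then show ?thesis by (intro exI[of _ "UNIV \<inter> jball 0 (real n)"]) simp
    qed
  qed (use q01 assms(2) L ab in auto)
  obtain C where C: "0 < C" "\<And>S z. finite S \<Longrightarrow> z \<in> S \<Longrightarrow> phi_in S z \<le> C"
    by (rule uniform_bound) auto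
  define deg where "deg = (3 * L) powr d"
  have deg0: "0 \<le> deg" by (simp add: deg_def)
  \<comment> \<open>The 1 accounts for boundary edges of \<open>\<Lambda>\<close> that start in
    \<open>S\<close> and so are boundary edges of \<open>S\<close> as well; \<open>deg * C\<close>
    bounds what a point outside \<open>S\<close> can still reach of the boundary of
    \<open>\<Lambda>\<close>, with \<open>deg\<close> bounding the edges at a vertex.\<close>
  have "phi E p \<Lambda> \<le> ennreal (1 + deg * C) * phi E p S"
    if h: "0 \<le> p" "p \<le> pc" "0 \<in> S" "S \<subseteq> \<Lambda>" for p S \<Lambda>
  proof -
    have p: "0 \<le> p" "p \<le> 1" "p \<le> q" using h q by (auto simp: pq)
    define edge_bd where "edge_bd T = {(u, v). u \<in> T \<and> v \<notin> T \<and> {u, v} \<in> E}" for T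
    have part: "sum (\<lambda>(x, y). ennreal (two_point E \<Lambda> p 0 x * p)) X \<le> ennreal (1 + deg * C) * phi E p S"
      if X: "finite X" "X \<subseteq> edge_bd \<Lambda>" for X
    proof -
      have ev: "ennreal (\<Sum>(x, y)\<in>X. tau E p (\<Lambda> \<inter> jball 0 (real n)) 0 x * p) \<le> ennreal (1 + deg * C) * phi E p S"
        if n: "1 \<le> n" "\<And>x y. (x, y) \<in> X \<Longrightarrow> jd 0 x \<le> real n" for n :: nat
      proof -
        \<comment> \<open>Both sets are cut off by the same ball, so a point of
          \<open>T' - T\<close> lies outside \<open>S\<close> and the edges in \<open>Y\<close> are
          boundary edges of \<open>S\<close> itself.\<close>
        define T T' where "T = S \<inter> jball 0 (real n)" and "T' = \<Lambda> \<inter> jball 0 (real n)"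
        have T: "finite T" "finite T'" "T \<subseteq> T'" "0 \<in> T" using h n by (auto simp: T_def T'_def mem_jball)
        define Y where "Y = {(u, v). u \<in> T \<and> v \<in> T' - T \<and> {u, v} \<in> E}"
        have Y: "finite Y" "Y \<subseteq> edge_bd S"
        proof -
          show "finite Y" by (rule finite_subset[of _ "T \<times> T'"]) (use T in \<open>auto simp: Y_def\<close>)
          show "Y \<subseteq> edge_bd S" by (auto simp: Y_def edge_bd_def T_def T'_def)
        qed
        define X1 where "X1 = {(x, y) \<in> X. x \<in> T}"
        have X1: "finite X1" "X1 \<subseteq> X" "X1 \<subseteq> edge_bd S"
        proof -
          show "X1 \<subseteq> X" by (auto simp: X1_def)
          then show "finite X1" using X(1) finite_subset by blast
          show "X1 \<subseteq> edge_bd S" using X(2) h(4) by (auto simp: X1_def edge_bd_def T_def)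
        qed
        have le2: "tau E p T 0 u \<le> two_point E S p 0 u" for u
          using two_point_finite(2)[OF p(1,2) T(1), of E 0 u] two_point_mono[OF p(1,2), of T S E 0 u] by (simp add: T_def)
        have tau0: "0 \<le> tau E p T'' v x" for T'' v x unfolding tau_def by (rule bpr_nonneg[OF p(1,2)])
        \<comment> \<open>The uniform bound is applied to the finite set \<open>T'\<close> with
          starting point \<open>v\<close>; monotonicity in the parameter carries it from the
          critical value down to \<open>p\<close>.\<close>
        have deg: "(\<Sum>(x, y)\<in>X. tau E p T' v x) \<le> deg * C" if v: "v \<in> T'" for v
        proof -
          have "(\<Sum>(x, y)\<in>X. tau E p T' v x) \<le> (\<Sum>(x, y)\<in>(SIGMA x:bd T'. UNIV \<inter> jball x L). tau E p T' v x)"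
          proof (rule sum_mono2)
            show "finite (SIGMA x:bd T'. UNIV \<inter> jball x L)" using finite_bd[OF T(2)] by auto
            show "X \<subseteq> (SIGMA x:bd T'. UNIV \<inter> jball x L)"
            proof
              fix e assume e: "e \<in> X"
              obtain x y where xy: "e = (x, y)" by (cases e)
              then have m: "x \<in> \<Lambda>" "y \<notin> \<Lambda>" "{x, y} \<in> E" "jd 0 x \<le> real n" using e X(2) n(2) by (auto simp: edge_bd_def)
              then have "x \<in> bd T'" unfolding inner_boundary_def T'_def by (auto simp: mem_jball)
              then show "e \<in> (SIGMA x:bd T'. UNIV \<inter> jball x L)" using E_edge[OF m(3)] by (simp add: xy mem_jball)
            qed
          qed (use tau0 in auto)
          also have "\<dots> = (\<Sum>x\<in>bd T'. \<Sum>y\<in>UNIV \<inter> jball x L. tau E p T' v x)"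
            using finite_bd[OF T(2)] by (subst sum.Sigma) auto
          also have "\<dots> \<le> (\<Sum>x\<in>bd T'. deg * tau E p T' v x)"
            unfolding deg_def using L(1) tau0 by (intro sum_mono) (simp add: mult_right_mono card_jball_le[of L UNIV, simplified])
          also have "\<dots> \<le> (\<Sum>x\<in>bd T'. deg * tau E q T' v x)"
            using deg0 p q by (intro sum_mono mult_left_mono tau_mono_p T(2)) auto
          also have "\<dots> = deg * phi_in T' v" by (simp add: phi_in_def sum_distrib_left)
          also have "\<dots> \<le> deg * C" using deg0 C(2)[OF T(2) v] by (intro mult_left_mono)
          finally show ?thesis .
        qed
        have "(\<Sum>(x, y)\<in>X. tau E p T' 0 x * p) \<le>
          (\<Sum>(x, y)\<in>X. (of_bool (x \<in> T) * tau E p T 0 x + (\<Sum>(u, v)\<in>Y. tau E p T 0 u * tau E p T' v x)) * p)"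
          unfolding Y_def using simon_lieb[OF T(2,3,4) p(1,2), of E] p(1) by (intro sum_mono) (auto intro: mult_right_mono)
        also have "\<dots> = (\<Sum>(x, y)\<in>X. of_bool (x \<in> T) * (tau E p T 0 x * p)) +
          (\<Sum>(x, y)\<in>X. \<Sum>(u, v)\<in>Y. tau E p T 0 u * p * tau E p T' v x)"
          by (simp add: sum.distrib[symmetric] case_prod_beta distrib_left sum_distrib_left mult_ac)
        also have "(\<Sum>(x, y)\<in>X. of_bool (x \<in> T) * (tau E p T 0 x * p)) = (\<Sum>(x, y)\<in>X1. tau E p T 0 x * p)"
          using X(1) X1(2) by (intro sum.mono_neutral_cong_right) (auto simp: X1_def)
        also have "\<dots> \<le> (\<Sum>(x, y)\<in>X1. two_point E S p 0 x * p)"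
          using p(1) le2 by (intro sum_mono) (auto intro: mult_right_mono)
        also have "(\<Sum>(x, y)\<in>X. \<Sum>(u, v)\<in>Y. tau E p T 0 u * p * tau E p T' v x) =
          (\<Sum>(u, v)\<in>Y. tau E p T 0 u * p * (\<Sum>(x, y)\<in>X. tau E p T' v x))"
          unfolding case_prod_beta sum_distrib_left by (rule sum.swap)
        also have "\<dots> \<le> (\<Sum>(u, v)\<in>Y. two_point E S p 0 u * p * (deg * C))"
        proof (rule sum_mono)
          fix e assume e: "e \<in> Y"
          obtain u v where uv: "e = (u, v)" by (cases e)
          have "v \<in> T'" using e uv by (simp add: Y_def)
          have "tau E p T 0 u * p * (\<Sum>(x, y)\<in>X. tau E p T' v x) \<le> two_point E S p 0 u * p * (deg * C)"
            using deg[OF \<open>v \<in> T'\<close>] le2[of u] p(1) tau0 two_point_nonneg[of E S p 0 u]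
            by (intro mult_mono mult_right_mono mult_nonneg_nonneg sum_nonneg) auto
          then show "(case e of (u, v) \<Rightarrow> tau E p T 0 u * p * (\<Sum>(x, y)\<in>X. tau E p T' v x)) \<le>
            (case e of (u, v) \<Rightarrow> two_point E S p 0 u * p * (deg * C))" by (simp add: uv)
        qed
        also have "\<dots> = deg * C * (\<Sum>(u, v)\<in>Y. two_point E S p 0 u * p)"
          by (simp add: sum_distrib_left case_prod_beta mult_ac)
        finally have main: "(\<Sum>(x, y)\<in>X. tau E p T' 0 x * p) \<le>
          (\<Sum>(x, y)\<in>X1. two_point E S p 0 x * p) + deg * C * (\<Sum>(u, v)\<in>Y. two_point E S p 0 u * p)" by simp
        have nn: "0 \<le> (\<Sum>(u, v)\<in>Z. two_point E S p 0 u * p)" for Z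
          using p(1) two_point_nonneg[of E S p 0] by (intro sum_nonneg) auto
        have dC: "0 \<le> deg * C" using deg0 C(1) by simp
        have "ennreal (\<Sum>(x, y)\<in>X. tau E p T' 0 x * p) \<le>
          ennreal ((\<Sum>(x, y)\<in>X1. two_point E S p 0 x * p) + deg * C * (\<Sum>(u, v)\<in>Y. two_point E S p 0 u * p))"
          by (rule ennreal_leI[OF main])
        also have "\<dots> = ennreal (\<Sum>(x, y)\<in>X1. two_point E S p 0 x * p) + ennreal (deg * C) * ennreal (\<Sum>(u, v)\<in>Y. two_point E S p 0 u * p)"
          unfolding ennreal_mult[OF dC nn, symmetric] by (rule ennreal_plus[OF nn mult_nonneg_nonneg[OF dC nn]])
        also have "\<dots> \<le> phi E p S + ennreal (deg * C) * phi E p S"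
          using X1 Y p(1) unfolding edge_bd_def by (intro add_mono mult_left_mono sum_le_phi) auto
        also have "\<dots> = ennreal (1 + deg * C) * phi E p S"
          using ennreal_plus[OF zero_le_one dC] by (simp add: distrib_right)
        finally show ?thesis unfolding T'_def .
      qed
      obtain n0 :: nat where n0: "Max (insert 1 ((\<lambda>e. jd 0 (fst e)) ` X)) \<le> real n0" using real_arch_simple by blast
      have n0': "1 \<le> n0" "\<And>x y. (x, y) \<in> X \<Longrightarrow> jd 0 x \<le> real n0"
      proof -
        have "1 \<le> Max (insert 1 ((\<lambda>e. jd 0 (fst e)) ` X))" using X(1) by (intro Max_ge) auto
        then show "1 \<le> n0" using n0 by simp
        fix x y assume "(x, y) \<in> X"
        then have "jd 0 x \<in> (\<lambda>e. jd 0 (fst e)) ` X" by force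
        then have "jd 0 x \<le> Max (insert 1 ((\<lambda>e. jd 0 (fst e)) ` X))" using X(1) by (intro Max_ge) auto
        then show "jd 0 x \<le> real n0" using n0 by simp
      qed
      have "(\<lambda>n. \<Sum>e\<in>X. tau E p (\<Lambda> \<inter> jball 0 (real n)) 0 (fst e) * p) \<longlonglongrightarrow> (\<Sum>e\<in>X. two_point E \<Lambda> p 0 (fst e) * p)"
        by (intro tendsto_sum tendsto_mult_right two_point_limit(2) p)
      then have lim: "(\<lambda>n. ennreal (\<Sum>e\<in>X. tau E p (\<Lambda> \<inter> jball 0 (real n)) 0 (fst e) * p)) \<longlonglongrightarrow> ennreal (\<Sum>e\<in>X. two_point E \<Lambda> p 0 (fst e) * p)"
        by (rule tendsto_ennrealI)
      have "ennreal (\<Sum>e\<in>X. two_point E \<Lambda> p 0 (fst e) * p) \<le> ennreal (1 + deg * C) * phi E p S"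
      proof (rule LIMSEQ_le_const2[OF lim], intro exI allI impI)
        fix n assume n: "n0 \<le> n"
        have "jd 0 x \<le> real n" if "(x, y) \<in> X" for x y using n0'(2)[OF that] n by linarith
        moreover have "1 \<le> n" using n0'(1) n by simp
        ultimately show "ennreal (\<Sum>e\<in>X. tau E p (\<Lambda> \<inter> jball 0 (real n)) 0 (fst e) * p) \<le> ennreal (1 + deg * C) * phi E p S"
          using ev[of n] by (simp add: case_prod_beta)
      qed
      moreover have "sum (\<lambda>(x, y). ennreal (two_point E \<Lambda> p 0 x * p)) X = ennreal (\<Sum>e\<in>X. two_point E \<Lambda> p 0 (fst e) * p)"
        using mult_nonneg_nonneg[OF two_point_nonneg p(1)]
        by (subst sum_ennreal[symmetric]) (auto simp: case_prod_beta)
      ultimately show ?thesis by simp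
    qed
    have "phi E p \<Lambda> = (SUP X\<in>{X. finite X \<and> X \<subseteq> edge_bd \<Lambda>}. sum (\<lambda>(x, y). ennreal (two_point E \<Lambda> p 0 x * p)) X)"
      unfolding phi_def edge_bd_def by (rule nonneg_infsum_complete) simp
    also have "\<dots> \<le> ennreal (1 + deg * C) * phi E p S"
      using part by (intro SUP_least) auto
    finally show ?thesis .
  qed
  moreover have "0 < 1 + deg * C" using deg0 C(1) by (simp add: add_pos_nonneg)
  ultimately show ?thesis unfolding pc_def by blast
qed

end
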